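(* Let $E\subset\mathbb{C}$ be a compact set containing more than two points such that $\Omega:=\overline{\mathbb{C}}\setminus E$ is connected, let $g:\Lambda(r)\to\Omega$ be the normalized universal covering map, let $\mathcal{D}$ be the Dirichlet domain associated with $g$ and centered at $\infty$, and let $\tilde E$ be the set associated with $E$ (all as defined in the context). Then $$\tilde E=\partial g(\mathcal{D}),$$ the boundary of the image of $\mathcal{D}$ under $g$.
   Context: $\overline{\mathbb{C}}$ is the Riemann sphere. For $s\ge 0$, $\Lambda(s):=\{w:|w|>s\}\cup\{\infty\}$. For $E$ as in the claim there exist a unique $r=r(E)>0$ and a unique holomorphic universal covering map $g:\Lambda(r)\to\Omega$ whose Laurent expansion at infinity has the form $g(w)=w+\sum_{k=0}^\infty b_kw^{-k}$ (so $g(\infty)=\infty$). $\Omega$ carries its hyperbolic (Poincaré) metric of constant curvature $-1$. $\tilde E$ is the union of $\partial E$ and the set of points in $\Omega$ which have more than one shortest curve to $\infty$ in $\Omega$ with respect to this metric. Let $\Gamma$ be the Fuchsian group acting on $\Lambda(r)$ with $\Lambda(r)/\Gamma\cong\Omega$ and $g\circ\tau=g$ for all $\tau\in\Gamma$ (the deck group of $g$), let $\Gamma_\infty$ be the orbit of $\infty$ under $\Gamma$, and let $d(\cdot,\cdot)$ be the hyperbolic distance in $\Lambda(r)$. The Dirichlet domain associated with $g$ and centered at $\infty$ is $$\mathcal{D}:=\{w\in\Lambda(r): d(\infty,w)<d(\zeta,w)\ \text{for all } \zeta\in\Gamma_\infty,\ \zeta\neq\infty\}.$$ *)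

theory Defs
  imports "HOL-Analysis.Analysis"
begin

datatype csphere = Fin complex | Infty

primrec csphere_of_option :: "complex option \<Rightarrow> csphere" where
  "csphere_of_option None = Infty"
| "csphere_of_option (Some z) = Fin z"

instantiation csphere :: topological_space
begin

definition open_csphere :: "csphere set \<Rightarrow> bool" where
  "open_csphere U \<longleftrightarrow>
     openin (Alexandroff_compactification euclidean) (csphere_of_option -` U)"

instance
proof
  have "openin (Alexandroff_compactification (euclidean :: complex topology)) UNIV"
    using openin_topspace[of "Alexandroff_compactification (euclidean :: complex topology)"]
    by (simp add: UNIV_option_conv)
  then show "open (UNIV :: csphere set)"
    by (simp add: open_csphere_def)
next
  fix S T :: "csphere set"
  assume "open S" "open T"
  then show "open (S \<inter> T)"
    by (auto simp: open_csphere_def vimage_Int)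
next
  fix K :: "csphere set set"
  assume "\<forall>S\<in>K. open S"
  then show "open (\<Union>K)"
    by (auto simp: open_csphere_def vimage_Union)
qed

end

lemma open_csphere_iff:
  "open U \<longleftrightarrow> open (Fin -` U) \<and> (Infty \<in> U \<longrightarrow> compact (- (Fin -` U)))"
proof (cases "Infty \<in> U")
  case True
  have im: "csphere_of_option -` U = insert None (Some ` (Fin -` U))"
  proof (rule set_eqI)
    fix x show "x \<in> csphere_of_option -` U \<longleftrightarrow> x \<in> insert None (Some ` (Fin -` U))"
      using True by (cases x) auto
  qed
  have ne: "insert None (Some ` A) = Some ` B \<longleftrightarrow> False" for A B :: "complex set"
    by (metis None_notin_image_Some insertI1)
  have eq: "insert None (Some ` A) = insert None (Some ` B) \<longleftrightarrow> A = B" for A B :: "complex set"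
    by (simp add: insert_ident inj_image_eq_iff)
  have "open U \<longleftrightarrow> (\<exists>C. compact C \<and> closed C \<and> Fin -` U = UNIV - C)"
    unfolding open_csphere_def im openin_Alexandroff_compactification by (simp add: ne eq)
  also have "\<dots> \<longleftrightarrow> compact (- (Fin -` U))"
    by (metis Compl_eq_Diff_UNIV compact_imp_closed double_complement)
  finally show ?thesis
    using True compact_imp_closed[of "- (Fin -` U)"] by (simp add: open_closed) blast
next
  case False
  have "csphere_of_option -` U = Some ` (Fin -` U)"
  proof (rule set_eqI)
    fix x show "x \<in> csphere_of_option -` U \<longleftrightarrow> x \<in> Some ` (Fin -` U)"
      using False by (cases x) auto
  qed
  with False show ?thesis by (simp add: open_csphere_def)
qed

text \<open>
  \<open>chart p\<close> is a holomorphic coordinate on a neighbourhood of \<open>p\<close>, namely \<open>z\<close> if \<open>p\<close>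
  is finite and \<open>1/z\<close> if \<open>p\<close> is the point at infinity. The value of \<open>chart p\<close> at the one
  point outside its domain is irrelevant.
\<close>

fun chart :: "csphere \<Rightarrow> csphere \<Rightarrow> complex" where
  "chart (Fin a) (Fin z) = z"
| "chart (Fin a) Infty = 0"
| "chart Infty (Fin z) = inverse z"
| "chart Infty Infty = 0"

fun chart_inv :: "csphere \<Rightarrow> complex \<Rightarrow> csphere" where
  "chart_inv (Fin a) u = Fin u"
| "chart_inv Infty u = (if u = 0 then Infty else Fin (inverse u))"

text \<open>Intended for open sets \<open>S\<close>.\<close>

definition sphere_holomorphic_on :: "(csphere \<Rightarrow> csphere) \<Rightarrow> csphere set \<Rightarrow> bool" where
  "sphere_holomorphic_on f S \<longleftrightarrow>
     continuous_on S f \<and>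
     (\<forall>p\<in>S. (\<lambda>u. chart (f p) (f (chart_inv p u))) field_differentiable at (chart p p))"

definition holomorphic_universal_covering ::
    "csphere set \<Rightarrow> (csphere \<Rightarrow> csphere) \<Rightarrow> csphere set \<Rightarrow> bool" where
  "holomorphic_universal_covering C f S \<longleftrightarrow>
     simply_connected C \<and> covering_space C f S \<and> sphere_holomorphic_on f C"

definition Lambda :: "real \<Rightarrow> csphere set" where
  "Lambda s = insert Infty (Fin ` {w. norm w > s})"

definition normalized_at_Infty :: "(csphere \<Rightarrow> csphere) \<Rightarrow> bool" where
  "normalized_at_Infty g \<longleftrightarrow>
     g Infty = Infty \<and>
     (\<exists>(b :: nat \<Rightarrow> complex) R. \<forall>w. norm w > R \<longrightarrow>
        (\<exists>z. g (Fin w) = Fin z \<and> (\<lambda>k. b k / w ^ k) sums (z - w)))"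

definition normalized_universal_covering ::
    "real \<Rightarrow> (csphere \<Rightarrow> csphere) \<Rightarrow> csphere set \<Rightarrow> bool" where
  "normalized_universal_covering r g \<Omega> \<longleftrightarrow>
     r > 0 \<and> holomorphic_universal_covering (Lambda r) g \<Omega> \<and> normalized_at_Infty g"

definition deck_group :: "csphere set \<Rightarrow> (csphere \<Rightarrow> csphere) \<Rightarrow> (csphere \<Rightarrow> csphere) set" where
  "deck_group C g =
     {\<tau>. bij_betw \<tau> C C \<and> sphere_holomorphic_on \<tau> C \<and> (\<forall>w\<in>C. g (\<tau> w) = g w)}"

text \<open>
  The hyperbolic metric of curvature \<open>-1\<close> is \<open>2 |dz| / (1 - |z|\<^sup>2)\<close> on the unit disc,
  and on \<open>\<Omega>\<close> it is the metric that pulls back to this one under every holomorphic universal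
  covering of \<open>\<Omega>\<close> by the disc. \<open>hyp_density \<Omega> p\<close> is its density at \<open>p\<close> with respect to
  the coordinate \<open>chart p\<close>. The value does not depend on the covering or on the preimage of \<open>p\<close>.
\<close>

definition hyp_density :: "csphere set \<Rightarrow> csphere \<Rightarrow> real" where
  "hyp_density \<Omega> p =
     (THE \<rho>. \<exists>f z. holomorphic_universal_covering (Fin ` ball 0 1) f \<Omega> \<and>
        norm z < 1 \<and> f (Fin z) = p \<and>
        \<rho> * norm (deriv (\<lambda>u. chart p (f (Fin u))) z) = 2 / (1 - (norm z)\<^sup>2))"

definition piecewise_C1_path :: "(real \<Rightarrow> csphere) \<Rightarrow> bool" where
  "piecewise_C1_path \<gamma> \<longleftrightarrow>
     path \<gamma> \<and>
     (\<exists>S. finite S \<and> (\<forall>t\<in>{0<..<1} - S. \<exists>e>0.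
        (\<lambda>s. chart (\<gamma> t) (\<gamma> s)) C1_differentiable_on {t - e<..<t + e}))"

definition curves_between :: "csphere set \<Rightarrow> csphere \<Rightarrow> csphere \<Rightarrow> (real \<Rightarrow> csphere) set" where
  "curves_between \<Omega> p q =
     {\<gamma>. piecewise_C1_path \<gamma> \<and> path_image \<gamma> \<subseteq> \<Omega> \<and> pathstart \<gamma> = p \<and> pathfinish \<gamma> = q}"

text \<open>
  The integrand is the speed of \<open>\<gamma>\<close> at time \<open>t\<close>, computed in the coordinate \<open>chart (\<gamma> t)\<close>;
  like any conformal line element it does not depend on the choice of coordinate.
\<close>

definition hyp_length :: "csphere set \<Rightarrow> (real \<Rightarrow> csphere) \<Rightarrow> ennreal" where
  "hyp_length \<Omega> \<gamma> =
     (\<integral>\<^sup>+t\<in>{0..1}. ennreal (hyp_density \<Omega> (\<gamma> t) *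
        norm (vector_derivative (\<lambda>s. chart (\<gamma> t) (\<gamma> s)) (at t))) \<partial>lborel)"

definition hyp_dist :: "csphere set \<Rightarrow> csphere \<Rightarrow> csphere \<Rightarrow> ennreal" where
  "hyp_dist \<Omega> p q = (INF \<gamma>\<in>curves_between \<Omega> p q. hyp_length \<Omega> \<gamma>)"

definition shortest_curve :: "csphere set \<Rightarrow> csphere \<Rightarrow> csphere \<Rightarrow> (real \<Rightarrow> csphere) \<Rightarrow> bool" where
  "shortest_curve \<Omega> p q \<gamma> \<longleftrightarrow>
     \<gamma> \<in> curves_between \<Omega> p q \<and>
     (\<forall>\<delta>\<in>curves_between \<Omega> p q. hyp_length \<Omega> \<gamma> \<le> hyp_length \<Omega> \<delta>)"

text \<open>
  Curves are paths up to orientation-preserving reparametrization. Reparametrizations may be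
  constant on intervals, since a path may be stationary there; so two paths are identified if
  both arise from a common path by weakly monotone reparametrization.
\<close>

definition monotone_reparam :: "(real \<Rightarrow> real) \<Rightarrow> bool" where
  "monotone_reparam \<phi> \<longleftrightarrow>
     continuous_on {0..1} \<phi> \<and> mono_on {0..1} \<phi> \<and> \<phi> 0 = 0 \<and> \<phi> 1 = 1"

definition same_curve :: "(real \<Rightarrow> csphere) \<Rightarrow> (real \<Rightarrow> csphere) \<Rightarrow> bool" where
  "same_curve \<gamma> \<delta> \<longleftrightarrow>
     (\<exists>\<sigma> \<phi> \<psi>. path \<sigma> \<and> monotone_reparam \<phi> \<and> monotone_reparam \<psi> \<and>
        (\<forall>t\<in>{0..1}. \<gamma> t = \<sigma> (\<phi> t) \<and> \<delta> t = \<sigma> (\<psi> t)))"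

definition E_tilde :: "complex set \<Rightarrow> csphere set" where
  "E_tilde E =
     (let \<Omega> = - (Fin ` E) in
      Fin ` frontier E \<union>
      {p\<in>\<Omega>. \<exists>\<gamma> \<delta>. shortest_curve \<Omega> p Infty \<gamma> \<and> shortest_curve \<Omega> p Infty \<delta> \<and>
                 \<not> same_curve \<gamma> \<delta>})"

definition dirichlet_domain :: "real \<Rightarrow> (csphere \<Rightarrow> csphere) \<Rightarrow> csphere set" where
  "dirichlet_domain r g =
     {w \<in> Lambda r. \<forall>\<zeta> \<in> (\<lambda>\<tau>. \<tau> Infty) ` deck_group (Lambda r) g. \<zeta> \<noteq> Infty \<longrightarrow>
        hyp_dist (Lambda r) Infty w < hyp_dist (Lambda r) \<zeta> w}"

end

(* A shortest curve from p to infinity lifts, through the covering of the complement of E by the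
   unit disc that sends 0 to infinity, to a path ending at 0; it is shortest exactly when the lift
   is a Euclidean ray from a point of minimal modulus in the fibre over p. The deck group acts
   simply transitively on fibres, so the Dirichlet domain corresponds to the set M of points of the
   disc that are the unique point of minimal modulus in their fibre. Hence the image of the Dirichlet
   domain is the set of points with just one shortest curve to infinity. M is open, and M contains
   the half-open ray from 0 to any b of minimal modulus in its fibre, so this image is open and
   dense in the complement of E, and the description of its boundary follows. *)

theory Submission
  imports Defs "HOL-Complex_Analysis.Complex_Analysis"
begin

subsection \<open>Automorphisms and coverings of the disc\<close>

text \<open>Complex analysis is done in the plane: for a point \<open>e\<close> of \<open>E\<close>
  the map 1/(z - e) is injective on the whole complement of \<open>E\<close> and sends infinity to
  0, so the covering becomes a holomorphic covering of an open plane set by the disc. Three points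
  then need an argument. Strictness inside a ray: for an automorphism that sends a to 0, |\<phi> z|
  = |z| is the hyperbolic bisector of 0 and a. It is given by an explicit inequality, and a ray from
  0 whose endpoint is still on the side of 0, or on the bisector, lies before its endpoint strictly
  on the side of 0. Uniqueness of the shortest curve: projecting a curve to a diameter does not
  increase its length, and equality forces the velocity to stay along the diameter, in one
  direction. This yields a ray up to monotone reparametrization. Distances from other points of the
  orbit of infinity: a deck transformation \<tau> composed with r/z is again a covering of
  \<open>Lambda r\<close>, centred at \<tau>(infinity), so the formula for distances from the centre
  applies to it directly.\<close>

abbreviation disc :: "complex set" where "disc \<equiv> ball 0 1"

lemma disc_denominator_nonzero:
  fixes w z :: complex
  assumes "norm w < 1" "norm z < 1"
  shows "1 - cnj w * z \<noteq> 0"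
proof
  assume "1 - cnj w * z = 0"
  then have "norm (cnj w * z) = 1"
    by simp
  moreover have "norm (cnj w * z) < 1"
    using assms norm_mult_less[of "cnj w" 1 z 1] by simp
  ultimately show False
    by simp
qed

lemma Moebius_function_has_derivative:
  assumes "norm w < 1" "norm z < 1"
  shows "(Moebius_function 0 w has_field_derivative
            of_real (1 - (norm w)\<^sup>2) / (1 - cnj w * z)\<^sup>2) (at z)"
proof -
  have nz: "1 - cnj w * z \<noteq> 0"
    using assms by (rule disc_denominator_nonzero)
  have sq: "complex_of_real ((norm w)\<^sup>2) = w * cnj w"
    by (metis complex_norm_square)
  have "((\<lambda>z. (z - w) / (1 - cnj w * z)) has_field_derivative
            (1 * (1 - cnj w * z) - (z - w) * (- cnj w)) / (1 - cnj w * z)\<^sup>2) (at z)"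
    using nz by (auto intro!: derivative_eq_intros simp: power2_eq_square)
  moreover have eq: "1 * (1 - cnj w * z) - (z - w) * (- cnj w) = of_real (1 - (norm w)\<^sup>2)"
    using sq by (simp add: algebra_simps)
  ultimately have "((\<lambda>z. (z - w) / (1 - cnj w * z)) has_field_derivative
            of_real (1 - (norm w)\<^sup>2) / (1 - cnj w * z)\<^sup>2) (at z)"
    by (simp only: eq)
  then show ?thesis
    by (simp only: Moebius_function_simple[abs_def])
qed

lemma scale_in_disc: "b \<in> disc \<Longrightarrow> 0 \<le> t \<Longrightarrow> t \<le> 1 \<Longrightarrow> of_real t * b \<in> disc"
  using mult_left_le_one_le[of "norm b" t] by (simp add: norm_mult)

lemma Moebius_function_in_disc: "norm w < 1 \<Longrightarrow> z \<in> disc \<Longrightarrow> Moebius_function 0 w z \<in> disc"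
  by (simp add: Moebius_function_norm_lt_1)

text \<open>The inverse is an explicit argument because it is used throughout: Schwarz's lemma is
  applied to both maps, and \<open>\<psi> 0\<close>, the point that \<phi> sends to the centre,
  determines the modulus of \<phi>.\<close>

definition disc_automorphism :: "(complex \<Rightarrow> complex) \<Rightarrow> (complex \<Rightarrow> complex) \<Rightarrow> bool" where
  "disc_automorphism \<phi> \<psi> \<longleftrightarrow>
     \<phi> holomorphic_on disc \<and> \<psi> holomorphic_on disc \<and> \<phi> \<in> disc \<rightarrow> disc \<and> \<psi> \<in> disc \<rightarrow> disc \<and>
     (\<forall>z\<in>disc. \<psi> (\<phi> z) = z) \<and> (\<forall>z\<in>disc. \<phi> (\<psi> z) = z)"

lemma disc_automorphism_sym: "disc_automorphism \<phi> \<psi> \<Longrightarrow> disc_automorphism \<psi> \<phi>"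
  by (auto simp: disc_automorphism_def)

lemma disc_automorphism_Moebius:
  assumes "norm a < 1"
  shows "disc_automorphism (Moebius_function 0 a) (Moebius_function 0 (- a))"
  using assms Moebius_function_compose[of a "- a"] Moebius_function_compose[of "- a" a]
  by (auto simp: disc_automorphism_def Moebius_function_holomorphic Moebius_function_norm_lt_1)

lemma disc_automorphism_compose:
  assumes "disc_automorphism \<phi> \<psi>" "disc_automorphism \<phi>' \<psi>'"
  shows "disc_automorphism (\<phi>' \<circ> \<phi>) (\<psi> \<circ> \<psi>')"
proof -
  note a = assms[unfolded disc_automorphism_def image_subset_iff_funcset[symmetric]]
  have "\<phi>' \<circ> \<phi> holomorphic_on disc"
    by (rule holomorphic_on_compose_gen[where t = disc]) (use a in blast)+
  moreover have "\<psi> \<circ> \<psi>' holomorphic_on disc"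
    by (rule holomorphic_on_compose_gen[where t = disc]) (use a in blast)+
  ultimately show ?thesis
    using assms unfolding disc_automorphism_def by (simp add: Pi_iff)
qed

text \<open>Schwarz's lemma for \<phi> gives one inequality; for \<psi>, which also fixes 0, it
  gives the other.\<close>

lemma disc_automorphism_norm_eq:
  assumes aut: "disc_automorphism \<phi> \<psi>" and 0: "\<phi> 0 = 0" and z: "z \<in> disc"
  shows "norm (\<phi> z) = norm z"
proof -
  have le: "norm (f w) \<le> norm w"
    if "f holomorphic_on disc" "f 0 = 0" "f \<in> disc \<rightarrow> disc" "w \<in> disc" for f w
    using Schwarz_Lemma(1)[of f w] that by (auto simp: Pi_iff)
  have "\<psi> 0 = 0"
    using aut 0 by (auto simp: disc_automorphism_def dest: bspec[of _ _ 0])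
  then have "norm (\<psi> (\<phi> z)) \<le> norm (\<phi> z)"
    using aut z by (intro le) (auto simp: disc_automorphism_def)
  moreover have "norm (\<phi> z) \<le> norm z"
    using aut z 0 by (intro le) (auto simp: disc_automorphism_def)
  ultimately show ?thesis
    using aut z by (auto simp: disc_automorphism_def)
qed

text \<open>Precomposing \<phi> with the inverse of the Moebius map that vanishes at
  \<open>\<psi> 0\<close> gives an automorphism fixing 0, which preserves moduli. So \<phi> is that
  Moebius map as far as moduli are concerned.\<close>

lemma disc_automorphism_norm:
  assumes aut: "disc_automorphism \<phi> \<psi>" and z: "z \<in> disc"
  shows "norm (\<phi> z) = norm (Moebius_function 0 (\<psi> 0) z)"
proof -
  define a where "a = \<psi> 0"
  have a: "norm a < 1"
    using aut by (auto simp: disc_automorphism_def a_def)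
  have "disc_automorphism (\<phi> \<circ> Moebius_function 0 (- a)) (Moebius_function 0 a \<circ> \<psi>)"
    by (rule disc_automorphism_compose)
       (use a aut disc_automorphism_Moebius disc_automorphism_sym in auto)
  moreover have "(\<phi> \<circ> Moebius_function 0 (- a)) 0 = 0"
    using aut by (simp add: Moebius_function_of_zero a_def disc_automorphism_def)
  moreover have "Moebius_function 0 a z \<in> disc"
    using a z by (rule Moebius_function_in_disc)
  ultimately have "norm ((\<phi> \<circ> Moebius_function 0 (- a)) (Moebius_function 0 a z))
      = norm (Moebius_function 0 a z)"
    by (rule disc_automorphism_norm_eq)
  then show ?thesis
    using Moebius_function_compose[of "- a" a z] a z by (simp add: a_def)
qed

text \<open>Moebius maps on both sides move \<open>z\<close> and \<open>\<phi> z\<close> to 0; the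
  claim is then the bound on the derivative at 0 in Schwarz's lemma.\<close>

lemma Schwarz_Pick_derivative:
  assumes hol: "\<phi> holomorphic_on disc" and into: "\<phi> \<in> disc \<rightarrow> disc" and z: "z \<in> disc"
  shows "norm (deriv \<phi> z) * (1 - (norm z)\<^sup>2) \<le> 1 - (norm (\<phi> z))\<^sup>2"
proof -
  define w where "w = \<phi> z"
  have w: "norm w < 1" and z': "norm z < 1"
    using into z by (auto simp: w_def)
  define F where "F = Moebius_function 0 w \<circ> \<phi> \<circ> Moebius_function 0 (- z)"
  have holF: "F holomorphic_on disc"
    unfolding F_def using w z' into hol
    by (intro holomorphic_on_compose_gen[of _ _ _ disc] Moebius_function_holomorphic)
       (auto simp: Moebius_function_norm_lt_1)
  have F0: "F 0 = 0"
    by (simp add: F_def Moebius_function_of_zero w_def Moebius_function_eq_zero)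
  have F1: "norm (F x) < 1" if "norm x < 1" for x
  proof -
    have "\<phi> (Moebius_function 0 (- z) x) \<in> disc"
      using that z' by (intro funcset_mem[OF into]) (simp add: Moebius_function_norm_lt_1)
    then show ?thesis
      using w Moebius_function_norm_lt_1[of w "\<phi> (Moebius_function 0 (- z) x)" 0] by (simp add: F_def)
  qed
  have d1: "(Moebius_function 0 (- z) has_field_derivative of_real (1 - (norm z)\<^sup>2)) (at 0)"
    using Moebius_function_has_derivative[of "- z" 0] z' by simp
  have d2: "(\<phi> has_field_derivative deriv \<phi> z) (at (Moebius_function 0 (- z) 0))"
    using holomorphic_derivI[OF hol] z by (simp add: Moebius_function_of_zero)
  have nw: "1 - cnj w * w \<noteq> 0"
    using w by (intro disc_denominator_nonzero)
  have "1 - cnj w * w = of_real (1 - (norm w)\<^sup>2)"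
    by (metis complex_norm_square mult.commute of_real_1 of_real_diff)
  then have d3: "(Moebius_function 0 w has_field_derivative 1 / of_real (1 - (norm w)\<^sup>2))
      (at (\<phi> (Moebius_function 0 (- z) 0)))"
    using Moebius_function_has_derivative[of w w] w nw
    by (simp add: Moebius_function_of_zero w_def power2_eq_square)
  have "(F has_field_derivative
      1 / of_real (1 - (norm w)\<^sup>2) * (deriv \<phi> z * of_real (1 - (norm z)\<^sup>2))) (at 0)"
    unfolding F_def comp_assoc
    by (rule DERIV_chain[OF _ DERIV_chain[OF d2 d1]]) (use d3 in simp)
  then have "deriv F 0 = 1 / of_real (1 - (norm w)\<^sup>2) * (deriv \<phi> z * of_real (1 - (norm z)\<^sup>2))"
    by (rule DERIV_imp_deriv)
  moreover have pos: "(norm w)\<^sup>2 < 1" "(norm z)\<^sup>2 < 1"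
    using w z' by (simp_all add: abs_square_less_1)
  ultimately have "norm (deriv F 0) = norm (deriv \<phi> z) * (1 - (norm z)\<^sup>2) / (1 - (norm w)\<^sup>2)"
    by (simp only: norm_mult norm_divide norm_of_real) simp
  moreover have "norm (deriv F 0) \<le> 1"
    using Schwarz_Lemma(2)[OF holF F0 F1, of 0] by simp
  ultimately show ?thesis
    using pos by (simp add: w_def)
qed

text \<open>Schwarz-Pick holds for \<phi> at \<open>z\<close> and for \<psi> at
  \<open>\<phi> z\<close>, and the two derivatives have product 1, so both inequalities are
  equalities.\<close>

lemma disc_automorphism_derivative:
  assumes aut: "disc_automorphism \<phi> \<psi>" and z: "z \<in> disc"
  shows "norm (deriv \<phi> z) * (1 - (norm z)\<^sup>2) = 1 - (norm (\<phi> z))\<^sup>2"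
proof -
  have hol: "\<phi> holomorphic_on disc" "\<psi> holomorphic_on disc" and \<phi>z: "\<phi> z \<in> disc"
    and into: "\<phi> \<in> disc \<rightarrow> disc" "\<psi> \<in> disc \<rightarrow> disc"
    and inv: "\<And>x. x \<in> disc \<Longrightarrow> \<psi> (\<phi> x) = x"
    using aut z by (auto simp: disc_automorphism_def)
  have "((\<psi> \<circ> \<phi>) has_field_derivative deriv \<psi> (\<phi> z) * deriv \<phi> z) (at z)"
    using hol z \<phi>z by (intro DERIV_chain holomorphic_derivI[of _ disc]) auto
  moreover have "((\<psi> \<circ> \<phi>) has_field_derivative 1) (at z)"
    by (rule has_field_derivative_transform_within_open[OF DERIV_ident, of disc])
       (use z inv in auto)
  ultimately have prod: "norm (deriv \<psi> (\<phi> z)) * norm (deriv \<phi> z) = 1"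
    by (metis DERIV_unique norm_mult norm_one)
  have "norm (deriv \<psi> (\<phi> z)) * (1 - (norm (\<phi> z))\<^sup>2) \<le> 1 - (norm z)\<^sup>2"
    using Schwarz_Pick_derivative[OF hol(2) into(2) \<phi>z] inv z by simp
  then have "norm (deriv \<phi> z) * (norm (deriv \<psi> (\<phi> z)) * (1 - (norm (\<phi> z))\<^sup>2))
      \<le> norm (deriv \<phi> z) * (1 - (norm z)\<^sup>2)"
    by (simp add: mult_left_mono)
  moreover have "norm (deriv \<phi> z) * (norm (deriv \<psi> (\<phi> z)) * (1 - (norm (\<phi> z))\<^sup>2)) =
      (norm (deriv \<psi> (\<phi> z)) * norm (deriv \<phi> z)) * (1 - (norm (\<phi> z))\<^sup>2)"
    by (simp only: mult_ac)
  ultimately have "1 - (norm (\<phi> z))\<^sup>2 \<le> norm (deriv \<phi> z) * (1 - (norm z)\<^sup>2)"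
    by (simp only: prod mult_1)
  then show ?thesis
    using Schwarz_Pick_derivative[OF hol(1) into(1) z] by simp
qed

text \<open>Describes the two sides of the hyperbolic perpendicular bisector of 0 and
  \<open>a\<close>. After squaring and clearing denominators the difference contains the positive
  factor 1 - |z|^2, and cancelling it leaves an inequality that is easy to follow along a
  ray.\<close>

lemma Moebius_norm_le_iff:
  assumes a: "norm a < 1" and z: "norm z < 1"
  shows "norm (Moebius_function 0 a z) \<le> norm z \<longleftrightarrow>
           (norm a)\<^sup>2 * (1 + (norm z)\<^sup>2) \<le> 2 * Re (cnj a * z)"
    and "norm z \<le> norm (Moebius_function 0 a z) \<longleftrightarrow>
           2 * Re (cnj a * z) \<le> (norm a)\<^sup>2 * (1 + (norm z)\<^sup>2)"
proof -
  define A B s where "A = (norm a)\<^sup>2" and "B = (norm z)\<^sup>2" and "s = Re (cnj a * z)"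
  have nz: "norm (1 - cnj a * z) > 0"
    using disc_denominator_nonzero[OF a z] by simp
  have B1: "B < 1"
    using z by (simp add: B_def abs_square_less_1)
  have num: "(norm (z - a))\<^sup>2 = B - 2 * s + A"
    unfolding A_def B_def s_def cmod_power2 by (simp add: power2_eq_square algebra_simps)
  have den: "(norm (1 - cnj a * z))\<^sup>2 = 1 - 2 * s + A * B"
    unfolding A_def B_def s_def cmod_power2 by (simp add: power2_eq_square algebra_simps)
  have M: "norm (Moebius_function 0 a z) = norm (z - a) / norm (1 - cnj a * z)"
    by (simp add: Moebius_function_simple norm_divide)
  have fact: "B - 2 * s + A - B * (1 - 2 * s + A * B) = (1 - B) * (A * (1 + B) - 2 * s)"
    by (simp add: algebra_simps)
  have "norm (Moebius_function 0 a z) \<le> norm z \<longleftrightarrow> norm (z - a) \<le> norm z * norm (1 - cnj a * z)"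
    using nz by (simp add: M pos_divide_le_eq)
  also have "\<dots> \<longleftrightarrow> (norm (z - a))\<^sup>2 \<le> (norm z * norm (1 - cnj a * z))\<^sup>2"
    by (simp add: power_mono_iff)
  also have "\<dots> \<longleftrightarrow> B - 2 * s + A - B * (1 - 2 * s + A * B) \<le> 0"
    by (simp add: num den power_mult_distrib B_def[symmetric])
  also have "\<dots> \<longleftrightarrow> (1 - B) * (A * (1 + B) - 2 * s) \<le> 0"
    by (simp only: fact)
  also have "\<dots> \<longleftrightarrow> A * (1 + B) \<le> 2 * s"
    using B1 by (simp add: mult_le_0_iff)
  finally show "norm (Moebius_function 0 a z) \<le> norm z \<longleftrightarrow>
           (norm a)\<^sup>2 * (1 + (norm z)\<^sup>2) \<le> 2 * Re (cnj a * z)"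
    by (simp add: A_def B_def s_def)
  have "norm z \<le> norm (Moebius_function 0 a z) \<longleftrightarrow> norm z * norm (1 - cnj a * z) \<le> norm (z - a)"
    using nz by (simp add: M pos_le_divide_eq)
  also have "\<dots> \<longleftrightarrow> (norm z * norm (1 - cnj a * z))\<^sup>2 \<le> (norm (z - a))\<^sup>2"
    by (simp add: power_mono_iff)
  also have "\<dots> \<longleftrightarrow> 0 \<le> B - 2 * s + A - B * (1 - 2 * s + A * B)"
    by (simp add: num den power_mult_distrib B_def[symmetric])
  also have "\<dots> \<longleftrightarrow> 0 \<le> (1 - B) * (A * (1 + B) - 2 * s)"
    by (simp only: fact)
  also have "\<dots> \<longleftrightarrow> 2 * s \<le> A * (1 + B)"
    using B1 by (simp add: zero_le_mult_iff)
  finally show "norm z \<le> norm (Moebius_function 0 a z) \<longleftrightarrow>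
           2 * Re (cnj a * z) \<le> (norm a)\<^sup>2 * (1 + (norm z)\<^sup>2)"
    by (simp add: A_def B_def s_def)
qed

text \<open>If the endpoint \<open>b\<close> of a ray is no farther from \<open>0\<close> than from \<open>a = \<psi> 0\<close>, then the
  interior points of the ray are strictly nearer to \<open>0\<close>.\<close>

lemma disc_automorphism_ray:
  assumes aut: "disc_automorphism \<phi> \<psi>" and ne: "\<phi> 0 \<noteq> 0" and b: "b \<in> disc"
    and t: "0 \<le> t" "t < 1" and far: "norm b \<le> norm (\<phi> b)"
  shows "norm (of_real t * b) < norm (\<phi> (of_real t * b))"
proof (rule ccontr)
  assume "\<not> ?thesis"
  then have near: "norm (\<phi> (of_real t * b)) \<le> norm (of_real t * b)"
    by simp
  define a where "a = \<psi> 0"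
  have a: "norm a < 1" and a0: "a \<noteq> 0"
    using aut ne by (auto simp: disc_automorphism_def a_def dest: bspec[of _ _ 0])
  have b1: "norm b < 1"
    using b by simp
  have tb: "norm (of_real t * b) < 1"
    using scale_in_disc[OF b t(1)] t(2) by simp
  define B s where "B = (norm b)\<^sup>2" and "s = Re (cnj a * b)"
  have B: "0 \<le> B" "B < 1"
    using b1 by (auto simp: B_def abs_square_less_1)
  have 1: "(norm a)\<^sup>2 * (1 + t\<^sup>2 * B) \<le> 2 * (t * s)"
    using near tb a disc_automorphism_norm[OF aut, of "of_real t * b"]
      Moebius_norm_le_iff(1)[OF a tb]
    by (simp add: a_def B_def s_def norm_mult power_mult_distrib algebra_simps)
  have 2: "2 * s \<le> (norm a)\<^sup>2 * (1 + B)"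
    using far b1 a disc_automorphism_norm[OF aut b] Moebius_norm_le_iff(2)[OF a b1]
    by (simp add: a_def B_def s_def)
  \<comment> \<open>Eliminates \<open>s\<close> between \<open>1\<close> and \<open>t\<close> times
    \<open>2\<close>. Cancelling |a|^2 > 0 leaves (1 - t)(1 - tB) \<le> 0, although both factors are
    positive.\<close>
  have "(norm a)\<^sup>2 * (1 + t\<^sup>2 * B) \<le> (norm a)\<^sup>2 * (t * (1 + B))"
    using 1 mult_left_mono[OF 2 t(1)] by (simp add: algebra_simps)
  then have "1 + t\<^sup>2 * B \<le> t * (1 + B)"
    using a0 by simp
  then have "(1 - t) * (1 - t * B) \<le> 0"
    by (simp add: algebra_simps power2_eq_square)
  moreover have "t * B < 1"
    using t B mult_left_le_one_le[of B t] by linarith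
  ultimately show False
    using t by (simp add: mult_le_0_iff)
qed

section \<open>Holomorphic coverings of a plane open set by the unit disc\<close>

locale disc_covering =
  fixes q :: "complex \<Rightarrow> complex" and W :: "complex set"
  assumes cov: "covering_space disc q W" and hol: "q holomorphic_on disc" and openW: "open W"
begin

lemma maps: "q \<in> disc \<rightarrow> W" and surj: "q ` disc = W"
  using covering_space_imp_surjective[OF cov] by auto

text \<open>The covering property supplies only a local homeomorphism; an injective holomorphic map
  has a holomorphic inverse and nonvanishing derivative, which upgrades it.\<close>

lemma local_inverse:
  assumes "z \<in> disc"
  obtains U V Q where "open U" "z \<in> U" "U \<subseteq> disc" "open V" "V \<subseteq> W" "q ` U = V"
    "Q holomorphic_on V" "Q ` V = U" "\<And>x. x \<in> U \<Longrightarrow> Q (q x) = x" "\<And>y. y \<in> V \<Longrightarrow> q (Q y) = y"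
    "\<And>x. x \<in> U \<Longrightarrow> deriv q x \<noteq> 0"
proof -
  obtain U V p where U: "z \<in> U" "openin (top_of_set disc) U"
    and V: "openin (top_of_set W) V" and hom: "homeomorphism U V q p"
    using covering_space_local_homeomorphism[OF cov assms] by metis
  have oU: "open U" "U \<subseteq> disc" and oV: "open V" "V \<subseteq> W"
    using U V openW openin_open_eq[of disc U] openin_open_eq[of W V] by auto
  have im: "q ` U = V"
    using hom by (simp add: homeomorphism_def)
  have inj: "inj_on q U"
    using hom by (metis homeomorphism_apply1 inj_on_inverseI)
  have holU: "q holomorphic_on U"
    using hol oU(2) holomorphic_on_subset by blast
  obtain Q where Q: "Q holomorphic_on (q ` U)" "\<And>x. x \<in> U \<Longrightarrow> deriv q x * deriv Q (q x) = 1"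
    "\<And>x. x \<in> U \<Longrightarrow> Q (q x) = x"
    using holomorphic_has_inverse[OF holU oU(1) inj] by metis
  show thesis
  proof (rule that[OF oU(1) U(1) oU(2) oV im, of Q])
    show "Q holomorphic_on V" "Q ` V = U"
      using Q im by (auto simp: image_image)
    show "Q (q x) = x" "deriv q x \<noteq> 0" if "x \<in> U" for x
      using Q(2,3)[OF that] by auto
    show "q (Q y) = y" if "y \<in> V" for y
      using Q(3) that im by auto
  qed
qed

lemma deriv_nonzero: "z \<in> disc \<Longrightarrow> deriv q z \<noteq> 0"
  using local_inverse by metis

text \<open>Near each point a continuous lift of \<open>f\<close> coincides with a holomorphic local
  inverse of \<open>q\<close> applied to \<open>f\<close>.\<close>

lemma lift_holomorphic:
  assumes S: "open S" and f: "f holomorphic_on S" and h: "continuous_on S h" "h \<in> S \<rightarrow> disc"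
    and fh: "\<And>x. x \<in> S \<Longrightarrow> q (h x) = f x"
  shows "h holomorphic_on S"
proof -
  have "h field_differentiable at x" if x: "x \<in> S" for x
  proof -
    have "h x \<in> disc"
      using h x by auto
    then obtain U V Q where UV: "open U" "h x \<in> U" "open V" "q ` U = V" "Q holomorphic_on V"
      "\<And>y. y \<in> U \<Longrightarrow> Q (q y) = y"
      using local_inverse by metis
    define T where "T = S \<inter> h -` U"
    have T: "open T" "x \<in> T"
      using UV x S h by (auto simp: T_def intro: continuous_open_preimage)
    have "f x \<in> V"
      using UV(2,4) fh[OF x] by force
    then have "(Q \<circ> f) field_differentiable at x"
      using f S x UV(3,5) by (intro field_differentiable_compose)
        (auto simp: holomorphic_on_imp_differentiable_at)
    moreover have "(Q \<circ> f) y = h y" if "y \<in> T" for y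
      using that UV(6)[of "h y"] fh[of y] by (simp add: T_def)
    ultimately show ?thesis
      using T has_field_derivative_transform_within_open[of "Q \<circ> f" _ x T h]
      unfolding field_differentiable_def by blast
  qed
  then show ?thesis
    using S by (simp add: holomorphic_on_open field_differentiable_def)
qed

lemma lift_exists:
  assumes f: "f holomorphic_on disc" "f \<in> disc \<rightarrow> W" and a: "a \<in> disc" and z: "z \<in> disc"
    and eq: "f z = q a"
  obtains h where "h holomorphic_on disc" "h \<in> disc \<rightarrow> disc" "h z = a" "\<And>x. x \<in> disc \<Longrightarrow> q (h x) = f x"
proof -
  have "simply_connected disc" "locally path_connected disc"
    by (simp_all add: convex_imp_simply_connected convex_imp_locally_path_connected)
  then obtain h where "continuous_on disc h" "h \<in> disc \<rightarrow> disc" "h z = a"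
    "\<And>x. x \<in> disc \<Longrightarrow> q (h x) = f x"
    using covering_space_lift_strong[OF cov a z _ _ holomorphic_on_imp_continuous_on[OF f(1)] f(2) eq]
    by metis
  then show thesis
    using lift_holomorphic[OF open_ball f(1)] that by metis
qed

lemma lift_unique:
  assumes "h \<in> disc \<rightarrow> disc" "h' \<in> disc \<rightarrow> disc" "continuous_on disc h" "continuous_on disc h'"
    and "\<And>x. x \<in> disc \<Longrightarrow> q (h x) = q (h' x)" and "z \<in> disc" "h z = h' z" and "x \<in> disc"
  shows "h x = h' x"
proof (rule covering_space_lift_unique[OF cov, where T = disc and f = "\<lambda>x. q (h x)" and a = z
      and ?g1.0 = h and ?g2.0 = h'])
  show "continuous_on disc (\<lambda>x. q (h x))"
    using assms(1,3) holomorphic_on_imp_continuous_on[OF hol]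
    by (intro continuous_on_compose2[of disc q disc h]) auto
  show "(\<lambda>x. q (h x)) \<in> disc \<rightarrow> W"
    using assms(1) maps by auto
qed (use assms in \<open>simp_all\<close>)

end

text \<open>Each covering is lifted through the other; the two composites are lifts of a covering
  through itself with a fixed point, hence the identity. With \<open>q1 = q2\<close> this is
  transitivity of the deck group on fibres, with different coverings it makes the hyperbolic density
  well defined.\<close>

lemma disc_coverings_automorphism:
  assumes "disc_covering q1 W" "disc_covering q2 W"
    and z1: "z1 \<in> disc" and z2: "z2 \<in> disc" and eq: "q1 z1 = q2 z2"
  obtains \<phi> \<psi> where "disc_automorphism \<phi> \<psi>" "\<phi> z1 = z2"
    "\<And>z. z \<in> disc \<Longrightarrow> q2 (\<phi> z) = q1 z" "\<And>z. z \<in> disc \<Longrightarrow> q1 (\<psi> z) = q2 z"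
proof -
  interpret q1: disc_covering q1 W by fact
  interpret q2: disc_covering q2 W by fact
  obtain \<phi> where \<phi>: "\<phi> holomorphic_on disc" "\<phi> \<in> disc \<rightarrow> disc" "\<phi> z1 = z2"
    "\<And>x. x \<in> disc \<Longrightarrow> q2 (\<phi> x) = q1 x"
    using q2.lift_exists[OF q1.hol q1.maps z2 z1 eq] by metis
  obtain \<psi> where \<psi>: "\<psi> holomorphic_on disc" "\<psi> \<in> disc \<rightarrow> disc" "\<psi> z2 = z1"
    "\<And>x. x \<in> disc \<Longrightarrow> q1 (\<psi> x) = q2 x"
    using q1.lift_exists[OF q2.hol q2.maps z1 z2 eq[symmetric]] by metis
  have cont: "continuous_on disc (\<psi> \<circ> \<phi>)" "continuous_on disc (\<phi> \<circ> \<psi>)"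
    using \<phi>(1,2) \<psi>(1,2)
    by (metis continuous_on_compose holomorphic_on_imp_continuous_on continuous_on_subset
        image_subset_iff_funcset)+
  have "(\<psi> \<circ> \<phi>) x = id x" if "x \<in> disc" for x
    by (rule q1.lift_unique[OF _ _ cont(1) _ _ z1 _ that]) (use \<phi> \<psi> in \<open>auto simp: Pi_iff\<close>)
  moreover have "(\<phi> \<circ> \<psi>) x = id x" if "x \<in> disc" for x
    by (rule q2.lift_unique[OF _ _ cont(2) _ _ z2 _ that]) (use \<phi> \<psi> in \<open>auto simp: Pi_iff\<close>)
  ultimately have "disc_automorphism \<phi> \<psi>"
    using \<phi> \<psi> by (simp add: disc_automorphism_def)
  then show thesis
    using that \<phi> \<psi> by blast
qed

section \<open>Points of minimal modulus in their fibre\<close>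

context disc_covering
begin

text \<open>The set M of the overview, the Dirichlet domain seen in the disc.\<close>

definition unique_min :: "complex set" where
  "unique_min = {b \<in> disc. \<forall>b'\<in>disc. q b' = q b \<longrightarrow> b' \<noteq> b \<longrightarrow> norm b < norm b'}"

text \<open>The part of the fibre inside the closed disc through one of its points is compact, and
  the points outside that disc cannot compete.\<close>

lemma fibre_attains_min:
  assumes "p \<in> W"
  obtains b where "b \<in> disc" "q b = p" "\<And>b'. b' \<in> disc \<Longrightarrow> q b' = p \<Longrightarrow> norm b \<le> norm b'"
proof -
  obtain b0 where b0: "b0 \<in> disc" "q b0 = p"
    using surj assms by auto
  define K where "K = cball 0 (norm b0) \<inter> q -` {p}"
  have sub: "cball 0 (norm b0) \<subseteq> disc"
    using b0 by auto
  have "continuous_on (cball 0 (norm b0)) q"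
    using holomorphic_on_imp_continuous_on[OF hol] sub continuous_on_subset by blast
  then have "compact K"
    unfolding K_def by (metis bounded_cball bounded_Int closed_cball closed_singleton
        compact_eq_bounded_closed continuous_on_closed_vimage Int_commute)
  moreover have "b0 \<in> K"
    using b0 by (simp add: K_def)
  ultimately obtain b where b: "b \<in> K" "\<And>b'. b' \<in> K \<Longrightarrow> norm b \<le> norm b'"
    using continuous_attains_inf[of K norm] continuous_on_norm_id by blast
  show thesis
  proof (rule that[of b])
    show "b \<in> disc" "q b = p"
      using b(1) sub by (auto simp: K_def)
    fix b' assume b': "b' \<in> disc" "q b' = p"
    show "norm b \<le> norm b'"
    proof (cases "b' \<in> K")
      case False
      then have "norm b0 < norm b'"
        using b' by (simp add: K_def)
      then show ?thesis
        using b(2)[OF \<open>b0 \<in> K\<close>] by simp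
    qed (use b in auto)
  qed
qed

text \<open>Suppose points \<open>x n\<close> outside the set tend to \<open>b\<close>. Their
  competitors \<open>y n\<close> stay in a compact part of the disc, and any limit point lies in the
  fibre of \<open>b\<close> with modulus at most |b|, so it is \<open>b\<close>. Then
  \<open>x n\<close> and \<open>y n\<close> are distinct points near \<open>b\<close> with the same
  image, against local injectivity.\<close>

lemma open_unique_min: "open unique_min"
proof -
  have "\<exists>e>0. ball b e \<subseteq> unique_min" if b: "b \<in> unique_min" for b
  proof (rule ccontr)
    assume no: "\<not> ?thesis"
    have bd: "b \<in> disc"
      using b by (simp add: unique_min_def)
    \<comment> \<open>The radii tend to 0 and never exceed (1 - |b|)/2, so all \<open>x n\<close>
      lie in the closed disc of radius \<open>R\<close> = (1 + |b|)/2 < 1.\<close>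
    define d where "d n = (1 - norm b) / (2 * real (Suc n))" for n
    have d: "d n > 0" "d n \<le> (1 - norm b) / 2" for n
      using bd divide_left_mono[of 2 "2 * real (Suc n)" "1 - norm b"] by (simp_all add: d_def)
    have "\<exists>x. x \<in> ball b (d n) \<and> x \<notin> unique_min" for n
      using no d(1)[of n] by blast
    then obtain x where x: "\<And>n. x n \<in> ball b (d n)" "\<And>n. x n \<notin> unique_min"
      by metis
    define R where "R = (1 + norm b) / 2"
    have R: "R < 1"
      using bd by (simp add: R_def)
    have xR: "norm (x n) \<le> R" for n
    proof -
      have "norm (x n) \<le> norm b + dist b (x n)"
        by (metis add.commute dist_0_norm dist_commute dist_triangle)
      then show ?thesis
        using x(1)[of n] d(2)[of n] by (simp add: R_def field_simps)
    qed
    then have xd: "x n \<in> disc" for n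
      using R by (meson mem_ball_0 order_le_less_trans)
    have "\<exists>y. y \<in> disc \<and> q y = q (x n) \<and> y \<noteq> x n \<and> norm y \<le> norm (x n)" for n
      using x(2)[of n] xd[of n] unfolding unique_min_def mem_Collect_eq by (meson not_less)
    then obtain y where y: "\<And>n. y n \<in> disc" "\<And>n. q (y n) = q (x n)" "\<And>n. y n \<noteq> x n"
      "\<And>n. norm (y n) \<le> norm (x n)"
      by metis
    have "y n \<in> cball 0 R" for n
      using y(4)[of n] xR[of n] by simp
    then obtain l \<sigma> where l: "l \<in> cball 0 R" and \<sigma>: "strict_mono (\<sigma> :: nat \<Rightarrow> nat)" and yl: "(y \<circ> \<sigma>) \<longlonglongrightarrow> l"
      using compact_cball[of "0::complex" R] unfolding compact_def by metis
    have ld: "l \<in> disc"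
      using l R by auto
    have "d \<longlonglongrightarrow> 0"
      unfolding d_def by real_asymp
    then have "x \<longlonglongrightarrow> b"
      by (rule metric_tendsto_imp_tendsto)
         (use x(1) d(1) in \<open>auto intro!: always_eventually simp: dist_commute less_imp_le\<close>)
    then have xb: "(x \<circ> \<sigma>) \<longlonglongrightarrow> b"
      using \<sigma> by (rule LIMSEQ_subseq_LIMSEQ)
    have cont: "isCont q z" if "z \<in> disc" for z
      using that hol by (meson continuous_on_eq_continuous_at holomorphic_on_imp_continuous_on open_ball)
    have "(\<lambda>n. q ((y \<circ> \<sigma>) n)) \<longlonglongrightarrow> q l" "(\<lambda>n. q ((x \<circ> \<sigma>) n)) \<longlonglongrightarrow> q b"
      using cont ld bd yl xb isCont_tendsto_compose by blast+
    then have "q l = q b"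
      using y(2) LIMSEQ_unique by auto
    moreover have "norm l \<le> norm b"
      by (rule LIMSEQ_le[OF tendsto_norm[OF yl] tendsto_norm[OF xb]]) (use y(4) in auto)
    ultimately have "l = b"
      using b ld by (force simp: unique_min_def)
    obtain U Q where U: "open U" "b \<in> U" "\<And>x. x \<in> U \<Longrightarrow> Q (q x) = x"
      using local_inverse[OF bd] by metis
    have "eventually (\<lambda>n. (y \<circ> \<sigma>) n \<in> U \<and> (x \<circ> \<sigma>) n \<in> U) sequentially"
      using topological_tendstoD[OF yl U(1)] topological_tendstoD[OF xb U(1)] U(2) \<open>l = b\<close>
      by (intro eventually_conj) auto
    then obtain n where "(y \<circ> \<sigma>) n \<in> U" "(x \<circ> \<sigma>) n \<in> U"
      by (auto simp: eventually_sequentially)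
    then show False
      using U(3)[of "(y \<circ> \<sigma>) n"] U(3)[of "(x \<circ> \<sigma>) n"] y(2,3)[of "\<sigma> n"] by simp
  qed
  then show ?thesis
    by (simp add: open_contains_ball)
qed

lemma open_image_unique_min: "open (q ` unique_min)"
proof -
  have "openin (top_of_set disc) unique_min"
    using open_unique_min by (auto simp: openin_open_eq unique_min_def)
  then show ?thesis
    using covering_space_open_map[OF cov] openW openin_open_eq by blast
qed

text \<open>A competitor of tb is \<phi>(tb) for a deck automorphism \<phi>. Minimality of
  \<open>b\<close> says that \<phi> does not bring \<open>b\<close> closer to 0, and
  \<open>disc_automorphism_ray\<close> makes this strict at tb.\<close>

lemma ray_in_unique_min:
  assumes b: "b \<in> disc" and min: "\<And>b'. b' \<in> disc \<Longrightarrow> q b' = q b \<Longrightarrow> norm b \<le> norm b'"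
    and t: "0 \<le> t" "t < 1"
  shows "of_real t * b \<in> unique_min"
proof -
  have tb: "of_real t * b \<in> disc"
    using scale_in_disc[OF b t(1)] t(2) by simp
  have "norm (of_real t * b) < norm b'"
    if b': "b' \<in> disc" "q b' = q (of_real t * b)" "b' \<noteq> of_real t * b" for b'
  proof -
    obtain \<phi> \<psi> where \<phi>: "disc_automorphism \<phi> \<psi>" "\<phi> (of_real t * b) = b'"
      "\<And>z. z \<in> disc \<Longrightarrow> q (\<phi> z) = q z"
      using disc_coverings_automorphism[OF disc_covering_axioms disc_covering_axioms tb b'(1)
          b'(2)[symmetric]] by metis
    \<comment> \<open>If \<phi> fixed 0, it and the identity would be two lifts of \<open>q\<close>
      agreeing at 0, so \<phi> would not move tb.\<close>
    have "\<phi> 0 \<noteq> 0"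
    proof
      assume "\<phi> 0 = 0"
      have "\<phi> \<in> disc \<rightarrow> disc" "continuous_on disc \<phi>"
        using \<phi>(1) by (simp_all add: disc_automorphism_def holomorphic_on_imp_continuous_on)
      then have "\<phi> (of_real t * b) = id (of_real t * b)"
        using \<phi>(3) tb \<open>\<phi> 0 = 0\<close>
        by (rule_tac lift_unique[where z = 0 and h = \<phi> and h' = id]) simp_all
      then show False
        using b'(3) \<phi>(2) by simp
    qed
    moreover have "norm b \<le> norm (\<phi> b)"
      using \<phi>(1,3) b by (intro min) (auto simp: disc_automorphism_def)
    ultimately show ?thesis
      using disc_automorphism_ray[OF \<phi>(1) _ b t] \<phi>(2) by simp
  qed
  then show ?thesis
    using tb by (auto simp: unique_min_def)
qed

lemma image_unique_min_dense: "W \<subseteq> closure (q ` unique_min)"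
proof
  fix p assume "p \<in> W"
  then obtain b where b: "b \<in> disc" "q b = p" "\<And>b'. b' \<in> disc \<Longrightarrow> q b' = p \<Longrightarrow> norm b \<le> norm b'"
    using fibre_attains_min by metis
  define t :: "nat \<Rightarrow> real" where "t n = 1 - 1 / real (Suc n)" for n
  have "q (of_real (t n) * b) \<in> q ` unique_min" for n
    using b by (intro imageI ray_in_unique_min) (auto simp: t_def)
  moreover have "(\<lambda>n. q (of_real (t n) * b)) \<longlonglongrightarrow> q b"
  proof (rule isCont_tendsto_compose[of b q])
    show "isCont q b"
      using b(1) hol by (meson continuous_on_eq_continuous_at holomorphic_on_imp_continuous_on open_ball)
    have "t \<longlonglongrightarrow> 1"
      unfolding t_def by real_asymp
    then have "(\<lambda>n. complex_of_real (t n) * b) \<longlonglongrightarrow> of_real 1 * b"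
      by (intro tendsto_intros)
    then show "(\<lambda>n. complex_of_real (t n) * b) \<longlonglongrightarrow> b"
      by simp
  qed
  ultimately show "p \<in> closure (q ` unique_min)"
    unfolding closure_sequential b(2)[symmetric] by (intro exI[of _ "\<lambda>n. q (of_real (t n) * b)"]) auto
qed

end

subsection \<open>Hyperbolic length in the disc\<close>

text \<open>The first part will bound lengths from below. The second is the case of equality:
  continuity off the finite set \<open>S\<close> turns equality of integrals into pointwise equality
  of the integrands.\<close>

lemma nn_integral_dominates_derivative:
  fixes f F F' :: "real \<Rightarrow> real"
  assumes S: "finite S" and f: "continuous_on ({0<..<1} - S) f"
    and F: "continuous_on {0..1} F"
    and F': "continuous_on ({0<..<1} - S) F'"
    and deriv: "\<And>t. t \<in> {0<..<1} - S \<Longrightarrow> (F has_real_derivative F' t) (at t)"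
    and nonneg: "\<And>t. t \<in> {0<..<1} - S \<Longrightarrow> 0 \<le> f t"
    and le: "\<And>t. t \<in> {0<..<1} - S \<Longrightarrow> F' t \<le> f t"
  shows "ennreal (F 1 - F 0) \<le> (\<integral>\<^sup>+t\<in>{0..1}. ennreal (f t) \<partial>lborel)"
    and "(\<integral>\<^sup>+t\<in>{0..1}. ennreal (f t) \<partial>lborel) \<le> ennreal (F 1 - F 0) \<Longrightarrow> F 0 \<le> F 1 \<Longrightarrow> t \<in> {0<..<1} - S \<Longrightarrow> f t = F' t"
proof -
  let ?I = "(\<integral>\<^sup>+t\<in>{0..1}. ennreal (f t) \<partial>lborel)"
  define T where "T = {0<..<1} - S"
  have oT: "open T"
    using S by (simp add: T_def finite_imp_closed open_Diff)
  \<comment> \<open>Cutting off outside the open set \<open>T\<close> gives a Borel function on the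
    whole line; at the points of \<open>S\<close> and at the ends nothing is known about
    \<open>f\<close>.\<close>
  define g where "g t = indicator T t * f t" for t
  have g_nonneg: "0 \<le> g t" for t
    using nonneg by (auto simp: g_def T_def indicator_def)
  have [measurable]: "g \<in> borel_measurable borel"
    unfolding g_def using borel_measurable_continuous_on_indicator[of T f] oT f by (simp add: T_def)
  have neg: "finite (S \<union> {0, 1})"
    using S by simp
  have "AE t in lborel. t \<notin> S \<union> {0, 1}"
    using finite_imp_null_set_lborel[OF neg] by (rule AE_not_in)
  then have "AE t in lborel. ennreal (f t) * indicator {0..1} t = ennreal (g t)"
    by eventually_elim (auto simp: g_def T_def indicator_def)
  then have I: "?I = (\<integral>\<^sup>+t. ennreal (g t) \<partial>lborel)"
    by (rule nn_integral_cong_AE)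
  define k where "k t = indicator T t * F' t" for t
  have "(F' has_integral (F 1 - F 0)) {0..1}"
    using deriv by (intro fundamental_theorem_of_calculus_interior_strong[OF S])
      (auto simp: F has_real_derivative_iff_has_vector_derivative)
  then have "(k has_integral (F 1 - F 0)) {0..1}"
    by (rule has_integral_spike_finite[OF neg, rotated]) (auto simp: k_def T_def)
  then have k: "(k has_integral (F 1 - F 0)) UNIV"
    by (rule has_integral_on_superset) (auto simp: k_def T_def)
  have kg: "k t \<le> g t" for t
    using le by (auto simp: k_def g_def T_def indicator_def)
  \<comment> \<open>A finite integral can be compared with that of \<open>k\<close>. An infinite one
    makes the first claim trivial and contradicts the assumption of the second.\<close>
  have fin: "F 1 - F 0 \<le> integral\<^sup>L lborel g \<and> ?I = ennreal (integral\<^sup>L lborel g) \<and>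
      (g has_integral integral\<^sup>L lborel g) UNIV" if "?I < \<infinity>"
  proof -
    have int: "integrable lborel g"
      using that I g_nonneg by (intro integrableI_nonneg) auto
    have "(g has_integral integral\<^sup>L lborel g) UNIV"
      using int by (rule has_integral_integral_lborel)
    moreover have "?I = ennreal (integral\<^sup>L lborel g)"
      unfolding I using int g_nonneg by (simp add: nn_integral_eq_integral)
    ultimately show ?thesis
      using has_integral_le[OF k] kg by blast
  qed
  show "ennreal (F 1 - F 0) \<le> ?I"
  proof (cases "?I < \<infinity>")
    case True
    then show ?thesis
      using fin by (metis ennreal_leI)
  qed (simp add: not_less top_unique)
  assume eq: "?I \<le> ennreal (F 1 - F 0)" and F01: "F 0 \<le> F 1" and t: "t \<in> {0<..<1} - S"
  have "?I < \<infinity>"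
    using eq by (metis ennreal_less_top infinity_ennreal_def le_less_trans)
  note fin = fin[OF this]
  have "integral\<^sup>L lborel g = F 1 - F 0"
    using fin eq F01 by (metis diff_ge_0_iff_ge ennreal_le_iff order_antisym)
  then have gk: "((\<lambda>t. g t - k t) has_integral 0) UNIV"
    using has_integral_diff[OF conjunct2[OF conjunct2[OF fin]] k] by simp
  \<comment> \<open>On a small interval inside \<open>T\<close> the function g - k is continuous and
    nonnegative, and its integral there lies between 0 and the total integral 0; so it vanishes on
    the interval.\<close>
  obtain d where d: "d > 0" "cball t d \<subseteq> T"
    using oT t open_contains_cball by (metis T_def)
  have sub: "{t - d..t + d} \<subseteq> T"
    using d(2) by (simp add: cball_eq_atLeastAtMost)
  have "(\<lambda>t. g t - k t) integrable_on {t - d..t + d}"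
    using gk by (meson has_integral_integrable integrable_on_subinterval subset_UNIV)
  then obtain i where i: "((\<lambda>t. g t - k t) has_integral i) {t - d..t + d}"
    by (auto simp: integrable_on_def)
  have "i \<le> 0"
    by (rule has_integral_subset_le[OF _ i gk]) (use kg in auto)
  moreover have "0 \<le> i"
    by (rule has_integral_nonneg[OF i]) (use kg in auto)
  ultimately have i0: "((\<lambda>t. g t - k t) has_integral 0) (cbox (t - d) (t + d))"
    using i by simp
  have "continuous_on {t - d..t + d} (\<lambda>t. f t - F' t)"
    using f F' sub by (auto simp: T_def intro: continuous_intros continuous_on_subset)
  then have cont: "continuous_on (cbox (t - d) (t + d)) (\<lambda>t. g t - k t)"
    by (subst continuous_on_cong[OF refl, of _ _ "\<lambda>t. f t - F' t"])
       (use sub in \<open>auto simp: g_def k_def\<close>)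
  have "g t - k t = 0"
    by (rule has_integral_0_cbox_imp_0[OF cont _ i0]) (use kg d in auto)
  then show "f t = F' t"
    using t by (simp add: g_def k_def T_def)
qed

section \<open>Continuously differentiable curves under holomorphic maps\<close>

definition C1_near :: "(real \<Rightarrow> 'a::real_normed_vector) \<Rightarrow> real \<Rightarrow> bool" where
  "C1_near c t \<longleftrightarrow> (\<exists>e>0. c C1_differentiable_on {t - e<..<t + e})"

lemma C1_nearI:
  assumes "open U" "t \<in> U" "c C1_differentiable_on U"
  shows "C1_near c t"
proof -
  obtain e where "e > 0" "ball t e \<subseteq> U"
    using assms(1,2) openE by blast
  then show ?thesis
    using assms(3) C1_differentiable_on_subset unfolding C1_near_def ball_eq_greaterThanLessThan
    by blast
qed

lemma C1_near_has_vector_derivative: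
  assumes "C1_near c t"
  shows "(c has_vector_derivative vector_derivative c (at t)) (at t)"
proof -
  obtain e where "e > 0" "c C1_differentiable_on {t - e<..<t + e}"
    using assms by (auto simp: C1_near_def)
  then show ?thesis
    by (auto simp: C1_differentiable_on_eq vector_derivative_works)
qed

lemma C1_near_imp_C1_differentiable_on:
  assumes "open T" "\<And>t. t \<in> T \<Longrightarrow> C1_near c t"
  shows "c C1_differentiable_on T"
  unfolding C1_differentiable_on_eq
proof (intro conjI ballI)
  show "c differentiable at t" if "t \<in> T" for t
    using C1_near_has_vector_derivative[OF assms(2)[OF that]]
    by (auto simp: vector_derivative_works[symmetric] differentiableI_vector)
  show "continuous_on T (\<lambda>t. vector_derivative c (at t))"
  proof (rule continuous_at_imp_continuous_on, rule ballI)
    fix t assume "t \<in> T"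
    then obtain e where "e > 0" "c C1_differentiable_on {t - e<..<t + e}"
      using assms(2) by (auto simp: C1_near_def)
    then show "isCont (\<lambda>t. vector_derivative c (at t)) t"
      by (auto simp: C1_differentiable_on_eq continuous_on_eq_continuous_at)
  qed
qed

text \<open>The chain rule in a form that needs the identity b = \<Phi>(c) only near
  \<open>t\<close>. It serves for changes of chart, for \<open>q\<close>, and for the local inverses
  of \<open>q\<close>, none of which need be defined along the whole curve.\<close>

lemma C1_near_holomorphic_image:
  fixes c :: "real \<Rightarrow> complex"
  assumes c: "C1_near c t" and V: "open V" "c t \<in> V" and \<Phi>: "\<Phi> holomorphic_on V"
    and U: "open U" "t \<in> U" and eq: "\<And>s. s \<in> U \<Longrightarrow> b s = \<Phi> (c s)"
  shows "C1_near b t" and "vector_derivative b (at t) = deriv \<Phi> (c t) * vector_derivative c (at t)"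
proof -
  obtain e where e: "e > 0" "c C1_differentiable_on {t - e<..<t + e}"
    using c by (auto simp: C1_near_def)
  define T where "T = U \<inter> ({t - e<..<t + e} \<inter> c -` V)"
  have contc: "continuous_on {t - e<..<t + e} c"
    using e(2) by (rule C1_differentiable_imp_continuous_on)
  then have T: "open T" "t \<in> T"
    using e V U by (auto simp: T_def intro!: continuous_open_preimage)
  have d: "(c has_vector_derivative vector_derivative c (at s)) (at s)" if "s \<in> T" for s
    using e(2) that by (auto simp: T_def C1_differentiable_on_eq vector_derivative_works)
  have b: "(b has_vector_derivative vector_derivative c (at s) * deriv \<Phi> (c s)) (at s)" if s: "s \<in> T" for s
  proof -
    have "(\<Phi> has_field_derivative deriv \<Phi> (c s)) (at (c s))"
      using \<Phi> V(1) s by (auto simp: T_def intro: holomorphic_derivI)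
    then have "((\<Phi> \<circ> c) has_vector_derivative vector_derivative c (at s) * deriv \<Phi> (c s)) (at s)"
      using field_vector_diff_chain_at[OF d[OF s]] by simp
    then show ?thesis
      by (rule has_vector_derivative_transform_within_open[OF _ T(1) s]) (use eq in \<open>auto simp: T_def\<close>)
  qed
  have "b C1_differentiable_on T"
    unfolding C1_differentiable_on_def
  proof (intro exI conjI ballI)
    show "(b has_vector_derivative vector_derivative c (at s) * deriv \<Phi> (c s)) (at s)" if "s \<in> T" for s
      using that by (rule b)
    have "continuous_on T (\<lambda>s. vector_derivative c (at s))"
      using e(2) by (auto simp: T_def C1_differentiable_on_eq intro: continuous_on_subset)
    moreover have "continuous_on T (\<lambda>s. deriv \<Phi> (c s))"
    proof (rule continuous_on_compose2[of V "deriv \<Phi>"])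
      show "continuous_on V (deriv \<Phi>)"
        using \<Phi> V(1) by (intro holomorphic_on_imp_continuous_on holomorphic_deriv)
      show "continuous_on T c"
        using contc by (rule continuous_on_subset) (auto simp: T_def)
    qed (auto simp: T_def)
    ultimately show "continuous_on T (\<lambda>s. vector_derivative c (at s) * deriv \<Phi> (c s))"
      by (intro continuous_intros)
  qed
  then show "C1_near b t"
    using T C1_nearI by blast
  show "vector_derivative b (at t) = deriv \<Phi> (c t) * vector_derivative c (at t)"
    using vector_derivative_at[OF b[OF T(2)]] by (simp add: mult.commute)
qed

section \<open>Length of a curve compared with its projection to a diameter\<close>

definition disc_length :: "(real \<Rightarrow> complex) \<Rightarrow> ennreal" where
  "disc_length c =
     (\<integral>\<^sup>+t\<in>{0..1}. ennreal (2 / (1 - (norm (c t))\<^sup>2) * norm (vector_derivative c (at t))) \<partial>lborel)"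

definition disc_path :: "real set \<Rightarrow> (real \<Rightarrow> complex) \<Rightarrow> bool" where
  "disc_path S c \<longleftrightarrow>
     path c \<and> path_image c \<subseteq> disc \<and> finite S \<and> (\<forall>t\<in>{0<..<1} - S. C1_near c t)"

lemma artanh_strict_mono: "0 \<le> x \<Longrightarrow> x < y \<Longrightarrow> y < 1 \<Longrightarrow> artanh x < artanh (y :: real)"
  unfolding artanh_def by (simp add: field_simps)

lemma artanh_le_iff: "0 \<le> x \<Longrightarrow> x < 1 \<Longrightarrow> 0 \<le> y \<Longrightarrow> y < 1 \<Longrightarrow> artanh x \<le> artanh (y :: real) \<longleftrightarrow> x \<le> y"
  using artanh_strict_mono[of x y] artanh_strict_mono[of y x] by (metis less_eq_real_def not_less)

lemma artanh_nonneg: "0 \<le> x \<Longrightarrow> x < 1 \<Longrightarrow> 0 \<le> artanh (x :: real)"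
  using artanh_le_iff[of 0 x] by simp

text \<open>2 artanh is the primitive of the density 2/(1 - x^2), that is, arc length along a
  diameter measured from 0.\<close>

lemma DERIV_artanh_chain:
  assumes "(x has_real_derivative D) (at t)" "\<bar>x t\<bar> < 1"
  shows "((\<lambda>t. 2 * artanh (x t)) has_real_derivative 2 / (1 - (x t)\<^sup>2) * D) (at t)"
  using DERIV_cmult[OF DERIV_chain2[OF artanh_real_has_field_derivative[OF assms(2)] assms(1)], of 2]
  by simp

lemma disc_path_norm: "disc_path S c \<Longrightarrow> t \<in> {0..1} \<Longrightarrow> norm (c t) < 1"
  unfolding disc_path_def path_image_def image_subset_iff by simp

lemma disc_path_continuous: "disc_path S c \<Longrightarrow> continuous_on {0..1} c"
  by (simp add: disc_path_def path_def)

lemma disc_path_deriv: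
  assumes "disc_path S c" "t \<in> {0<..<1} - S"
  shows "(c has_vector_derivative vector_derivative c (at t)) (at t)"
  using assms C1_near_has_vector_derivative[of c t] by (simp add: disc_path_def)

text \<open>For |u| = 1 this is the orthogonal projection to the diameter through \<open>u\<close>.
  Unlike the modulus it is real-linear in the point, so it stays differentiable where the curve
  passes through 0.\<close>

definition axis_coord :: "complex \<Rightarrow> (real \<Rightarrow> complex) \<Rightarrow> real \<Rightarrow> real" where
  "axis_coord u c t = Re (cnj u * c t)"

context
  fixes S :: "real set" and c :: "real \<Rightarrow> complex" and u :: complex
  assumes c: "disc_path S c" and u: "norm u = 1"
begin

private abbreviation "x \<equiv> axis_coord u c"
private abbreviation "T \<equiv> {0<..<1} - S"
private abbreviation "dc \<equiv> \<lambda>t. vector_derivative c (at t)"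
private abbreviation "dx \<equiv> \<lambda>t. Re (cnj u * dc t)"

lemma disc_path_coordinate_deriv:
  assumes "t \<in> T"
  shows "(x has_real_derivative dx t) (at t)"
    "((\<lambda>t. Im (cnj u * c t)) has_real_derivative Im (cnj u * dc t)) (at t)"
proof -
  have "((\<lambda>t. cnj u * c t) has_vector_derivative cnj u * dc t) (at t)"
    using disc_path_deriv[OF c assms] by (rule has_vector_derivative_mult_right)
  then show "(x has_real_derivative dx t) (at t)"
    "((\<lambda>t. Im (cnj u * c t)) has_real_derivative Im (cnj u * dc t)) (at t)"
    unfolding axis_coord_def[abs_def] has_real_derivative_iff_has_vector_derivative
    by (rule bounded_linear.has_vector_derivative[OF bounded_linear_Re]
          bounded_linear.has_vector_derivative[OF bounded_linear_Im])+
qed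

lemma abs_Re_cnj_mult_le: "\<bar>Re (cnj u * w)\<bar> \<le> norm w"
  using abs_Re_le_cmod[of "cnj u * w"] u by (simp add: norm_mult)

lemma disc_path_coordinate_bound: "t \<in> {0..1} \<Longrightarrow> \<bar>x t\<bar> < 1"
  using disc_path_norm[OF c] abs_Re_cnj_mult_le unfolding axis_coord_def by (meson order.strict_trans1)

private abbreviation "f \<equiv> \<lambda>t. 2 / (1 - (norm (c t))\<^sup>2) * norm (dc t)"
private abbreviation "F' \<equiv> \<lambda>t. 2 / (1 - (x t)\<^sup>2) * dx t"

text \<open>Projection moves points towards 0, where the density is smaller, and it shortens
  velocities.\<close>

lemma disc_length_integrand_ge:
  assumes "t \<in> {0..1}"
  shows "2 / (1 - (x t)\<^sup>2) * \<bar>dx t\<bar> \<le> f t"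
proof (rule mult_mono)
  have "(x t)\<^sup>2 \<le> (norm (c t))\<^sup>2"
    using abs_Re_cnj_mult_le[of "c t"] by (simp add: axis_coord_def abs_le_square_iff[symmetric])
  moreover have "(norm (c t))\<^sup>2 < 1"
    using disc_path_norm[OF c assms] by (simp add: abs_square_less_1)
  ultimately show "2 / (1 - (x t)\<^sup>2) \<le> 2 / (1 - (norm (c t))\<^sup>2)" "0 \<le> 2 / (1 - (norm (c t))\<^sup>2)"
    by (simp_all add: frac_le)
qed (use abs_Re_cnj_mult_le in auto)

lemma disc_length_comparison:
  shows "ennreal (2 * artanh (x 1) - 2 * artanh (x 0)) \<le> disc_length c"
    and "disc_length c \<le> ennreal (2 * artanh (x 1) - 2 * artanh (x 0)) \<Longrightarrow> artanh (x 0) \<le> artanh (x 1)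
          \<Longrightarrow> t \<in> T \<Longrightarrow> f t = F' t"
proof -
  have S: "finite S"
    using c by (simp add: disc_path_def)
  have C1: "c C1_differentiable_on T"
    using c by (intro C1_near_imp_C1_differentiable_on) (auto simp: disc_path_def finite_imp_closed open_Diff)
  have contc: "continuous_on T c"
    using disc_path_continuous[OF c] by (rule continuous_on_subset) auto
  have contdc: "continuous_on T dc"
    using C1 by (simp add: C1_differentiable_on_eq)
  have contx: "continuous_on {0..1} x"
    unfolding axis_coord_def[abs_def] using disc_path_continuous[OF c] by (intro continuous_intros)
  have sq: "1 - (norm (c t))\<^sup>2 \<noteq> 0" "1 - (x t)\<^sup>2 \<noteq> 0" "\<bar>x t\<bar> < 1" if "t \<in> T" for t
    using disc_path_norm[OF c, of t] disc_path_coordinate_bound[of t] that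
      abs_square_less_1[of "x t"] abs_square_less_1[of "norm (c t)"] by auto
  have f: "continuous_on T f"
    using contc contdc sq by (intro continuous_intros) auto
  have F: "continuous_on {0..1} (\<lambda>t. 2 * artanh (x t))"
    using contx disc_path_coordinate_bound by (intro continuous_intros) (auto simp: abs_less_iff)
  have F': "continuous_on T F'"
    using continuous_on_subset[OF contx, of T] contdc sq
    by (intro continuous_intros) (auto simp: subset_iff)
  have deriv: "((\<lambda>t. 2 * artanh (x t)) has_real_derivative F' t) (at t)" if "t \<in> T" for t
    by (rule DERIV_artanh_chain) (use disc_path_coordinate_deriv(1)[OF that] sq(3)[OF that] in auto)
  have nonneg: "0 \<le> f t" if "t \<in> T" for t
    using disc_path_norm[OF c, of t] that by (simp add: abs_square_less_1 less_imp_le)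
  have le: "F' t \<le> f t" if "t \<in> T" for t
  proof -
    have "0 \<le> 2 / (1 - (x t)\<^sup>2)"
      using sq(3)[OF that] by (simp add: abs_square_less_1 less_imp_le)
    then have "F' t \<le> 2 / (1 - (x t)\<^sup>2) * \<bar>dx t\<bar>"
      by (intro mult_left_mono) auto
    then show ?thesis
      using disc_length_integrand_ge[of t] that by auto
  qed
  note N = nn_integral_dominates_derivative[OF S f F F' deriv nonneg le]
  show "ennreal (2 * artanh (x 1) - 2 * artanh (x 0)) \<le> disc_length c"
    unfolding disc_length_def by (rule N(1))
  show "disc_length c \<le> ennreal (2 * artanh (x 1) - 2 * artanh (x 0)) \<Longrightarrow> artanh (x 0) \<le> artanh (x 1)
          \<Longrightarrow> t \<in> T \<Longrightarrow> f t = F' t"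
    unfolding disc_length_def using N(2) by simp
qed

text \<open>Equality of integrands forces the rotated velocity \<open>cnj u * dc t\<close> to be
  real and nonnegative. Hence the imaginary part of \<open>cnj u * c t\<close> keeps its initial
  value 0, and the real part increases.\<close>

lemma disc_length_equality:
  assumes "disc_length c \<le> ennreal (2 * artanh (x 1) - 2 * artanh (x 0))"
    and "artanh (x 0) \<le> artanh (x 1)" and im0: "Im (cnj u * c 0) = 0"
  shows "t \<in> {0..1} \<Longrightarrow> c t = u * of_real (x t)" and "mono_on {0..1} x" and "continuous_on {0..1} x"
proof -
  have S: "finite S"
    using c by (simp add: disc_path_def)
  show contx: "continuous_on {0..1} x"
    unfolding axis_coord_def[abs_def] using disc_path_continuous[OF c] by (intro continuous_intros)
  have eq: "0 \<le> dx t \<and> Im (cnj u * dc t) = 0" if t: "t \<in> T" for t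
  proof -
    have eqf: "f t = F' t"
      using disc_length_comparison(2)[OF assms(1,2) t] .
    have pos: "0 < 2 / (1 - (x t)\<^sup>2)"
      using disc_path_coordinate_bound[of t] t by (simp add: abs_square_less_1)
    have "0 < 1 - (norm (c t))\<^sup>2"
      using disc_path_norm[OF c, of t] t by (simp add: abs_square_less_1)
    moreover have "(x t)\<^sup>2 \<le> (norm (c t))\<^sup>2"
      using abs_Re_cnj_mult_le[of "c t"] by (simp add: axis_coord_def abs_le_square_iff[symmetric])
    ultimately have "2 / (1 - (x t)\<^sup>2) \<le> 2 / (1 - (norm (c t))\<^sup>2)"
      by (simp add: frac_le)
    \<comment> \<open>Replacing the density at \<open>c t\<close> by the smaller one at
      \<open>x t\<close> leaves the same factor on both sides, so it cancels to |dc| \<le>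
      dx.\<close>
    then have "2 / (1 - (x t)\<^sup>2) * norm (dc t) \<le> F' t"
      unfolding eqf[symmetric] by (rule mult_right_mono) simp
    then have "norm (dc t) \<le> dx t"
      by (simp only: mult_le_cancel_left_pos[OF pos])
    then have nle: "norm (cnj u * dc t) \<le> Re (cnj u * dc t)"
      using u by (simp add: norm_mult)
    then have "Re (cnj u * dc t) = norm (cnj u * dc t)"
      using complex_Re_le_cmod order_antisym by blast
    then have "Im (cnj u * dc t) = 0"
      by (metis cmod_eq_Re abs_norm_cancel cmod_power2 add_cancel_right_right power2_abs zero_eq_power2)
    then show ?thesis
      using nle norm_ge_zero order_trans by blast
  qed
  have Im0: "Im (cnj u * c t) = 0" if t: "t \<in> {0..1}" for t
  proof (rule has_derivative_zero_unique_strong_interval[where k = "S \<union> {0, 1}" and a = 0 and b = 1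
        and f = "\<lambda>t. Im (cnj u * c t)"])
    show "continuous_on {0..1} (\<lambda>t. Im (cnj u * c t))"
      using disc_path_continuous[OF c] by (intro continuous_intros)
    fix s assume "s \<in> {0..1} - (S \<union> {0, 1})"
    then have "s \<in> T"
      by auto
    then have "((\<lambda>t. Im (cnj u * c t)) has_real_derivative 0) (at s)"
      using disc_path_coordinate_deriv(2)[of s] eq by auto
    then show "((\<lambda>t. Im (cnj u * c t)) has_derivative (\<lambda>h. 0)) (at s within {0..1})"
      by (simp add: has_field_derivative_def has_derivative_at_withinI lambda_zero)
  qed (use S im0 t in auto)
  show "c t = u * of_real (x t)" if "t \<in> {0..1}" for t
  proof -
    have "cnj u * c t = of_real (x t)"
      using Im0[OF that] by (simp add: complex_eq_iff axis_coord_def)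
    then have "(u * cnj u) * c t = u * of_real (x t)"
      by (simp add: mult.assoc)
    moreover have "u * cnj u = 1"
      using u by (metis complex_norm_square mult_1 of_real_1 power_one)
    ultimately show ?thesis
      by simp
  qed
  show "mono_on {0..1} x"
  proof (rule mono_onI)
    fix a b :: real assume ab: "a \<in> {0..1}" "b \<in> {0..1}" "a \<le> b"
    have "((\<lambda>t. if t \<in> S then 0 else dx t) has_integral (x b - x a)) {a..b}"
    proof (rule fundamental_theorem_of_calculus_interior_strong[OF S ab(3)])
      show "continuous_on {a..b} x"
        using contx ab by (auto intro: continuous_on_subset)
      fix t assume "t \<in> {a<..<b} - S"
      then show "(x has_vector_derivative (if t \<in> S then 0 else dx t)) (at t)"
        using disc_path_coordinate_deriv(1)[of t] ab
        by (auto simp: has_real_derivative_iff_has_vector_derivative)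
    qed
    \<comment> \<open>The sign of \<open>dx\<close> is known only on \<open>T\<close>, so the
      integrand is set to 0 at the ends as well, in case \<open>a\<close> is 0 or \<open>b\<close>
      is 1.\<close>
    then have "((\<lambda>t. if t \<in> S \<union> {0, 1} then 0 else dx t) has_integral (x b - x a)) {a..b}"
      by (rule has_integral_spike_finite[of "{0, 1}", rotated -1]) auto
    then have "0 \<le> x b - x a"
      by (rule has_integral_nonneg) (use eq ab in auto)
    then show "x a \<le> x b"
      by simp
  qed
qed

end

lemma disc_length_ge_from_0:
  assumes c: "disc_path S c" and "c 0 = 0"
  shows "ennreal (2 * artanh (norm (c 1))) \<le> disc_length c"
proof -
  \<comment> \<open>The diameter through \<open>c 1\<close>, on which the projection of
    \<open>c 1\<close> is |c 1|.\<close>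
  define u where "u = (if c 1 = 0 then 1 else sgn (c 1))"
  have u: "norm u = 1"
    by (simp add: u_def norm_sgn)
  have "cnj u * c 1 = of_real (norm (c 1))"
    by (simp add: u_def sgn_div_norm scaleR_conv_of_real complex_norm_square power2_eq_square
        field_simps flip: complex_norm_square)
  then show ?thesis
    using disc_length_comparison(1)[OF c u] assms(2) by (simp add: axis_coord_def)
qed

text \<open>The second claim says that a curve to 0 of least length is the radius from
  \<open>c 0\<close>, traversed monotonically but possibly with pauses, which is all the freedom
  that \<open>same_curve\<close> forgives.\<close>

lemma disc_length_to_0:
  assumes c: "disc_path S c" and 1: "c 1 = 0"
  shows "ennreal (2 * artanh (norm (c 0))) \<le> disc_length c"
    and "disc_length c \<le> ennreal (2 * artanh (norm (c 0))) \<Longrightarrow>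
           \<exists>\<phi>. monotone_reparam \<phi> \<and> (\<forall>t\<in>{0..1}. c t = of_real (1 - \<phi> t) * c 0)"
proof -
  \<comment> \<open>The minus sign makes the projection run upwards, from -|c 0| to 0, as the
    comparison requires. For \<open>c 0 = 0\<close> any unit vector will do.\<close>
  define u where "u = (if c 0 = 0 then 1 else - sgn (c 0))"
  have u: "norm u = 1"
    by (simp add: u_def norm_sgn)
  have u0: "cnj u * c 0 = - of_real (norm (c 0))"
    by (simp add: u_def sgn_div_norm scaleR_conv_of_real complex_norm_square power2_eq_square
        field_simps flip: complex_norm_square)
  have n1: "norm (c 0) < 1"
    using c by (rule disc_path_norm) auto
  define x where "x = axis_coord u c"
  have x01: "x 0 = - norm (c 0)" "x 1 = 0"
    by (simp_all add: x_def axis_coord_def u0 1)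
  have len: "2 * artanh (norm (c 0)) = 2 * artanh (x 1) - 2 * artanh (x 0)"
    using n1 by (simp add: x01)
  show "ennreal (2 * artanh (norm (c 0))) \<le> disc_length c"
    unfolding len x_def by (rule disc_length_comparison(1)[OF c u])
  assume "disc_length c \<le> ennreal (2 * artanh (norm (c 0)))"
  then have le: "disc_length c \<le> ennreal (2 * artanh (axis_coord u c 1) - 2 * artanh (axis_coord u c 0))"
    unfolding len x_def .
  have "artanh (x 0) \<le> artanh (x 1)"
    using n1 artanh_nonneg[of "norm (c 0)"] by (simp add: x01)
  then have le': "artanh (axis_coord u c 0) \<le> artanh (axis_coord u c 1)"
    by (simp add: x_def)
  have im0: "Im (cnj u * c 0) = 0"
    by (simp add: u0)
  note eq = disc_length_equality[OF c u le le' im0, folded x_def]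
  show "\<exists>\<phi>. monotone_reparam \<phi> \<and> (\<forall>t\<in>{0..1}. c t = of_real (1 - \<phi> t) * c 0)"
  proof (cases "c 0 = 0")
    case True
    \<comment> \<open>Here the increasing function \<open>x\<close> is squeezed between 0 and 0, so
      the curve is constant and the identity is a suitable reparametrization.\<close>
    have "c t = of_real (1 - t) * c 0" if "t \<in> {0..1}" for t
    proof -
      have "x 0 \<le> x t" "x t \<le> x 1"
        using eq(2) that by (auto intro: mono_onD)
      then show ?thesis
        using eq(1)[OF that] True x01 by simp
    qed
    moreover have "monotone_reparam (\<lambda>t. t)"
      by (auto simp: monotone_reparam_def intro: mono_onI)
    ultimately show ?thesis
      by blast
  next
    case False
    \<comment> \<open>Solves x = -(1 - \<phi>) |c 0|, the relation between the projection and the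
      fraction of the radius already covered.\<close>
    define \<phi> where "\<phi> t = 1 + x t / norm (c 0)" for t
    have "monotone_reparam \<phi>"
      unfolding monotone_reparam_def
    proof (intro conjI)
      show "continuous_on {0..1} \<phi>"
        unfolding \<phi>_def using eq(3) False by (intro continuous_intros) auto
      show "mono_on {0..1} \<phi>"
        using eq(2) by (auto simp: \<phi>_def mono_on_def divide_right_mono)
    qed (use False in \<open>simp_all add: \<phi>_def x01\<close>)
    moreover have "c t = of_real (1 - \<phi> t) * c 0" if "t \<in> {0..1}" for t
      using eq(1)[OF that] False
      by (simp add: \<phi>_def u_def sgn_div_norm scaleR_conv_of_real field_simps)
    ultimately show ?thesis
      by blast
  qed
qed

lemma disc_path_segment:
  assumes "a \<in> disc" "b \<in> disc"
  shows "disc_path {} (\<lambda>t. of_real (1 - t) * a + of_real t * b)"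
  unfolding disc_path_def
proof (intro conjI ballI)
  have *: "(\<lambda>t. of_real (1 - t) * a + of_real t * b) = linepath a b"
    by (simp add: linepath_def fun_eq_iff scaleR_conv_of_real)
  show "path (\<lambda>t. of_real (1 - t) * a + of_real t * b)"
    unfolding * by simp
  show "path_image (\<lambda>t. of_real (1 - t) * a + of_real t * b) \<subseteq> disc"
    unfolding * using assms by (simp add: closed_segment_subset)
  fix t :: real
  show "C1_near (\<lambda>t. of_real (1 - t) * a + of_real t * b) t"
    by (rule C1_nearI[of UNIV])
       (auto simp: C1_differentiable_on_def intro!: exI[of _ "\<lambda>_. b - a"] derivative_eq_intros)
qed auto

lemma disc_length_ray:
  assumes z: "z \<in> disc"
  shows "disc_length (\<lambda>t. of_real t * z) = ennreal (2 * artanh (norm z))"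
    and "disc_length (\<lambda>t. of_real (1 - t) * z) = ennreal (2 * artanh (norm z))"
proof -
  have tz: "\<bar>t * norm z\<bar> < 1" if "t \<in> {0..1}" for t
    using that z mult_left_le_one_le[of "norm z" t] by (auto simp: abs_mult)
  have bound: "(t * norm z)\<^sup>2 < 1" if "t \<in> {0..1}" for t
    using tz[OF that] by (simp add: abs_square_less_1)
  have vd: "vector_derivative (\<lambda>t. of_real t * z) (at t) = z"
    "vector_derivative (\<lambda>t. of_real (1 - t) * z) (at t) = - z" for t
    by (rule vector_derivative_at, auto intro!: derivative_eq_intros)+
  have "(\<integral>\<^sup>+t\<in>{0..1}. ennreal (2 / (1 - (t * norm z)\<^sup>2) * norm z) \<partial>lborel)
      = ennreal (2 * artanh (1 * norm z) - 2 * artanh (0 * norm z))"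
  proof (rule nn_integral_FTC_Icc[where F = "\<lambda>t. 2 * artanh (t * norm z)"])
    show "((\<lambda>t. 2 * artanh (t * norm z)) has_real_derivative 2 / (1 - (t * norm z)\<^sup>2) * norm z)
        (at t)" if "t \<in> {0..1}" for t
      using tz[OF that] by (intro DERIV_artanh_chain) (auto intro!: derivative_eq_intros)
    show "0 \<le> 2 / (1 - (t * norm z)\<^sup>2) * norm z" if "t \<in> {0..1}" for t
      using bound[of t] that by (simp add: less_imp_le)
  qed auto
  moreover have "disc_length (\<lambda>t. of_real t * z) =
      (\<integral>\<^sup>+t\<in>{0..1}. ennreal (2 / (1 - (t * norm z)\<^sup>2) * norm z) \<partial>lborel)"
    unfolding disc_length_def vd by (simp add: norm_mult power_mult_distrib)
  ultimately show "disc_length (\<lambda>t. of_real t * z) = ennreal (2 * artanh (norm z))"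
    by simp
  have "(\<integral>\<^sup>+t\<in>{0..1}. ennreal (2 / (1 - ((1 - t) * norm z)\<^sup>2) * norm z) \<partial>lborel)
      = ennreal (- 2 * artanh ((1 - 1) * norm z) - (- 2 * artanh ((1 - 0) * norm z)))"
  proof (rule nn_integral_FTC_Icc[where F = "\<lambda>t. - 2 * artanh ((1 - t) * norm z)"])
    show "((\<lambda>t. - 2 * artanh ((1 - t) * norm z)) has_real_derivative
        2 / (1 - ((1 - t) * norm z)\<^sup>2) * norm z) (at t)" if "t \<in> {0..1}" for t
    proof -
      have "((\<lambda>t. 2 * artanh ((1 - t) * norm z)) has_real_derivative
          2 / (1 - ((1 - t) * norm z)\<^sup>2) * (- norm z)) (at t)"
        using tz[of "1 - t"] that by (intro DERIV_artanh_chain) (auto intro!: derivative_eq_intros)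
      then show ?thesis
        using DERIV_minus by fastforce
    qed
    show "0 \<le> 2 / (1 - ((1 - t) * norm z)\<^sup>2) * norm z" if "t \<in> {0..1}" for t
      using bound[of "1 - t"] that by (simp add: less_imp_le)
  qed auto
  moreover have "disc_length (\<lambda>t. of_real (1 - t) * z) =
      (\<integral>\<^sup>+t\<in>{0..1}. ennreal (2 / (1 - ((1 - t) * norm z)\<^sup>2) * norm z) \<partial>lborel)"
    unfolding disc_length_def vd
    by (simp add: norm_mult power_mult_distrib del: of_real_diff)
  ultimately show "disc_length (\<lambda>t. of_real (1 - t) * z) = ennreal (2 * artanh (norm z))"
    by simp
qed

subsection \<open>The coordinate \<open>1 / (z - e)\<close> on the sphere\<close>

text \<open>Where \<open>Fin e\<close> is omitted, this single coordinate replaces the two charts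
  and sends infinity to 0. It is used with \<open>e\<close> in \<open>E\<close> for the complement
  of \<open>E\<close>, and with \<open>e = 0\<close> for \<open>Lambda r\<close>.\<close>

fun coord :: "complex \<Rightarrow> csphere \<Rightarrow> complex" where
  "coord e (Fin z) = inverse (z - e)"
| "coord e Infty = 0"

definition coord_inv :: "complex \<Rightarrow> complex \<Rightarrow> csphere" where
  "coord_inv e u = (if u = 0 then Infty else Fin (e + inverse u))"

lemma coord_coord_inv [simp]: "coord e (coord_inv e u) = u"
  by (simp add: coord_inv_def)

lemma coord_inv_coord [simp]: "x \<noteq> Fin e \<Longrightarrow> coord_inv e (coord e x) = x"
  by (cases x) (auto simp: coord_inv_def)

lemma coord_inv_neq [simp]: "coord_inv e u \<noteq> Fin e" "Fin e \<noteq> coord_inv e u"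
  by (simp_all add: coord_inv_def)

lemma vimage_Fin_image [simp]: "Fin -` (Fin ` B) = B"
  by auto

lemma open_Fin_image: "open A \<Longrightarrow> open (Fin ` A)"
  by (auto simp: open_csphere_iff)

lemma open_Compl_Fin: "open (- {Fin e})"
proof -
  have "Fin -` (- {Fin e}) = - {e}"
    by auto
  then show ?thesis
    by (simp add: open_csphere_iff open_Compl)
qed

lemma open_Compl_Fin_image:
  assumes "compact E"
  shows "open (- (Fin ` E))"
proof -
  have "Fin -` (- (Fin ` E)) = - E"
    by auto
  then show ?thesis
    using assms by (simp add: open_csphere_iff compact_imp_closed open_Compl)
qed

lemma open_Compl_Infty: "open (- {Infty})"
proof -
  have "- {Infty} = range Fin"
    using csphere.exhaust by auto
  then show ?thesis
    by (simp add: open_Fin_image)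
qed

lemma continuous_on_Fin: "continuous_on A Fin"
proof -
  have "continuous_on UNIV Fin"
    by (simp add: continuous_on_open_vimage open_csphere_iff)
  then show ?thesis
    using continuous_on_subset by blast
qed

lemma homeomorphism_Fin: "homeomorphism A (Fin ` A) Fin (chart (Fin 0))"
proof (rule homeomorphism_of_subsets)
  show "homeomorphism UNIV (range Fin) Fin (chart (Fin 0))"
  proof (rule homeomorphismI)
    have "open (chart (Fin 0) -` B \<inter> range Fin)" if "open B" for B
    proof -
      have "chart (Fin 0) -` B \<inter> range Fin = Fin ` B"
        by auto
      then show ?thesis
        using that by (simp add: open_Fin_image)
    qed
    then show "continuous_on (range Fin) (chart (Fin 0))"
      by (simp add: continuous_on_open_vimage open_Fin_image)
  qed (auto simp: continuous_on_Fin)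
qed auto

lemma continuous_on_coord: "continuous_on (- {Fin e}) (coord e)"
proof -
  have "open (coord e -` B \<inter> - {Fin e})" if B: "open B" for B
  proof -
    have im: "Fin -` (coord e -` B \<inter> - {Fin e}) = (- {e}) \<inter> (\<lambda>z. inverse (z - e)) -` B"
      by auto
    have op: "open ((- {e}) \<inter> (\<lambda>z. inverse (z - e)) -` B)"
      using B by (intro continuous_open_preimage continuous_intros) auto
    \<comment> \<open>For an open set to contain infinity its complement must be compact. Points
      with |z - e| > 1/d are sent into \<open>ball 0 d\<close>, so the complement is
      bounded.\<close>
    have "compact (- ((- {e}) \<inter> (\<lambda>z. inverse (z - e)) -` B))" if 0: "0 \<in> B"
    proof -
      obtain d where d: "d > 0" "ball 0 d \<subseteq> B"
        using B 0 openE by blast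
      have "- ((- {e}) \<inter> (\<lambda>z. inverse (z - e)) -` B) \<subseteq> cball e (inverse d)"
      proof
        fix z assume z: "z \<in> - ((- {e}) \<inter> (\<lambda>z. inverse (z - e)) -` B)"
        show "z \<in> cball e (inverse d)"
        proof (cases "z = e")
          case False
          then have "inverse (z - e) \<notin> ball 0 d"
            using z d by auto
          then have "d \<le> inverse (norm (z - e))"
            by (simp add: norm_inverse)
          then have "norm (z - e) \<le> inverse d"
            using d(1) le_imp_inverse_le by fastforce
          then show ?thesis
            by (simp add: dist_norm norm_minus_commute)
        qed (use d in auto)
      qed
      then have "bounded (- ((- {e}) \<inter> (\<lambda>z. inverse (z - e)) -` B))"
        by (rule bounded_subset[OF bounded_cball])
      moreover have "closed (- ((- {e}) \<inter> (\<lambda>z. inverse (z - e)) -` B))"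
        using op by (rule closed_Compl)
      ultimately show ?thesis
        by (simp only: compact_eq_bounded_closed)
    qed
    then show ?thesis
      using op by (simp add: open_csphere_iff im del: vimage_Int)
  qed
  then show ?thesis
    by (simp add: continuous_on_open_vimage open_Compl_Fin)
qed

lemma continuous_on_coord_inv: "continuous_on A (coord_inv e)"
proof -
  have "open (coord_inv e -` B)" if B: "open B" for B
  proof -
    \<comment> \<open>The preimage away from 0 is settled by continuity of inversion. Near 0 one
      uses that the finite points outside \<open>B\<close> are bounded, so that a punctured disc
      about 0 is sent into \<open>B\<close>.\<close>
    define G where "G = (- {0}) \<inter> (\<lambda>u. e + inverse u) -` (Fin -` B)"
    have G: "open G"
      unfolding G_def
    proof (rule continuous_open_preimage)
      show "continuous_on (- {0}) (\<lambda>u. e + inverse u)"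
        by (intro continuous_intros) auto
      show "open (Fin -` B)"
        using B by (simp add: open_csphere_iff)
    qed (simp add: open_Compl)
    have sub: "G \<subseteq> coord_inv e -` B"
      by (auto simp: G_def coord_inv_def)
    have eq: "coord_inv e -` B - {0} \<subseteq> G"
      by (auto simp: G_def coord_inv_def)
    show ?thesis
    proof (cases "Infty \<in> B")
      case True
      then have "bounded (- (Fin -` B))"
        using B by (simp add: open_csphere_iff compact_imp_bounded)
      then obtain M where M: "M > 0" "\<And>z. z \<notin> Fin -` B \<Longrightarrow> norm (z - e) \<le> M"
      proof -
        obtain M0 where "- (Fin -` B) \<subseteq> cball e M0"
          using \<open>bounded (- (Fin -` B))\<close> bounded_subset_ballD[of "- (Fin -` B)" e] by (meson ball_subset_cball subset_trans)
        then have "norm (z - e) \<le> max M0 1" if "z \<notin> Fin -` B" for z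
          using that by (auto simp: subset_iff dist_norm norm_minus_commute intro: max.coboundedI1)
        then show thesis
          by (intro that[of "max M0 1"]) auto
      qed
      have "ball 0 (inverse M) \<subseteq> coord_inv e -` B"
      proof
        fix u :: complex assume u: "u \<in> ball 0 (inverse M)"
        show "u \<in> coord_inv e -` B"
        proof (cases "u = 0")
          case False
          then have "M < norm (inverse u)"
            using u M(1) less_imp_inverse_less[of "norm u" "inverse M"] by (simp add: norm_inverse)
          then have "e + inverse u \<in> Fin -` B"
            using M(2)[of "e + inverse u"] by force
          then show ?thesis
            using False by (simp add: coord_inv_def)
        qed (use True in \<open>simp add: coord_inv_def\<close>)
      qed
      then have "coord_inv e -` B = G \<union> ball 0 (inverse M)"
        using sub eq M(1) by auto
      then show ?thesis
        using G by auto
    next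
      case False
      then have "0 \<notin> coord_inv e -` B"
        by (simp add: coord_inv_def)
      then have "coord_inv e -` B = G"
        using sub eq by blast
      then show ?thesis
        using G by simp
    qed
  qed
  then have "continuous_on UNIV (coord_inv e)"
    by (simp add: continuous_on_open_vimage)
  then show ?thesis
    using continuous_on_subset by blast
qed

lemma homeomorphism_coord: "homeomorphism (- {Fin e}) UNIV (coord e) (coord_inv e)"
  by (rule homeomorphismI) (auto simp: continuous_on_coord continuous_on_coord_inv)

lemma homeomorphism_coord_subset: "Fin e \<notin> A \<Longrightarrow> homeomorphism A (coord e ` A) (coord e) (coord_inv e)"
  by (rule homeomorphism_of_subsets[OF homeomorphism_coord]) auto

lemma open_coord_image:
  assumes "open A" "Fin e \<notin> A"
  shows "open (coord e ` A)"
proof -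
  have "coord e ` A = coord_inv e -` A"
  proof (intro equalityI subsetI)
    fix u assume "u \<in> coord e ` A"
    then obtain x where "x \<in> A" "u = coord e x"
      by auto
    moreover from this have "x \<noteq> Fin e"
      using assms(2) by auto
    ultimately show "u \<in> coord_inv e -` A"
      by simp
  next
    fix u assume "u \<in> coord_inv e -` A"
    then show "u \<in> coord e ` A"
      by (intro image_eqI[of _ _ "coord_inv e u"]) simp_all
  qed
  then show ?thesis
    using assms(1) continuous_on_coord_inv[of UNIV e] by (simp add: continuous_on_open_vimage)
qed

subsection \<open>Change of coordinates\<close>

text \<open>\<open>to_chart e p\<close> and \<open>of_chart e p\<close> are the transition maps between \<open>coord e\<close> and
  \<open>chart p\<close>, valid on the neighbourhood \<open>chart_nbhd e p\<close> of \<open>p\<close>.\<close>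

fun to_chart :: "complex \<Rightarrow> csphere \<Rightarrow> complex \<Rightarrow> complex" where
  "to_chart e (Fin a) u = e + inverse u"
| "to_chart e Infty u = u / (1 + e * u)"

fun of_chart :: "complex \<Rightarrow> csphere \<Rightarrow> complex \<Rightarrow> complex" where
  "of_chart e (Fin a) v = inverse (v - e)"
| "of_chart e Infty v = v / (1 - e * v)"

text \<open>Removed are the pole of \<open>coord e\<close> and the one point where the formula for
  \<open>chart p\<close> is not a coordinate: infinity if \<open>p\<close> is finite,
  \<open>Fin 0\<close> if \<open>p\<close> is infinity.\<close>

fun chart_nbhd :: "complex \<Rightarrow> csphere \<Rightarrow> csphere set" where
  "chart_nbhd e (Fin a) = - {Fin e} \<inter> - {Infty}"
| "chart_nbhd e Infty = - {Fin e} \<inter> - {Fin 0}"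

fun to_chart_domain :: "complex \<Rightarrow> csphere \<Rightarrow> complex set" where
  "to_chart_domain e (Fin a) = - {0}"
| "to_chart_domain e Infty = {u. 1 + e * u \<noteq> 0}"

fun of_chart_domain :: "complex \<Rightarrow> csphere \<Rightarrow> complex set" where
  "of_chart_domain e (Fin a) = - {e}"
| "of_chart_domain e Infty = {v. 1 - e * v \<noteq> 0}"

lemma open_chart_nbhd: "open (chart_nbhd e p)"
  by (cases p) (auto intro!: open_Int open_Compl_Fin open_Compl_Infty)

lemma in_chart_nbhd: "p \<noteq> Fin e \<Longrightarrow> p \<in> chart_nbhd e p"
  by (cases p) auto

lemma open_to_chart_domain: "open (to_chart_domain e p)"
proof (cases p)
  case Infty
  have "open {u. 1 + e * u \<noteq> 0}"
    by (intro open_Collect_neq continuous_intros)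
  then show ?thesis
    by (simp add: Infty)
qed auto

lemma open_of_chart_domain: "open (of_chart_domain e p)"
proof (cases p)
  case Infty
  have "open {u. 1 - e * u \<noteq> 0}"
    by (intro open_Collect_neq continuous_intros)
  then show ?thesis
    by (simp add: Infty)
qed auto

lemma to_chart_holomorphic: "to_chart e p holomorphic_on to_chart_domain e p"
proof (cases p)
  case (Fin a)
  have "(\<lambda>u. e + inverse u) holomorphic_on - {0}"
    by (intro holomorphic_intros) auto
  then show ?thesis
    by (simp add: Fin cong: holomorphic_cong)
next
  case Infty
  have "(\<lambda>u. u / (1 + e * u)) holomorphic_on {u. 1 + e * u \<noteq> 0}"
    by (intro holomorphic_intros) auto
  then show ?thesis
    by (simp add: Infty cong: holomorphic_cong)
qed

lemma of_chart_holomorphic: "of_chart e p holomorphic_on of_chart_domain e p"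
proof (cases p)
  case (Fin a)
  have "(\<lambda>u. inverse (u - e)) holomorphic_on - {e}"
    by (intro holomorphic_intros) auto
  then show ?thesis
    by (simp add: Fin cong: holomorphic_cong)
next
  case Infty
  have "(\<lambda>u. u / (1 - e * u)) holomorphic_on {u. 1 - e * u \<noteq> 0}"
    by (intro holomorphic_intros) auto
  then show ?thesis
    by (simp add: Infty cong: holomorphic_cong)
qed

lemma chart_nbhdD:
  assumes "x \<in> chart_nbhd e p"
  shows "coord e x \<in> to_chart_domain e p" "to_chart e p (coord e x) = chart p x"
    "chart p x \<in> of_chart_domain e p" "of_chart e p (chart p x) = coord e x" "chart_inv p (chart p x) = x"
proof -
  have "coord e x \<in> to_chart_domain e p \<and> to_chart e p (coord e x) = chart p x \<and>
    chart p x \<in> of_chart_domain e p \<and> of_chart e p (chart p x) = coord e x \<and> chart_inv p (chart p x) = x"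
  proof (cases p; cases x)
    fix a z assume "p = Fin a" "x = Fin z"
    then show ?thesis
      using assms by auto
  next
    fix z assume "p = Infty" "x = Fin z"
    then show ?thesis
      using assms by (auto simp: field_simps)
  qed (use assms in auto)
  then show "coord e x \<in> to_chart_domain e p" "to_chart e p (coord e x) = chart p x"
    "chart p x \<in> of_chart_domain e p" "of_chart e p (chart p x) = coord e x" "chart_inv p (chart p x) = x"
    by blast+
qed

lemma deriv_to_chart_nonzero:
  assumes "p \<noteq> Fin e"
  shows "deriv (to_chart e p) (coord e p) \<noteq> 0"
proof (cases p)
  case (Fin a)
  then have "inverse (a - e) \<noteq> 0"
    using assms by auto
  then have "((\<lambda>u. e + inverse u) has_field_derivative - (inverse (inverse (a - e)) ^ Suc (Suc 0)))
      (at (inverse (a - e)))"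
    by (auto intro!: derivative_eq_intros)
  moreover have "to_chart e p = (\<lambda>u. e + inverse u)"
    by (simp add: Fin fun_eq_iff)
  ultimately show ?thesis
    using assms Fin by (simp add: DERIV_imp_deriv)
next
  case Infty
  have "((\<lambda>u. u / (1 + e * u)) has_field_derivative 1) (at 0)"
    by (auto intro!: derivative_eq_intros)
  moreover have "to_chart e p = (\<lambda>u. u / (1 + e * u))"
    by (simp add: Infty fun_eq_iff)
  ultimately show ?thesis
    by (simp add: Infty DERIV_imp_deriv)
qed

text \<open>Regularity and length of curves are defined in a chart that moves with \<gamma> t. This
  passes to the fixed coordinate \<open>coord e\<close>, at the price of a factor that
  \<open>hyp_density_eq\<close> absorbs.\<close>

lemma chart_C1_iff:
  assumes cont: "continuous_on T \<gamma>" and T: "open T" "t \<in> T" and ne: "\<gamma> t \<noteq> Fin e"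
  shows "C1_near (\<lambda>s. chart (\<gamma> t) (\<gamma> s)) t \<longleftrightarrow> C1_near (\<lambda>s. coord e (\<gamma> s)) t"
    and "C1_near (\<lambda>s. coord e (\<gamma> s)) t \<Longrightarrow> vector_derivative (\<lambda>s. chart (\<gamma> t) (\<gamma> s)) (at t) =
           deriv (to_chart e (\<gamma> t)) (coord e (\<gamma> t)) * vector_derivative (\<lambda>s. coord e (\<gamma> s)) (at t)"
proof -
  define U where "U = T \<inter> \<gamma> -` chart_nbhd e (\<gamma> t)"
  have U: "open U" "t \<in> U"
    using continuous_on_open_vimage[OF T(1)] cont open_chart_nbhd T(2) in_chart_nbhd[OF ne]
    by (auto simp: U_def Int_commute)
  have D: "\<gamma> s \<in> chart_nbhd e (\<gamma> t)" if "s \<in> U" for s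
    using that by (simp add: U_def)
  have bwd: "C1_near (\<lambda>s. coord e (\<gamma> s)) t" if c: "C1_near (\<lambda>s. chart (\<gamma> t) (\<gamma> s)) t"
    by (rule C1_near_holomorphic_image(1)[OF c open_of_chart_domain _ of_chart_holomorphic[of e "\<gamma> t"] U])
       (use D U(2) chart_nbhdD in auto)
  have fwd: "C1_near (\<lambda>s. chart (\<gamma> t) (\<gamma> s)) t"
    "vector_derivative (\<lambda>s. chart (\<gamma> t) (\<gamma> s)) (at t) =
       deriv (to_chart e (\<gamma> t)) (coord e (\<gamma> t)) * vector_derivative (\<lambda>s. coord e (\<gamma> s)) (at t)"
    if c: "C1_near (\<lambda>s. coord e (\<gamma> s)) t"
    by (rule C1_near_holomorphic_image[OF c open_to_chart_domain _ to_chart_holomorphic[of e "\<gamma> t"] U];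
        use D U(2) chart_nbhdD in auto)+
  show "C1_near (\<lambda>s. chart (\<gamma> t) (\<gamma> s)) t \<longleftrightarrow> C1_near (\<lambda>s. coord e (\<gamma> s)) t"
    using bwd fwd(1) by blast
  show "C1_near (\<lambda>s. coord e (\<gamma> s)) t \<Longrightarrow> vector_derivative (\<lambda>s. chart (\<gamma> t) (\<gamma> s)) (at t) =
           deriv (to_chart e (\<gamma> t)) (coord e (\<gamma> t)) * vector_derivative (\<lambda>s. coord e (\<gamma> s)) (at t)"
    by (rule fwd(2))
qed

subsection \<open>Transport of coverings by homeomorphisms\<close>

text \<open>The sheets are unchanged; only the evenly covered sets are moved by \<open>k\<close>,
  which is injective on \<open>S\<close>.\<close>

lemma covering_space_compose_homeomorphism_left:
  assumes cov: "covering_space C p S" and hom: "homeomorphism S S' k k'"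
  shows "covering_space C (k \<circ> p) S'"
proof
  show "continuous_on C (k \<circ> p)"
    using cov hom by (metis continuous_on_compose covering_space_def homeomorphism_def)
  show "(k \<circ> p) ` C = S'"
    using cov hom by (metis covering_space_def homeomorphism_def image_comp)
  fix y assume "y \<in> S'"
  then have y: "k' y \<in> S" "k (k' y) = y"
    using hom by (auto simp: homeomorphism_def)
  obtain T v where T: "k' y \<in> T" "openin (top_of_set S) T" and v: "\<Union>v = C \<inter> p -` T"
    "\<And>u. u \<in> v \<Longrightarrow> openin (top_of_set C) u" "pairwise disjnt v" "\<And>u. u \<in> v \<Longrightarrow> \<exists>q. homeomorphism u T p q"
    using cov y(1) unfolding covering_space_def by meson
  have TS: "T \<subseteq> S"
    using T(2) openin_subset by fastforce
  have homT: "homeomorphism T (k ` T) k k'"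
    by (rule homeomorphism_of_subsets[OF hom TS order_refl refl])
  have "C \<inter> (k \<circ> p) -` (k ` T) = C \<inter> p -` T"
  proof -
    have "p x \<in> T" if "x \<in> C" "k (p x) = k s" "s \<in> T" for x s
    proof -
      have "p x \<in> S"
        using cov that(1) by (auto simp: covering_space_def)
      then show ?thesis
        using that TS hom by (metis homeomorphism_apply1 subsetD)
    qed
    then show ?thesis
      by auto
  qed
  then have vim: "\<Union>v = C \<inter> (k \<circ> p) -` (k ` T)"
    using v(1) by simp
  have homv: "\<exists>q. homeomorphism u (k ` T) (k \<circ> p) q" if "u \<in> v" for u
    using v(4)[OF that] homeomorphism_compose[OF _ homT] by blast
  have "y \<in> k ` T"
    using T(1) y(2) by (metis imageI)
  then show "\<exists>T. y \<in> T \<and> openin (top_of_set S') T \<and>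
     (\<exists>v. \<Union>v = C \<inter> (k \<circ> p) -` T \<and> (\<forall>u\<in>v. openin (top_of_set C) u) \<and> pairwise disjnt v \<and>
          (\<forall>u\<in>v. \<exists>q. homeomorphism u T (k \<circ> p) q))"
    using vim homv v(2,3) homeomorphism_imp_open_map[OF hom T(2)]
    by (intro exI[of _ "k ` T"] conjI exI[of _ v] ballI) simp_all
qed

text \<open>The evenly covered sets are unchanged; the sheets are carried over by the inverse
  \<open>h'\<close>.\<close>

lemma covering_space_compose_homeomorphism_right:
  assumes cov: "covering_space C p S" and hom: "homeomorphism C' C h h'"
  shows "covering_space C' (p \<circ> h) S"
proof
  have hC: "h ` C' = C"
    using hom by (simp add: homeomorphism_def)
  show "continuous_on C' (p \<circ> h)"
    using cov hom by (metis continuous_on_compose covering_space_def homeomorphism_def)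
  show "(p \<circ> h) ` C' = S"
    using cov hC by (metis covering_space_def image_comp)
  fix y assume "y \<in> S"
  then obtain T v where T: "y \<in> T" "openin (top_of_set S) T" and v: "\<Union>v = C \<inter> p -` T"
    "\<And>u. u \<in> v \<Longrightarrow> openin (top_of_set C) u" "pairwise disjnt v" "\<And>u. u \<in> v \<Longrightarrow> \<exists>q. homeomorphism u T p q"
    using cov unfolding covering_space_def by meson
  have uC: "u \<subseteq> C" if "u \<in> v" for u
    using v(1) that by auto
  have hom': "homeomorphism C C' h' h"
    using hom by (rule homeomorphism_symD)
  have "\<Union>((`) h' ` v) = h' ` (C \<inter> p -` T)"
    unfolding v(1)[symmetric] by auto
  also have "\<dots> = C' \<inter> (p \<circ> h) -` T"
  proof (intro equalityI subsetI)
    fix y assume "y \<in> h' ` (C \<inter> p -` T)"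
    then obtain x where x: "x \<in> C" "p x \<in> T" "y = h' x"
      by auto
    then show "y \<in> C' \<inter> (p \<circ> h) -` T"
      using homeomorphism_apply2[OF hom x(1)] homeomorphism_image2[OF hom] by auto
  next
    fix y assume "y \<in> C' \<inter> (p \<circ> h) -` T"
    then have "y = h' (h y)" "h y \<in> C \<inter> p -` T"
      using homeomorphism_apply1[OF hom] hC by auto
    then show "y \<in> h' ` (C \<inter> p -` T)"
      by (rule image_eqI)
  qed
  finally have 1: "\<Union>((`) h' ` v) = C' \<inter> (p \<circ> h) -` T" .
  have 2: "openin (top_of_set C') u" if "u \<in> (`) h' ` v" for u
    using that homeomorphism_imp_open_map[OF hom'] v(2) by auto
  have inj: "inj_on h' C"
    using hom by (metis homeomorphism_apply2 inj_on_inverseI)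
  have 3: "pairwise disjnt ((`) h' ` v)"
  proof (rule pairwiseI)
    fix a b assume "a \<in> (`) h' ` v" "b \<in> (`) h' ` v" "a \<noteq> b"
    then obtain a' b' where ab: "a' \<in> v" "b' \<in> v" "a' \<noteq> b'" "a = h' ` a'" "b = h' ` b'"
      by auto
    then have "a' \<inter> b' = {}"
      using v(3) by (auto simp: pairwise_def disjnt_def)
    then show "disjnt a b"
      using inj_on_image_Int[OF inj uC[OF ab(1)] uC[OF ab(2)]] ab(4,5) by (simp add: disjnt_def)
  qed
  have 4: "\<exists>q. homeomorphism u T (p \<circ> h) q" if u: "u \<in> (`) h' ` v" for u
  proof -
    obtain u' where u': "u' \<in> v" "u = h' ` u'"
      using u by auto
    then obtain q where "homeomorphism u' T p q"
      using v(4) by blast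
    moreover have "homeomorphism u u' h h'"
    proof (rule homeomorphism_of_subsets[OF hom])
      show "u \<subseteq> C'"
        using u'(1) uC hom' by (auto simp: u'(2) homeomorphism_def)
      show "h ` u = u'"
      proof -
        have "h (h' x) = x" if "x \<in> u'" for x
          using uC[OF u'(1)] that homeomorphism_apply2[OF hom] by blast
        then show ?thesis
          by (simp add: u'(2) image_image)
      qed
    qed (use uC u' in blast)
    ultimately show ?thesis
      using homeomorphism_compose by blast
  qed
  show "\<exists>T. y \<in> T \<and> openin (top_of_set S) T \<and>
     (\<exists>v. \<Union>v = C' \<inter> (p \<circ> h) -` T \<and> (\<forall>u\<in>v. openin (top_of_set C') u) \<and> pairwise disjnt v \<and>
          (\<forall>u\<in>v. \<exists>q. homeomorphism u T (p \<circ> h) q))"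
    using T 1 2 3 4 by (intro exI[of _ T] exI[of _ "(`) h' ` v"] conjI ballI) assumption+
qed

subsection \<open>Shortest curves and the covering by the disc\<close>

lemma path_image_memD: "path_image c \<subseteq> A \<Longrightarrow> t \<in> {0..1} \<Longrightarrow> c t \<in> A"
  by (auto simp: path_image_def)

lemma field_differentiable_transform_open:
  fixes F G :: "complex \<Rightarrow> complex"
  assumes "F field_differentiable at z" "open U" "z \<in> U" "\<And>u. u \<in> U \<Longrightarrow> F u = G u"
  shows "G field_differentiable at z"
proof -
  obtain D where "(F has_field_derivative D) (at z)"
    using assms(1) by (auto simp: field_differentiable_def)
  then have "(G has_field_derivative D) (at z)"
    using assms(2-4) by (rule has_field_derivative_transform_within_open)
  then show ?thesis
    by (auto simp: field_differentiable_def)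
qed

text \<open>Turns the pointwise definition by charts into ordinary holomorphy: near each point
  \<open>coord e\<close> is \<open>of_chart\<close> applied to the chart at the image point.\<close>

lemma sphere_holomorphic_disc:
  assumes hol: "sphere_holomorphic_on F (Fin ` disc)" and ne: "\<And>z. z \<in> disc \<Longrightarrow> F (Fin z) \<noteq> Fin e"
  shows "(\<lambda>z. coord e (F (Fin z))) holomorphic_on disc"
proof -
  have cont: "continuous_on disc (\<lambda>z. F (Fin z))"
    using hol continuous_on_Fin[of disc] unfolding sphere_holomorphic_on_def
    by (rule_tac continuous_on_compose2[of "Fin ` disc" F disc Fin]) auto
  have "(\<lambda>z. coord e (F (Fin z))) field_differentiable at z" if z: "z \<in> disc" for z
  proof -
    define p where "p = F (Fin z)"
    have p: "p \<noteq> Fin e"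
      using ne[OF z] by (simp add: p_def)
    have d: "(\<lambda>u. chart p (F (Fin u))) field_differentiable at z"
      using hol z by (auto simp: sphere_holomorphic_on_def p_def dest!: bspec[of _ _ "Fin z"])
    define U where "U = disc \<inter> (\<lambda>z. F (Fin z)) -` chart_nbhd e p"
    have U: "open U" "z \<in> U"
      using continuous_on_open_vimage[of disc] cont open_chart_nbhd z in_chart_nbhd[OF p]
      by (auto simp: U_def Int_commute p_def)
    have "chart p (F (Fin z)) \<in> of_chart_domain e p"
      using in_chart_nbhd[OF p] chart_nbhdD by (simp add: p_def)
    then have "of_chart e p field_differentiable at (chart p (F (Fin z)))"
      using of_chart_holomorphic open_of_chart_domain by (metis holomorphic_on_imp_differentiable_at)
    then have "(of_chart e p \<circ> (\<lambda>u. chart p (F (Fin u)))) field_differentiable at z"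
      using d by (intro field_differentiable_compose)
    then show ?thesis
      using U by (rule field_differentiable_transform_open) (simp add: U_def chart_nbhdD)
  qed
  then show ?thesis
    by (simp add: holomorphic_on_open field_differentiable_def)
qed

text \<open>Instantiated for the complement of \<open>E\<close>, for \<open>Lambda r\<close>, and
  for an arbitrary covering competing in the definition of \<open>hyp_density\<close>.\<close>

locale sphere_covering =
  fixes \<pi> :: "csphere \<Rightarrow> csphere" and \<Omega> :: "csphere set" and e :: complex
  assumes covering: "holomorphic_universal_covering (Fin ` disc) \<pi> \<Omega>"
    and omitted: "Fin e \<notin> \<Omega>" and open_domain: "open \<Omega>"
begin

definition f :: "complex \<Rightarrow> csphere" where "f z = \<pi> (Fin z)"

definition q :: "complex \<Rightarrow> complex" where "q z = coord e (f z)"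

lemma f_maps: "z \<in> disc \<Longrightarrow> f z \<in> \<Omega>"
  using covering by (auto simp: holomorphic_universal_covering_def covering_space_def f_def)

lemma f_neq: "z \<in> disc \<Longrightarrow> f z \<noteq> Fin e"
  using f_maps omitted by metis

lemma f_eq_coord_inv: "z \<in> disc \<Longrightarrow> f z = coord_inv e (q z)"
  using f_neq by (simp add: q_def)

lemma q_eq_iff: "z \<in> disc \<Longrightarrow> z' \<in> disc \<Longrightarrow> q z = q z' \<longleftrightarrow> f z = f z'"
  using f_eq_coord_inv q_def by metis

lemma continuous_on_f: "continuous_on disc f"
  unfolding f_def[abs_def]
  using covering continuous_on_Fin[of disc]
  unfolding holomorphic_universal_covering_def covering_space_def
  by (rule_tac continuous_on_compose2[of "Fin ` disc" \<pi> disc Fin]) auto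

lemma disc_covering_q: "disc_covering q (coord e ` \<Omega>)"
proof
  have "covering_space disc (\<pi> \<circ> Fin) \<Omega>"
    using covering homeomorphism_Fin unfolding holomorphic_universal_covering_def
    by (meson covering_space_compose_homeomorphism_right)
  then have "covering_space disc (coord e \<circ> (\<pi> \<circ> Fin)) (coord e ` \<Omega>)"
    using homeomorphism_coord_subset[OF omitted] by (rule covering_space_compose_homeomorphism_left)
  moreover have "coord e \<circ> (\<pi> \<circ> Fin) = q"
    by (simp add: fun_eq_iff q_def f_def)
  ultimately show "covering_space disc q (coord e ` \<Omega>)"
    by simp
  show "q holomorphic_on disc"
    unfolding q_def[abs_def] f_def
    using covering f_neq unfolding holomorphic_universal_covering_def f_def
    by (intro sphere_holomorphic_disc) auto
  show "open (coord e ` \<Omega>)"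
    using open_domain omitted by (rule open_coord_image)
qed

sublocale disc_covering q "coord e ` \<Omega>"
  by (rule disc_covering_q)

lemma deriv_chart:
  assumes z: "z \<in> disc"
  shows "deriv (\<lambda>u. chart (f z) (\<pi> (Fin u))) z = deriv (to_chart e (f z)) (q z) * deriv q z"
proof (rule DERIV_imp_deriv)
  define p where "p = f z"
  define U where "U = disc \<inter> f -` chart_nbhd e p"
  have U: "open U" "z \<in> U"
    using continuous_on_open_vimage[of disc] continuous_on_f open_chart_nbhd z in_chart_nbhd[OF f_neq[OF z]]
    by (auto simp: U_def Int_commute p_def)
  have "q z \<in> to_chart_domain e p"
    using U(2) chart_nbhdD(1) by (auto simp: U_def q_def)
  then have "(to_chart e p has_field_derivative deriv (to_chart e p) (q z)) (at (q z))"
    using to_chart_holomorphic open_to_chart_domain by (meson holomorphic_derivI)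
  moreover have "(q has_field_derivative deriv q z) (at z)"
    using hol z by (auto intro: holomorphic_derivI)
  ultimately have "(to_chart e p \<circ> q has_field_derivative deriv (to_chart e p) (q z) * deriv q z) (at z)"
    by (rule DERIV_chain)
  moreover have "(to_chart e p \<circ> q) u = chart p (\<pi> (Fin u))" if "u \<in> U" for u
    using that chart_nbhdD(2)[of "f u" e p] by (simp add: U_def q_def f_def)
  ultimately have "((\<lambda>u. chart p (\<pi> (Fin u))) has_field_derivative
      deriv (to_chart e p) (q z) * deriv q z) (at z)"
    using U by (rule_tac has_field_derivative_transform_within_open)
  then show "((\<lambda>u. chart (f z) (\<pi> (Fin u))) has_field_derivative
      deriv (to_chart e (f z)) (q z) * deriv q z) (at z)"
    by (simp only: p_def)
qed

text \<open>The description by \<open>THE\<close> is resolved by solving for \<rho> with the given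
  covering, the derivatives being nonzero. Any other covering differs by a disc automorphism and
  leads to the same value.\<close>

lemma hyp_density_eq:
  assumes z: "z \<in> disc"
  shows "hyp_density \<Omega> (f z) * norm (deriv (to_chart e (f z)) (q z) * deriv q z) = 2 / (1 - (norm z)\<^sup>2)"
proof -
  define K where "K = deriv (to_chart e (f z)) (q z)"
  have K: "K \<noteq> 0"
    unfolding K_def q_def by (rule deriv_to_chart_nonzero) (rule f_neq[OF z])
  have q': "deriv q z \<noteq> 0"
    by (rule deriv_nonzero[OF z])
  define \<rho> where "\<rho> = 2 / (1 - (norm z)\<^sup>2) / norm (K * deriv q z)"
  have \<rho>: "\<rho> * norm (K * deriv q z) = 2 / (1 - (norm z)\<^sup>2)"
    using K q' by (simp add: \<rho>_def)
  have "hyp_density \<Omega> (f z) = \<rho>"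
    unfolding hyp_density_def
  proof (rule the_equality)
    show "\<exists>F x. holomorphic_universal_covering (Fin ` disc) F \<Omega> \<and> norm x < 1 \<and> F (Fin x) = f z \<and>
        \<rho> * norm (deriv (\<lambda>u. chart (f z) (F (Fin u))) x) = 2 / (1 - (norm x)\<^sup>2)"
      using covering z deriv_chart[OF z] \<rho>
      by (intro exI[of _ \<pi>] exI[of _ z]) (simp add: f_def[symmetric] K_def)
    fix \<rho>' assume "\<exists>F x. holomorphic_universal_covering (Fin ` disc) F \<Omega> \<and> norm x < 1 \<and> F (Fin x) = f z \<and>
        \<rho>' * norm (deriv (\<lambda>u. chart (f z) (F (Fin u))) x) = 2 / (1 - (norm x)\<^sup>2)"
    then obtain F x where F: "holomorphic_universal_covering (Fin ` disc) F \<Omega>" "x \<in> disc"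
      "F (Fin x) = f z" "\<rho>' * norm (deriv (\<lambda>u. chart (f z) (F (Fin u))) x) = 2 / (1 - (norm x)\<^sup>2)"
      by auto
    interpret F: sphere_covering F \<Omega> e
      using F(1) omitted open_domain by (simp add: sphere_covering_def)
    have Fx: "F.f x = f z" "F.q x = q z"
      using F(3) by (simp_all add: F.f_def F.q_def q_def)
    obtain \<phi> \<psi> where \<phi>: "disc_automorphism \<phi> \<psi>" "\<phi> x = z" "\<And>w. w \<in> disc \<Longrightarrow> q (\<phi> w) = F.q w"
      using disc_coverings_automorphism[OF F.disc_covering_q disc_covering_q F(2) z Fx(2)] by metis
    have hol\<phi>: "\<phi> holomorphic_on disc"
      using \<phi>(1) by (simp add: disc_automorphism_def)
    have "(\<phi> has_field_derivative deriv \<phi> x) (at x)"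
      using hol\<phi> F(2) by (auto intro: holomorphic_derivI)
    moreover have "(q has_field_derivative deriv q z) (at (\<phi> x))"
      using hol z \<phi>(2) by (auto intro: holomorphic_derivI)
    ultimately have "(q \<circ> \<phi> has_field_derivative deriv q z * deriv \<phi> x) (at x)"
      by (metis DERIV_chain)
    then have "(F.q has_field_derivative deriv q z * deriv \<phi> x) (at x)"
      using has_field_derivative_transform_within_open[of "q \<circ> \<phi>" _ x disc F.q] F(2) \<phi>(3) by auto
    then have Fq: "deriv F.q x = deriv q z * deriv \<phi> x"
      by (rule DERIV_imp_deriv)
    have "\<rho>' * norm (K * deriv q z) * norm (deriv \<phi> x) = 2 / (1 - (norm x)\<^sup>2)"
      using F(4) F.deriv_chart[OF F(2)] by (simp add: Fx Fq K_def norm_mult mult_ac)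
    moreover have nx: "1 - (norm x)\<^sup>2 \<noteq> 0" "1 - (norm z)\<^sup>2 \<noteq> 0"
      using F(2) z abs_square_less_1[of "norm x"] abs_square_less_1[of "norm z"] by auto
    \<comment> \<open>Automorphisms are hyperbolic isometries: the factor |deriv \<phi> x| converts
      the disc density at \<open>z\<close> into that at \<open>x\<close>, so \<rho>' solves the
      equation that determines \<rho>.\<close>
    moreover have "norm (deriv \<phi> x) * (1 - (norm x)\<^sup>2) = 1 - (norm z)\<^sup>2"
      using disc_automorphism_derivative[OF \<phi>(1) F(2)] \<phi>(2) by simp
    ultimately have "\<rho>' * norm (K * deriv q z) * (1 - (norm z)\<^sup>2) = 2"
      by (metis (no_types, lifting) mult.assoc nonzero_eq_divide_eq)
    then have "\<rho>' * norm (K * deriv q z) = \<rho> * norm (K * deriv q z)"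
      using nx(2) \<rho> by (metis nonzero_eq_divide_eq)
    then show "\<rho>' = \<rho>"
      using K q' by simp
  qed
  then show ?thesis
    using \<rho> by (simp add: K_def)
qed

text \<open>\<open>f\<close> is a local isometry, so the two integrands agree off the finite set of
  exceptional times.\<close>

lemma image_disc_path:
  assumes c: "disc_path S c" and \<gamma>: "\<And>t. t \<in> {0..1} \<Longrightarrow> \<gamma> t = f (c t)"
  shows "\<gamma> \<in> curves_between \<Omega> (f (c 0)) (f (c 1))" and "hyp_length \<Omega> \<gamma> = disc_length c"
proof -
  have S: "finite S" and cd: "\<And>t. t \<in> {0..1} \<Longrightarrow> c t \<in> disc" and contc: "continuous_on {0..1} c"
    using c disc_path_norm[OF c] disc_path_continuous[OF c] by (auto simp: disc_path_def)
  have "continuous_on {0..1} (\<lambda>t. f (c t))"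
    using continuous_on_f contc cd by (rule_tac continuous_on_compose2[of disc f]) auto
  then have cont\<gamma>: "continuous_on {0..1} \<gamma>"
    by (subst continuous_on_cong[OF refl \<gamma>]) auto
  define I where "I = {0<..<1} - S"
  have I: "open I" "I \<subseteq> {0..1}"
    using S by (auto simp: I_def finite_imp_closed open_Diff)
  have contI: "continuous_on I \<gamma>"
    using cont\<gamma> I(2) continuous_on_subset by blast
  have loc: "C1_near (\<lambda>s. chart (\<gamma> t) (\<gamma> s)) t \<and> hyp_density \<Omega> (\<gamma> t) *
      norm (vector_derivative (\<lambda>s. chart (\<gamma> t) (\<gamma> s)) (at t)) =
      2 / (1 - (norm (c t))\<^sup>2) * norm (vector_derivative c (at t))" if t: "t \<in> I" for t
  proof -
    have t01: "t \<in> {0..1}"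
      using t I(2) by auto
    have C1: "C1_near c t"
      using c t by (simp add: disc_path_def I_def)
    have eq: "coord e (\<gamma> s) = q (c s)" if "s \<in> I" for s
      using \<gamma>[of s] that I(2) by (auto simp: q_def)
    have q: "C1_near (\<lambda>s. coord e (\<gamma> s)) t"
      "vector_derivative (\<lambda>s. coord e (\<gamma> s)) (at t) = deriv q (c t) * vector_derivative c (at t)"
      by (rule C1_near_holomorphic_image[OF C1 open_ball cd[OF t01] hol I(1) t eq]; assumption)+
    have ne: "\<gamma> t \<noteq> Fin e"
      using \<gamma>[OF t01] f_neq[OF cd[OF t01]] by simp
    have "norm (vector_derivative (\<lambda>s. chart (\<gamma> t) (\<gamma> s)) (at t)) =
        norm (deriv (to_chart e (\<gamma> t)) (coord e (\<gamma> t)) * deriv q (c t)) * norm (vector_derivative c (at t))"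
      using chart_C1_iff(2)[OF contI I(1) t ne q(1)] by (simp add: q(2) norm_mult)
    then have "hyp_density \<Omega> (\<gamma> t) * norm (vector_derivative (\<lambda>s. chart (\<gamma> t) (\<gamma> s)) (at t)) =
        hyp_density \<Omega> (f (c t)) * norm (deriv (to_chart e (f (c t))) (q (c t)) * deriv q (c t)) *
        norm (vector_derivative c (at t))"
      using \<gamma>[OF t01] by (simp add: q_def)
    also have "\<dots> = 2 / (1 - (norm (c t))\<^sup>2) * norm (vector_derivative c (at t))"
      by (simp only: hyp_density_eq[OF cd[OF t01]])
    finally show ?thesis
      using chart_C1_iff(1)[OF contI I(1) t ne] q(1) by blast
  qed
  have "piecewise_C1_path \<gamma>"
    using loc S cont\<gamma> unfolding piecewise_C1_path_def path_def I_def C1_near_def by blast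
  moreover have "path_image \<gamma> \<subseteq> \<Omega>"
    using \<gamma> cd f_maps by (auto simp: path_image_def)
  ultimately show "\<gamma> \<in> curves_between \<Omega> (f (c 0)) (f (c 1))"
    using \<gamma>[of 0] \<gamma>[of 1] by (simp add: curves_between_def pathstart_def pathfinish_def)
  have "finite (S \<union> {0, 1})"
    using S by simp
  then have "AE t in lborel. t \<notin> S \<union> {0, 1}"
    using finite_imp_null_set_lborel AE_not_in by blast
  then have ae: "AE t in lborel. ennreal (hyp_density \<Omega> (\<gamma> t) *
        norm (vector_derivative (\<lambda>s. chart (\<gamma> t) (\<gamma> s)) (at t))) * indicator {0..1} t =
      ennreal (2 / (1 - (norm (c t))\<^sup>2) * norm (vector_derivative c (at t))) * indicator {0..1} t"
  proof eventually_elim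
    case (elim t)
    show ?case
    proof (cases "t \<in> {0..1}")
      case True
      then have "t \<in> I"
        using elim by (auto simp: I_def)
      then show ?thesis
        using loc by simp
    qed simp
  qed
  show "hyp_length \<Omega> \<gamma> = disc_length c"
    unfolding hyp_length_def disc_length_def by (rule nn_integral_cong_AE[OF ae])
qed

lemma lift_path:
  assumes \<gamma>: "path \<gamma>" "path_image \<gamma> \<subseteq> \<Omega>" and a: "a \<in> disc" "\<gamma> 0 = f a"
  obtains c where "path c" "path_image c \<subseteq> disc" "c 0 = a" "\<And>t. t \<in> {0..1} \<Longrightarrow> f (c t) = \<gamma> t"
proof -
  have ne: "\<gamma> t \<noteq> Fin e" if "t \<in> {0..1}" for t
    using \<gamma>(2) that omitted unfolding path_image_def by (metis image_subset_iff)
  have "path (coord e \<circ> \<gamma>)"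
    using \<gamma> omitted
    by (intro path_continuous_image continuous_on_subset[OF continuous_on_coord]) auto
  moreover have "path_image (coord e \<circ> \<gamma>) \<subseteq> coord e ` \<Omega>"
    using \<gamma>(2) by (auto simp: path_image_def)
  moreover have "pathstart (coord e \<circ> \<gamma>) = q a"
    using a(2) by (simp add: pathstart_def q_def)
  ultimately obtain c where c: "path c" "path_image c \<subseteq> disc" "pathstart c = a"
    "\<And>t. t \<in> {0..1} \<Longrightarrow> q (c t) = (coord e \<circ> \<gamma>) t"
    using covering_space_lift_path_strong[OF cov a(1)] by metis
  show thesis
  proof (rule that[of c])
    show "f (c t) = \<gamma> t" if t: "t \<in> {0..1}" for t
    proof -
      have "c t \<in> disc"
        using path_image_memD[OF c(2) t] .
      then show ?thesis
        using c(4)[OF t] ne[OF t] by (simp add: f_eq_coord_inv)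
    qed
  qed (use c in \<open>auto simp: pathstart_def\<close>)
qed

text \<open>Curves to infinity have to be lifted with endpoint 0, whereas path lifting fixes the
  initial point; hence the reversal.\<close>

lemma lift_path_end:
  assumes \<gamma>: "path \<gamma>" "path_image \<gamma> \<subseteq> \<Omega>" and a: "a \<in> disc" "\<gamma> 1 = f a"
  obtains c where "path c" "path_image c \<subseteq> disc" "c 1 = a" "\<And>t. t \<in> {0..1} \<Longrightarrow> f (c t) = \<gamma> t"
proof -
  have "reversepath \<gamma> 0 = f a"
    using a(2) by (simp add: reversepath_def)
  then obtain c where c: "path c" "path_image c \<subseteq> disc" "c 0 = a"
    "\<And>t. t \<in> {0..1} \<Longrightarrow> f (c t) = reversepath \<gamma> t"
    using lift_path[of "reversepath \<gamma>" a] \<gamma> a(1) by auto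
  show thesis
  proof (rule that[of "reversepath c"])
    show "f (reversepath c t) = \<gamma> t" if "t \<in> {0..1}" for t
      using c(4)[of "1 - t"] that by (simp add: reversepath_def)
    show "reversepath c 1 = a"
      using c(3) by (simp add: reversepath_def)
  qed (use c(1,2) in \<open>simp_all\<close>)
qed

text \<open>Locally the lift is a holomorphic inverse of \<open>q\<close> applied to the curve in
  the coordinate \<open>coord e\<close>, so it inherits differentiability off the same finite
  set.\<close>

lemma lift_is_disc_path:
  assumes \<gamma>: "piecewise_C1_path \<gamma>" and c: "path c" "path_image c \<subseteq> disc"
    and lift: "\<And>t. t \<in> {0..1} \<Longrightarrow> f (c t) = \<gamma> t"
  obtains S where "disc_path S c"
proof -
  obtain S where S: "finite S" and C1: "\<And>t. t \<in> {0<..<1} - S \<Longrightarrow> C1_near (\<lambda>s. chart (\<gamma> t) (\<gamma> s)) t"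
    using \<gamma> unfolding piecewise_C1_path_def C1_near_def by blast
  have cont\<gamma>: "continuous_on {0<..<1} \<gamma>"
    using \<gamma> unfolding piecewise_C1_path_def path_def
    by (meson continuous_on_subset greaterThanLessThan_subseteq_atLeastAtMost_iff order_refl)
  have cd: "c t \<in> disc" if "t \<in> {0..1}" for t
    using path_image_memD[OF c(2) that] .
  have "C1_near c t" if t: "t \<in> {0<..<1} - S" for t
  proof -
    have t01: "t \<in> {0..1}" and tI: "t \<in> {0<..<1}"
      using t by auto
    have ne: "\<gamma> t \<noteq> Fin e"
      using lift[OF t01] f_neq[OF cd[OF t01]] by simp
    have C1q: "C1_near (\<lambda>s. coord e (\<gamma> s)) t"
      using chart_C1_iff(1)[OF cont\<gamma> open_greaterThanLessThan tI ne] C1[OF t] by blast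
    obtain U V Q where U: "open U" "c t \<in> U" and V: "open V" and Q: "Q holomorphic_on V"
      "q ` U = V" "\<And>x. x \<in> U \<Longrightarrow> Q (q x) = x"
      using local_inverse[OF cd[OF t01]] by metis
    define T where "T = {0<..<1} \<inter> c -` U"
    have "continuous_on {0<..<1} c"
      using c(1) unfolding path_def
      by (meson continuous_on_subset greaterThanLessThan_subseteq_atLeastAtMost_iff order_refl)
    then have T: "open T" "t \<in> T"
      using U tI by (auto simp: T_def intro: continuous_open_preimage)
    have coord: "coord e (\<gamma> s) = q (c s)" if "s \<in> {0..1}" for s
      using lift[OF that] by (simp add: q_def)
    show ?thesis
    proof (rule C1_near_holomorphic_image(1)[OF C1q V _ Q(1) T])
      show "coord e (\<gamma> t) \<in> V"
        using coord[OF t01] U(2) Q(2) by auto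
      show "c s = Q (coord e (\<gamma> s))" if "s \<in> T" for s
        using that coord[of s] Q(3)[of "c s"] by (simp add: T_def)
    qed
  qed
  then show thesis
    using that[of S] c S by (simp add: disc_path_def)
qed

lemma lift_unique_path:
  assumes "path c" "path_image c \<subseteq> disc" "path d" "path_image d \<subseteq> disc"
    and eq: "\<And>t. t \<in> {0..1} \<Longrightarrow> f (c t) = f (d t)" and a: "a \<in> {0..1}" "c a = d a" and t: "t \<in> {0..1}"
  shows "c t = d t"
proof (rule covering_space_lift_unique[OF cov, where T = "{0..1}" and f = "\<lambda>t. q (c t)" and a = a
      and ?g1.0 = c and ?g2.0 = d])
  have cd: "c \<in> {0..1} \<rightarrow> disc" "d \<in> {0..1} \<rightarrow> disc"
    using assms(2,4) by (auto simp: path_image_def)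
  show "continuous_on {0..1} (\<lambda>t. q (c t))"
    using holomorphic_on_imp_continuous_on[OF hol] assms(1) cd(1)
    by (rule_tac continuous_on_compose2[of disc q]) (auto simp: path_def)
  show "(\<lambda>t. q (c t)) \<in> {0..1} \<rightarrow> coord e ` \<Omega>"
    using maps cd(1) by (auto simp: Pi_iff)
  show "q (c t) = q (d t)" if "t \<in> {0..1}" for t
    using eq[OF that] by (simp add: q_def)
  show "c \<in> {0..1} \<rightarrow> disc" "d \<in> {0..1} \<rightarrow> disc"
    by (fact cd)+
  show "continuous_on {0..1} c" "continuous_on {0..1} d"
    using assms(1,3) by (simp_all add: path_def)
qed (use a t in auto)

text \<open>Injectivity forces every lift starting at 0 to end at \<open>b\<close> itself, so no
  other fibre point can give a shorter curve. This is the case of \<open>Lambda r\<close>.\<close>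

lemma hyp_dist_injective:
  assumes inj: "inj_on f disc" and b: "b \<in> disc"
  shows "hyp_dist \<Omega> (f 0) (f b) = ennreal (2 * artanh (norm b))"
proof (rule antisym)
  define c where "c t = of_real t * b" for t
  have c: "disc_path {} c"
    using disc_path_segment[of 0 b] b by (simp add: c_def[abs_def])
  have "(\<lambda>t. f (c t)) \<in> curves_between \<Omega> (f 0) (f b)" "hyp_length \<Omega> (\<lambda>t. f (c t)) = disc_length c"
    using image_disc_path[OF c, of "\<lambda>t. f (c t)"] by (simp_all add: c_def)
  then show "hyp_dist \<Omega> (f 0) (f b) \<le> ennreal (2 * artanh (norm b))"
    using disc_length_ray(1)[OF b] unfolding hyp_dist_def c_def[abs_def] by (metis INF_lower)
  show "ennreal (2 * artanh (norm b)) \<le> hyp_dist \<Omega> (f 0) (f b)"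
    unfolding hyp_dist_def
  proof (rule INF_greatest)
    fix \<gamma> assume "\<gamma> \<in> curves_between \<Omega> (f 0) (f b)"
    then have \<gamma>: "piecewise_C1_path \<gamma>" "path \<gamma>" "path_image \<gamma> \<subseteq> \<Omega>" "\<gamma> 0 = f 0" "\<gamma> 1 = f b"
      by (auto simp: curves_between_def piecewise_C1_path_def pathstart_def pathfinish_def)
    obtain d where d: "path d" "path_image d \<subseteq> disc" "d 0 = 0" "\<And>t. t \<in> {0..1} \<Longrightarrow> f (d t) = \<gamma> t"
      using lift_path[OF \<gamma>(2,3) _ \<gamma>(4)] by auto
    obtain S where S: "disc_path S d"
      using lift_is_disc_path[OF \<gamma>(1) d(1,2,4)] by blast
    have "d 1 \<in> disc"
      using path_image_memD[OF d(2)] by simp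
    then have "d 1 = b"
      using d(4)[of 1] \<gamma>(5) inj b by (auto dest: inj_onD)
    moreover have "hyp_length \<Omega> \<gamma> = disc_length d"
      using image_disc_path(2)[OF S] d(4) by simp
    ultimately show "ennreal (2 * artanh (norm b)) \<le> hyp_length \<Omega> \<gamma>"
      using disc_length_ge_from_0[OF S d(3)] by simp
  qed
qed

definition ray :: "complex \<Rightarrow> real \<Rightarrow> csphere" where
  "ray b t = f (of_real (1 - t) * b)"

lemma ray_curve:
  assumes b: "b \<in> disc"
  shows "ray b \<in> curves_between \<Omega> (f b) (f 0)" "hyp_length \<Omega> (ray b) = ennreal (2 * artanh (norm b))"
proof -
  have c: "disc_path {} (\<lambda>t. of_real (1 - t) * b)"
    using disc_path_segment[of b 0] b by simp
  show "ray b \<in> curves_between \<Omega> (f b) (f 0)"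
    using image_disc_path(1)[OF c, of "ray b"] by (simp add: ray_def)
  show "hyp_length \<Omega> (ray b) = ennreal (2 * artanh (norm b))"
    using image_disc_path(2)[OF c, of "ray b"] disc_length_ray(2)[OF b] by (simp add: ray_def)
qed

text \<open>The lift is pinned at its end, so its initial point \<open>b\<close> is the point of the
  fibre over \<open>p\<close> that the curve selects; the estimates are those for curves to 0 in the
  disc.\<close>

lemma curve_to_centre:
  assumes "\<gamma> \<in> curves_between \<Omega> p (f 0)"
  obtains b where "b \<in> disc" "f b = p" "ennreal (2 * artanh (norm b)) \<le> hyp_length \<Omega> \<gamma>"
    "hyp_length \<Omega> \<gamma> \<le> ennreal (2 * artanh (norm b)) \<Longrightarrow>
       \<exists>\<phi>. monotone_reparam \<phi> \<and> (\<forall>t\<in>{0..1}. \<gamma> t = ray b (\<phi> t))"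
proof -
  have \<gamma>: "piecewise_C1_path \<gamma>" "path \<gamma>" "path_image \<gamma> \<subseteq> \<Omega>" "\<gamma> 1 = f 0" "\<gamma> 0 = p"
    using assms by (auto simp: curves_between_def piecewise_C1_path_def pathstart_def pathfinish_def)
  obtain d where d: "path d" "path_image d \<subseteq> disc" "d 1 = 0" "\<And>t. t \<in> {0..1} \<Longrightarrow> f (d t) = \<gamma> t"
    using lift_path_end[OF \<gamma>(2,3) _ \<gamma>(4)] by auto
  obtain S where S: "disc_path S d"
    using lift_is_disc_path[OF \<gamma>(1) d(1,2,4)] by blast
  have len: "hyp_length \<Omega> \<gamma> = disc_length d"
    using image_disc_path(2)[OF S] d(4) by simp
  show thesis
  proof (rule that[of "d 0"])
    show "d 0 \<in> disc"
      using path_image_memD[OF d(2)] by simp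
    show "f (d 0) = p"
      using d(4)[of 0] \<gamma>(5) by simp
    show "ennreal (2 * artanh (norm (d 0))) \<le> hyp_length \<Omega> \<gamma>"
      using disc_length_to_0(1)[OF S d(3)] len by simp
    assume "hyp_length \<Omega> \<gamma> \<le> ennreal (2 * artanh (norm (d 0)))"
    then have "disc_length d \<le> ennreal (2 * artanh (norm (d 0)))"
      by (simp only: len)
    then obtain \<phi> where \<phi>: "monotone_reparam \<phi>" "\<And>t. t \<in> {0..1} \<Longrightarrow> d t = of_real (1 - \<phi> t) * d 0"
      using disc_length_to_0(2)[OF S d(3)] by blast
    have "\<gamma> t = ray (d 0) (\<phi> t)" if "t \<in> {0..1}" for t
      using d(4)[OF that] \<phi>(2)[OF that] by (simp only: ray_def)
    then show "\<exists>\<phi>. monotone_reparam \<phi> \<and> (\<forall>t\<in>{0..1}. \<gamma> t = ray (d 0) (\<phi> t))"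
      using \<phi>(1) by blast
  qed
qed

lemma shortest_ray:
  assumes b: "b \<in> disc" and min: "\<And>b'. b' \<in> disc \<Longrightarrow> f b' = f b \<Longrightarrow> norm b \<le> norm b'"
  shows "shortest_curve \<Omega> (f b) (f 0) (ray b)"
  unfolding shortest_curve_def
proof (intro conjI ballI)
  fix \<delta> assume "\<delta> \<in> curves_between \<Omega> (f b) (f 0)"
  then obtain b' where b': "b' \<in> disc" "f b' = f b" "ennreal (2 * artanh (norm b')) \<le> hyp_length \<Omega> \<delta>"
    using curve_to_centre by metis
  have "artanh (norm b) \<le> artanh (norm b')"
    using min[OF b'(1,2)] b b'(1) by (simp add: artanh_le_iff)
  then have "ennreal (2 * artanh (norm b)) \<le> ennreal (2 * artanh (norm b'))"
    by (intro ennreal_leI) simp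
  then show "hyp_length \<Omega> (ray b) \<le> hyp_length \<Omega> \<delta>"
    using b'(3) ray_curve(2)[OF b] by (metis order_trans)
qed (rule ray_curve(1)[OF b])

text \<open>Comparison with the rays from all points of the fibre shows that \<open>b\<close> has
  minimal modulus; comparison with \<open>ray b\<close> itself gives the equality that makes the
  curve a ray.\<close>

lemma shortest_curve_is_ray:
  assumes "shortest_curve \<Omega> p (f 0) \<gamma>"
  obtains b \<phi> where "b \<in> disc" "f b = p" "\<And>b'. b' \<in> disc \<Longrightarrow> f b' = p \<Longrightarrow> norm b \<le> norm b'"
    "monotone_reparam \<phi>" "\<And>t. t \<in> {0..1} \<Longrightarrow> \<gamma> t = ray b (\<phi> t)"
proof -
  have "\<gamma> \<in> curves_between \<Omega> p (f 0)"
    using assms by (simp add: shortest_curve_def)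
  then obtain b where b: "b \<in> disc" "f b = p" "ennreal (2 * artanh (norm b)) \<le> hyp_length \<Omega> \<gamma>"
    "hyp_length \<Omega> \<gamma> \<le> ennreal (2 * artanh (norm b)) \<Longrightarrow>
       \<exists>\<phi>. monotone_reparam \<phi> \<and> (\<forall>t\<in>{0..1}. \<gamma> t = ray b (\<phi> t))"
    using curve_to_centre by metis
  have le: "hyp_length \<Omega> \<gamma> \<le> ennreal (2 * artanh (norm b'))" if "b' \<in> disc" "f b' = p" for b'
    using assms ray_curve[OF that(1)] that(2) by (auto simp: shortest_curve_def)
  have "norm b \<le> norm b'" if b': "b' \<in> disc" "f b' = p" for b'
  proof -
    have "ennreal (2 * artanh (norm b)) \<le> ennreal (2 * artanh (norm b'))"
      using b(3) le[OF b'] by (rule order_trans)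
    then have "artanh (norm b) \<le> artanh (norm b')"
      using artanh_nonneg[of "norm b'"] b'(1) by (simp add: ennreal_le_iff)
    then show ?thesis
      using b(1) b'(1) by (simp add: artanh_le_iff)
  qed
  then show thesis
    using that b(1,2) b(4)[OF le[OF b(1,2)]] by blast
qed

lemma ray_path: "b \<in> disc \<Longrightarrow> path (ray b)"
  using ray_curve(1) by (simp add: curves_between_def piecewise_C1_path_def)

text \<open>Lift the common path \<sigma> so that it ends at 0. Reparametrized by \<phi> and by
  \<psi>, this lift must be the straight segment from \<open>b\<close> and the one from
  \<open>b'\<close>, by uniqueness of lifts from the end. Both start where the lift of \<sigma>
  starts.\<close>

lemma same_curve_rays:
  assumes b: "b \<in> disc" and b': "b' \<in> disc" and same: "same_curve (ray b) (ray b')"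
  shows "b = b'"
proof -
  obtain \<sigma> \<phi> \<psi> where \<sigma>: "path \<sigma>" and \<phi>: "monotone_reparam \<phi>" and \<psi>: "monotone_reparam \<psi>"
    and eq: "\<And>t. t \<in> {0..1} \<Longrightarrow> ray b t = \<sigma> (\<phi> t)" "\<And>t. t \<in> {0..1} \<Longrightarrow> ray b' t = \<sigma> (\<psi> t)"
    using same unfolding same_curve_def by blast
  \<comment> \<open>\<sigma> is known only at values of \<phi>, but these fill the unit interval by
    the intermediate value theorem.\<close>
  have "path_image \<sigma> \<subseteq> \<Omega>"
  proof
    fix x assume "x \<in> path_image \<sigma>"
    then obtain s where s: "s \<in> {0..1}" "x = \<sigma> s"
      by (auto simp: path_image_def)
    then obtain t where "0 \<le> t" "t \<le> 1" "\<phi> t = s"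
      using IVT'[of \<phi> 0 s 1] \<phi> by (auto simp: monotone_reparam_def)
    then have "x = ray b t" "t \<in> {0..1}"
      using eq(1)[of t] s(2) by auto
    then show "x \<in> \<Omega>"
      using ray_curve(1)[OF b] by (auto simp: curves_between_def path_image_def)
  qed
  moreover have "\<sigma> 1 = f 0"
    using eq(1)[of 1] \<phi> by (simp add: ray_def monotone_reparam_def)
  ultimately obtain s where s: "path s" "path_image s \<subseteq> disc" "s 1 = 0"
    "\<And>t. t \<in> {0..1} \<Longrightarrow> f (s t) = \<sigma> t"
    using lift_path_end[OF \<sigma>, of 0] by auto
  have start: "s 0 = a" if a: "a \<in> disc" and \<theta>: "monotone_reparam \<theta>"
    and eq: "\<And>t. t \<in> {0..1} \<Longrightarrow> ray a t = \<sigma> (\<theta> t)" for a \<theta>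
  proof -
    have \<theta>01: "\<theta> ` {0..1} \<subseteq> {0..1}"
    proof
      fix y assume "y \<in> \<theta> ` {0..1}"
      then obtain t where t: "t \<in> {0..1}" "y = \<theta> t"
        by auto
      moreover have "mono_on {0..1} \<theta>"
        using \<theta> by (simp add: monotone_reparam_def)
      ultimately have "\<theta> 0 \<le> \<theta> t" "\<theta> t \<le> \<theta> 1"
        using mono_onD[of "{0..1}" \<theta> 0 t] mono_onD[of "{0..1}" \<theta> t 1] by auto
      then show "y \<in> {0..1}"
        using \<theta> t by (simp add: monotone_reparam_def)
    qed
    have "path (s \<circ> \<theta>)"
      using s(1) \<theta> \<theta>01 unfolding path_def monotone_reparam_def
      by (metis continuous_on_compose continuous_on_subset)
    moreover have "path_image (s \<circ> \<theta>) \<subseteq> disc"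
      using s(2) \<theta>01 by (fastforce simp: path_image_def)
    moreover have "path (\<lambda>t. of_real (1 - t) * a)" "path_image (\<lambda>t. of_real (1 - t) * a) \<subseteq> disc"
      using disc_path_segment[of a 0] a by (simp_all add: disc_path_def)
    moreover have "f ((s \<circ> \<theta>) t) = f (of_real (1 - t) * a)" if "t \<in> {0..1}" for t
    proof -
      have "\<theta> t \<in> {0..1}"
        using \<theta>01 that by blast
      then show ?thesis
        using eq[OF that] s(4)[of "\<theta> t"] by (simp only: ray_def o_apply)
    qed
    moreover have "(s \<circ> \<theta>) 1 = of_real (1 - 1) * a"
      using \<theta> s(3) by (simp add: monotone_reparam_def)
    ultimately have "(s \<circ> \<theta>) 0 = of_real (1 - 0) * a"
      using lift_unique_path[of "s \<circ> \<theta>" "\<lambda>t. of_real (1 - t) * a" 1 0] by simp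
    then show ?thesis
      using \<theta> by (simp add: monotone_reparam_def)
  qed
  show ?thesis
    using start[OF b \<phi> eq(1)] start[OF b' \<psi> eq(2)] by simp
qed

lemma several_shortest_curves_iff:
  assumes p: "p \<in> \<Omega>"
  shows "(\<exists>\<gamma> \<delta>. shortest_curve \<Omega> p (f 0) \<gamma> \<and> shortest_curve \<Omega> p (f 0) \<delta> \<and> \<not> same_curve \<gamma> \<delta>)
    \<longleftrightarrow> p \<notin> f ` unique_min"
proof
  assume "\<exists>\<gamma> \<delta>. shortest_curve \<Omega> p (f 0) \<gamma> \<and> shortest_curve \<Omega> p (f 0) \<delta> \<and> \<not> same_curve \<gamma> \<delta>"
  then obtain \<gamma> \<delta> where \<gamma>\<delta>: "shortest_curve \<Omega> p (f 0) \<gamma>" "shortest_curve \<Omega> p (f 0) \<delta>" "\<not> same_curve \<gamma> \<delta>"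
    by blast
  obtain b \<phi> where b: "b \<in> disc" "f b = p" "\<And>b'. b' \<in> disc \<Longrightarrow> f b' = p \<Longrightarrow> norm b \<le> norm b'"
    "monotone_reparam \<phi>" "\<And>t. t \<in> {0..1} \<Longrightarrow> \<gamma> t = ray b (\<phi> t)"
    using shortest_curve_is_ray[OF \<gamma>\<delta>(1)] by metis
  obtain d \<psi> where d: "d \<in> disc" "f d = p" "\<And>b'. b' \<in> disc \<Longrightarrow> f b' = p \<Longrightarrow> norm d \<le> norm b'"
    "monotone_reparam \<psi>" "\<And>t. t \<in> {0..1} \<Longrightarrow> \<delta> t = ray d (\<psi> t)"
    using shortest_curve_is_ray[OF \<gamma>\<delta>(2)] by metis
  \<comment> \<open>Otherwise \<gamma> and \<delta> would both be reparametrizations of the path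
    \<open>ray b\<close>.\<close>
  have "b \<noteq> d"
    using \<gamma>\<delta>(3) b d ray_path[OF b(1)] unfolding same_curve_def by blast
  show "p \<notin> f ` unique_min"
  proof
    assume "p \<in> f ` unique_min"
    then obtain m where m: "m \<in> disc" "p = f m"
      "\<And>b'. b' \<in> disc \<Longrightarrow> q b' = q m \<Longrightarrow> b' \<noteq> m \<Longrightarrow> norm m < norm b'"
      by (auto simp: unique_min_def)
    have "x = m" if x: "x \<in> disc" "f x = p" "norm x \<le> norm m" for x
      using m(3)[OF x(1)] x m(1,2) q_eq_iff by (metis not_less)
    then have "b = m" "d = m"
      using b d m by auto
    then show False
      using \<open>b \<noteq> d\<close> by simp
  qed
next
  assume np: "p \<notin> f ` unique_min"
  have "coord e p \<in> coord e ` \<Omega>"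
    using p by simp
  then obtain b where b: "b \<in> disc" "q b = coord e p"
    "\<And>b'. b' \<in> disc \<Longrightarrow> q b' = coord e p \<Longrightarrow> norm b \<le> norm b'"
    using fibre_attains_min by metis
  have fq: "f x = p \<longleftrightarrow> q x = coord e p" if "x \<in> disc" for x
    using that p omitted f_eq_coord_inv[OF that] by (metis coord_inv_coord q_def)
  have "b \<notin> unique_min"
    using np b fq by auto
  then obtain d where d: "d \<in> disc" "q d = q b" "d \<noteq> b" "\<not> norm b < norm d"
    using b(1) unfolding unique_min_def by blast
  have min: "norm d \<le> norm b'" if "b' \<in> disc" "q b' = coord e p" for b'
    using b(3)[OF that] d(4) by simp
  have "shortest_curve \<Omega> (f b) (f 0) (ray b)"
    using b fq by (intro shortest_ray) auto
  moreover have "shortest_curve \<Omega> (f d) (f 0) (ray d)"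
  proof (rule shortest_ray[OF d(1)])
    fix b' assume "b' \<in> disc" "f b' = f d"
    then show "norm d \<le> norm b'"
      using min q_eq_iff[OF _ d(1)] b(2) d(2) by auto
  qed
  moreover have "f b = p" "f d = p"
    using fq b d by auto
  moreover have "\<not> same_curve (ray b) (ray d)"
    using same_curve_rays[OF b(1) d(1)] d(3) by blast
  ultimately show "\<exists>\<gamma> \<delta>. shortest_curve \<Omega> p (f 0) \<gamma> \<and> shortest_curve \<Omega> p (f 0) \<delta> \<and> \<not> same_curve \<gamma> \<delta>"
    by metis
qed

lemma image_unique_min_eq: "f ` unique_min = coord_inv e ` (q ` unique_min)"
  unfolding image_image by (rule image_cong) (auto simp: unique_min_def f_eq_coord_inv)

lemma open_f_image_unique_min: "open (f ` unique_min)"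
proof -
  have "f ` unique_min = coord e -` (q ` unique_min) \<inter> - {Fin e}"
  proof (rule set_eqI)
    fix x
    show "x \<in> f ` unique_min \<longleftrightarrow> x \<in> coord e -` (q ` unique_min) \<inter> - {Fin e}"
    proof (cases "x = Fin e")
      case True
      have "f z \<noteq> Fin e" if "z \<in> unique_min" for z
        using that f_neq[of z] by (simp add: unique_min_def)
      then show ?thesis
        using True by (metis ComplD IntD2 imageE singletonI)
    next
      case False
      then show ?thesis
        unfolding image_unique_min_eq by (metis ComplI IntD1 IntI coord_coord_inv coord_inv_coord imageE
            image_eqI singletonD vimageD vimageI)
    qed
  qed
  then show ?thesis
    using continuous_on_coord[of e] open_image_unique_min
    by (simp add: continuous_on_open_vimage open_Compl_Fin)
qed

lemma closure_f_image_unique_min: "\<Omega> \<subseteq> closure (f ` unique_min)"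
proof
  fix p assume p: "p \<in> \<Omega>"
  show "p \<in> closure (f ` unique_min)"
    unfolding closure_iff_nhds_not_empty
  proof (intro allI impI)
    fix A V :: "csphere set"
    assume V: "V \<subseteq> A" "open V" "p \<in> V"
    define B where "B = coord_inv e -` V"
    have B: "open B"
      using continuous_on_coord_inv[of UNIV e] V(2) by (simp add: B_def continuous_on_open_vimage)
    have "p \<noteq> Fin e"
      using p omitted by auto
    then have "coord e p \<in> B"
      using V(3) by (simp add: B_def)
    moreover have "coord e p \<in> closure (q ` unique_min)"
      using image_unique_min_dense p by auto
    ultimately have "q ` unique_min \<inter> B \<noteq> {}"
      using B by (metis IntI disjoint_iff open_Int_closure_eq_empty Int_commute)
    then obtain z where z: "z \<in> unique_min" "q z \<in> B"
      by auto
    then have "f z \<in> V"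
      using f_eq_coord_inv by (auto simp: B_def unique_min_def)
    then show "f ` unique_min \<inter> A \<noteq> {}"
      using z(1) V(1) by auto
  qed
qed

end

subsection \<open>The Dirichlet domain\<close>

text \<open>\<open>lam r\<close> is the biholomorphic map \<open>z \<mapsto> r / z\<close> of the disc onto \<open>Lambda r\<close>.\<close>

definition lam :: "real \<Rightarrow> complex \<Rightarrow> csphere" where
  "lam r z = coord_inv 0 (z / of_real r)"

definition lam_inv :: "real \<Rightarrow> csphere \<Rightarrow> complex" where
  "lam_inv r x = of_real r * coord 0 x"

lemma Lambda_eq: "Lambda r = - (Fin ` cball 0 r)"
proof (rule set_eqI)
  show "x \<in> Lambda r \<longleftrightarrow> x \<in> - (Fin ` cball 0 r)" for x
    by (cases x) (auto simp: Lambda_def image_iff not_le)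
qed

lemma open_Lambda: "open (Lambda r)"
  unfolding Lambda_eq by (rule open_Compl_Fin_image) simp

lemma zero_notin_Lambda: "r > 0 \<Longrightarrow> Fin 0 \<notin> Lambda r"
  by (auto simp: Lambda_def)

lemma lam_0 [simp]: "lam r 0 = Infty"
  by (simp add: lam_def coord_inv_def)

lemma lam_inv_lam: "r > 0 \<Longrightarrow> lam_inv r (lam r z) = z"
  by (simp add: lam_def lam_inv_def)

lemma lam_lam_inv: "r > 0 \<Longrightarrow> x \<in> Lambda r \<Longrightarrow> lam r (lam_inv r x) = x"
  using zero_notin_Lambda[of r] coord_inv_coord[of x 0] by (auto simp: lam_def lam_inv_def simp del: coord_inv_coord)

lemma lam_in_Lambda: "r > 0 \<Longrightarrow> z \<in> disc \<Longrightarrow> lam r z \<in> Lambda r"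
  by (auto simp: lam_def coord_inv_def Lambda_def norm_divide pos_less_divide_eq)

lemma lam_inv_in_disc: "r > 0 \<Longrightarrow> x \<in> Lambda r \<Longrightarrow> lam_inv r x \<in> disc"
  by (cases x) (auto simp: lam_inv_def Lambda_def norm_divide divide_less_eq_1 simp flip: divide_inverse)

lemma homeomorphism_lam:
  assumes r: "r > 0"
  shows "homeomorphism disc (Lambda r) (lam r) (lam_inv r)"
proof (rule homeomorphismI)
  have "continuous_on disc (\<lambda>z. z / complex_of_real r)"
    using r by (intro continuous_intros) auto
  then show "continuous_on disc (lam r)"
    unfolding lam_def[abs_def] by (rule continuous_on_compose2[OF continuous_on_coord_inv[of UNIV]]) auto
  have "continuous_on (Lambda r) (coord 0)"
    using zero_notin_Lambda[OF r] by (intro continuous_on_subset[OF continuous_on_coord]) auto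
  then show "continuous_on (Lambda r) (lam_inv r)"
    unfolding lam_inv_def[abs_def] by (intro continuous_intros)
qed (use r lam_inv_lam lam_lam_inv lam_in_Lambda lam_inv_in_disc in blast)+

lemma bij_betw_lam:
  assumes "r > 0"
  shows "bij_betw (lam r) disc (Lambda r)" "bij_betw (lam_inv r) (Lambda r) disc"
  using homeomorphism_lam[OF assms]
  by (auto simp: homeomorphism_def bij_betw_def intro: inj_on_inverseI)

lemma chart_coord_inv_0: "chart p (coord_inv 0 v) = to_chart 0 p v"
  by (cases p) (simp_all add: coord_inv_def)

lemma coord_0_chart_inv: "coord 0 (chart_inv p v) = of_chart 0 p v"
  by (cases p) simp_all

lemma chart_inv_to_chart: "u \<in> to_chart_domain 0 p \<Longrightarrow> chart_inv p (to_chart 0 p u) = coord_inv 0 u"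
  by (cases p) (auto simp: coord_inv_def)

lemma to_chart_differentiable:
  assumes "p \<noteq> Fin e"
  shows "to_chart e p field_differentiable at (coord e p)"
  using to_chart_holomorphic open_to_chart_domain chart_nbhdD(1)[OF in_chart_nbhd[OF assms]]
  by (rule holomorphic_on_imp_differentiable_at)

lemma of_chart_differentiable:
  assumes "p \<noteq> Fin e"
  shows "of_chart e p field_differentiable at (chart p p)"
  using of_chart_holomorphic open_of_chart_domain chart_nbhdD(3)[OF in_chart_nbhd[OF assms]]
  by (rule holomorphic_on_imp_differentiable_at)

lemma to_chart_coord: "p \<noteq> Fin e \<Longrightarrow> to_chart e p (coord e p) = chart p p"
  and of_chart_chart: "p \<noteq> Fin e \<Longrightarrow> of_chart e p (chart p p) = coord e p"
  using chart_nbhdD in_chart_nbhd by metis+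

lemma homeomorphism_Fin_lam:
  assumes "r > 0"
  shows "homeomorphism (Fin ` disc) (Lambda r) (\<lambda>x. lam r (chart (Fin 0) x)) (Fin \<circ> lam_inv r)"
  using homeomorphism_compose[OF homeomorphism_symD[OF homeomorphism_Fin] homeomorphism_lam[OF assms]]
  by (simp only: comp_def)

lemma sphere_holomorphic_on_lam:
  assumes r: "r > 0" and G: "sphere_holomorphic_on G (Lambda r)"
  shows "sphere_holomorphic_on (\<lambda>x. G (lam r (chart (Fin 0) x))) (Fin ` disc)"
  unfolding sphere_holomorphic_on_def
proof (intro conjI ballI)
  show "continuous_on (Fin ` disc) (\<lambda>x. G (lam r (chart (Fin 0) x)))"
    by (rule continuous_on_compose2[of "Lambda r" G])
       (use G homeomorphism_Fin_lam[OF r] in \<open>auto simp: sphere_holomorphic_on_def homeomorphism_def\<close>)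
  fix x assume "x \<in> Fin ` disc"
  then obtain z where x: "x = Fin z" and z: "z \<in> disc"
    by auto
  define p where "p = lam r z"
  have pL: "p \<in> Lambda r"
    using lam_in_Lambda[OF r z] by (simp add: p_def)
  then have p0: "p \<noteq> Fin 0"
    using zero_notin_Lambda[OF r] by auto
  have cp: "coord 0 p = z / of_real r"
    by (simp add: p_def lam_def)
  define U where "U = (\<lambda>u. u / of_real r) -` to_chart_domain 0 p"
  have U: "open U"
    unfolding U_def using open_to_chart_domain r by (intro open_vimage continuous_intros) auto
  have zU: "z \<in> U"
    using chart_nbhdD(1)[OF in_chart_nbhd[OF p0]] by (simp add: U_def cp)
  have "(\<lambda>u. u / of_real r) field_differentiable at z"
    using r by (intro derivative_intros) auto
  moreover have "to_chart 0 p field_differentiable at (z / of_real r)"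
    using to_chart_differentiable[OF p0] by (simp add: cp)
  ultimately have "(to_chart 0 p \<circ> (\<lambda>u. u / of_real r)) field_differentiable at z"
    by (rule field_differentiable_compose)
  moreover have "(\<lambda>v. chart (G p) (G (chart_inv p v))) field_differentiable
      at ((to_chart 0 p \<circ> (\<lambda>u. u / of_real r)) z)"
    using G pL to_chart_coord[OF p0] by (simp add: sphere_holomorphic_on_def cp)
  ultimately have "((\<lambda>v. chart (G p) (G (chart_inv p v))) \<circ> (to_chart 0 p \<circ> (\<lambda>u. u / of_real r)))
      field_differentiable at z"
    by (rule field_differentiable_compose)
  then have "(\<lambda>u. chart (G p) (G (lam r u))) field_differentiable at z"
    using U zU by (rule field_differentiable_transform_open) (simp add: U_def chart_inv_to_chart lam_def)
  then show "(\<lambda>u. chart (G (lam r (chart (Fin 0) x))) (G (lam r (chart (Fin 0) (chart_inv x u)))))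
      field_differentiable at (chart x x)"
    by (simp add: x p_def)
qed

text \<open>Stated for general \<open>G\<close> because it serves both for \<open>g\<close> and for
  a deck transformation, which covers \<open>Lambda r\<close> by itself.\<close>

lemma covering_lam:
  assumes r: "r > 0" and cov: "covering_space (Lambda r) G \<Omega>" and hol: "sphere_holomorphic_on G (Lambda r)"
  shows "holomorphic_universal_covering (Fin ` disc) (\<lambda>x. G (lam r (chart (Fin 0) x))) \<Omega>"
  unfolding holomorphic_universal_covering_def
proof (intro conjI)
  have "disc homeomorphic Fin ` disc"
    using homeomorphism_Fin homeomorphic_def by blast
  then show "simply_connected (Fin ` disc)"
    using homeomorphic_simply_connected convex_imp_simply_connected convex_ball by blast
  show "covering_space (Fin ` disc) (\<lambda>x. G (lam r (chart (Fin 0) x))) \<Omega>"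
    using covering_space_compose_homeomorphism_right[OF cov homeomorphism_Fin_lam[OF r]]
    by (simp only: comp_def)
  show "sphere_holomorphic_on (\<lambda>x. G (lam r (chart (Fin 0) x))) (Fin ` disc)"
    by (rule sphere_holomorphic_on_lam[OF r hol])
qed

lemma sphere_holomorphic_ident: "sphere_holomorphic_on (\<lambda>x. x) A"
proof -
  have *: "chart p (chart_inv p u) = u" for p u
    by (cases p) auto
  show ?thesis
    by (simp add: sphere_holomorphic_on_def *)
qed

lemma sphere_holomorphic_conjugate:
  assumes r: "r > 0" and \<phi>: "\<phi> holomorphic_on disc" "\<phi> \<in> disc \<rightarrow> disc"
  shows "sphere_holomorphic_on (\<lambda>x. lam r (\<phi> (lam_inv r x))) (Lambda r)"
  unfolding sphere_holomorphic_on_def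
proof (intro conjI ballI)
  have lam: "continuous_on disc (lam r)" "continuous_on (Lambda r) (lam_inv r)" "lam_inv r ` Lambda r = disc"
    using homeomorphism_lam[OF r] by (simp_all add: homeomorphism_def)
  have "continuous_on (Lambda r) (\<lambda>x. \<phi> (lam_inv r x))"
    by (rule continuous_on_compose2[OF holomorphic_on_imp_continuous_on[OF \<phi>(1)] lam(2)]) (simp add: lam(3))
  then show "continuous_on (Lambda r) (\<lambda>x. lam r (\<phi> (lam_inv r x)))"
    by (rule continuous_on_compose2[OF lam(1)]) (use lam(3) \<phi>(2) in blast)
  fix p assume p: "p \<in> Lambda r"
  define z where "z = lam_inv r p"
  define p' where "p' = lam r (\<phi> z)"
  have z: "z \<in> disc"
    using lam_inv_in_disc[OF r p] by (simp add: z_def)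
  then have "p' \<in> Lambda r"
    unfolding p'_def by (intro lam_in_Lambda[OF r] funcset_mem[OF \<phi>(2)])
  then have p0: "p \<noteq> Fin 0" "p' \<noteq> Fin 0"
    using p zero_notin_Lambda[OF r] by auto
  have "(\<lambda>u. of_real r * of_chart 0 p u) field_differentiable at (chart p p)"
    using of_chart_differentiable[OF p0(1)] by (intro field_differentiable_mult) auto
  moreover have zeq: "of_real r * of_chart 0 p (chart p p) = z"
    using of_chart_chart[OF p0(1)] by (simp add: z_def lam_inv_def)
  moreover have "\<phi> field_differentiable at (of_real r * of_chart 0 p (chart p p))"
    unfolding zeq using \<phi>(1) open_ball z by (rule holomorphic_on_imp_differentiable_at)
  ultimately have 1: "(\<phi> \<circ> (\<lambda>u. of_real r * of_chart 0 p u)) field_differentiable at (chart p p)"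
    by (rule_tac field_differentiable_compose)
  have "(\<lambda>w. w / of_real r) field_differentiable at (\<phi> z)"
    using r by (intro derivative_intros) auto
  moreover have "to_chart 0 p' field_differentiable at (\<phi> z / of_real r)"
    using to_chart_differentiable[OF p0(2)] by (simp add: p'_def lam_def)
  ultimately have "(to_chart 0 p' \<circ> (\<lambda>w. w / of_real r)) field_differentiable at (\<phi> z)"
    by (rule field_differentiable_compose)
  then have "(to_chart 0 p' \<circ> (\<lambda>w. w / of_real r)) field_differentiable
      at ((\<phi> \<circ> (\<lambda>u. of_real r * of_chart 0 p u)) (chart p p))"
    by (simp only: o_apply zeq)
  with 1 have "((to_chart 0 p' \<circ> (\<lambda>w. w / of_real r)) \<circ> (\<phi> \<circ> (\<lambda>u. of_real r * of_chart 0 p u)))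
      field_differentiable at (chart p p)"
    by (rule field_differentiable_compose)
  moreover have "(to_chart 0 p' \<circ> (\<lambda>w. w / of_real r)) \<circ> (\<phi> \<circ> (\<lambda>u. of_real r * of_chart 0 p u)) =
      (\<lambda>u. chart p' (lam r (\<phi> (lam_inv r (chart_inv p u)))))"
    by (simp add: fun_eq_iff lam_def lam_inv_def chart_coord_inv_0 coord_0_chart_inv)
  ultimately show "(\<lambda>u. chart (lam r (\<phi> (lam_inv r p))) (lam r (\<phi> (lam_inv r (chart_inv p u)))))
      field_differentiable at (chart p p)"
    by (simp add: p'_def z_def)
qed

text \<open>\<open>Fin\<close> is an open embedding, so interiors may be computed in the plane; the
  closure of the complement omits just the interior of the closed set \<open>E\<close>.\<close>

lemma closure_Compl_Fin_image:
  assumes "compact E"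
  shows "closure (- (Fin ` E)) = - (Fin ` E) \<union> Fin ` frontier E"
proof -
  have "interior (Fin ` E) = Fin ` interior E"
  proof
    have op: "open (Fin -` interior (Fin ` E))"
      using open_interior[of "Fin ` E"] by (simp add: open_csphere_iff)
    have "Fin -` interior (Fin ` E) \<subseteq> E"
      using interior_subset[of "Fin ` E"] by blast
    then have "Fin -` interior (Fin ` E) \<subseteq> interior E"
      using op by (rule interior_maximal)
    then show "interior (Fin ` E) \<subseteq> Fin ` interior E"
      using interior_subset[of "Fin ` E"] by blast
    show "Fin ` interior E \<subseteq> interior (Fin ` E)"
      by (intro interior_maximal open_Fin_image image_mono interior_subset) simp
  qed
  moreover have "Fin ` frontier E = Fin ` E - Fin ` interior E"
    using compact_imp_closed[OF assms]
    by (simp add: frontier_def closure_closed image_set_diff[symmetric] inj_def)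
  moreover have "Fin ` interior E \<subseteq> Fin ` E"
    by (intro image_mono interior_subset)
  ultimately show ?thesis
    unfolding closure_complement by blast
qed

section \<open>Deck group, Dirichlet domain and boundary\<close>

locale normalized_covering =
  fixes E :: "complex set" and r :: real and g :: "csphere \<Rightarrow> csphere" and e :: complex
  assumes compact_E: "compact E" and e_in_E: "e \<in> E" and r_pos: "r > 0"
    and covering_g: "covering_space (Lambda r) g (- (Fin ` E))"
    and holomorphic_g: "sphere_holomorphic_on g (Lambda r)"
    and g_Infty: "g Infty = Infty"
begin

sublocale sphere_covering "\<lambda>x. g (lam r (chart (Fin 0) x))" "- (Fin ` E)" e
proof
  show "holomorphic_universal_covering (Fin ` disc) (\<lambda>x. g (lam r (chart (Fin 0) x))) (- Fin ` E)"
    using r_pos covering_g holomorphic_g by (rule covering_lam)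
  show "Fin e \<notin> - Fin ` E"
    using e_in_E by simp
  show "open (- Fin ` E)"
    using compact_E by (rule open_Compl_Fin_image)
qed

lemma f_eq: "f z = g (lam r z)"
  by (simp add: f_def)

lemma f_0: "f 0 = Infty"
  by (simp add: f_eq g_Infty)

lemma automorphism_fixing_point:
  assumes "disc_automorphism \<phi> \<psi>" and "\<And>z. z \<in> disc \<Longrightarrow> q (\<phi> z) = q z"
    and "a \<in> disc" "\<phi> a = a" "z \<in> disc"
  shows "\<phi> z = z"
proof -
  have "\<phi> \<in> disc \<rightarrow> disc" "continuous_on disc \<phi>"
    using assms(1) by (simp_all add: disc_automorphism_def holomorphic_on_imp_continuous_on)
  then have "\<phi> z = id z"
    using lift_unique[of \<phi> id a z] assms by simp
  then show ?thesis
    by simp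
qed

text \<open>With \<open>automorphism_in_deck_group\<close> this identifies the deck group,
  conjugated by \<open>lam r\<close>, with the disc automorphisms that preserve
  \<open>q\<close>.\<close>

lemma deck_group_automorphism:
  assumes \<tau>: "\<tau> \<in> deck_group (Lambda r) g"
  obtains \<phi> \<psi> where "disc_automorphism \<phi> \<psi>" "\<And>z. z \<in> disc \<Longrightarrow> \<tau> (lam r z) = lam r (\<phi> z)"
    "\<And>z. z \<in> disc \<Longrightarrow> q (\<phi> z) = q z"
proof -
  have bij: "bij_betw \<tau> (Lambda r) (Lambda r)" and hol\<tau>: "sphere_holomorphic_on \<tau> (Lambda r)"
    and g\<tau>: "\<And>w. w \<in> Lambda r \<Longrightarrow> g (\<tau> w) = g w"
    using \<tau> by (auto simp: deck_group_def)
  have \<tau>L: "\<tau> (lam r z) \<in> Lambda r" if "z \<in> disc" for z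
    using bij lam_in_Lambda[OF r_pos that] by (auto simp: bij_betw_def)
  define \<phi> where "\<phi> z = lam_inv r (\<tau> (lam r z))" for z
  have "(\<lambda>z. coord 0 (\<tau> (lam r (chart (Fin 0) (Fin z))))) holomorphic_on disc"
  proof (rule sphere_holomorphic_disc)
    show "sphere_holomorphic_on (\<lambda>x. \<tau> (lam r (chart (Fin 0) x))) (Fin ` disc)"
      using r_pos hol\<tau> by (rule sphere_holomorphic_on_lam)
    show "\<tau> (lam r (chart (Fin 0) (Fin z))) \<noteq> Fin 0" if "z \<in> disc" for z
      using \<tau>L[OF that] zero_notin_Lambda[OF r_pos] by auto
  qed
  then have hol\<phi>: "\<phi> holomorphic_on disc"
    unfolding \<phi>_def[abs_def] lam_inv_def by (auto intro: holomorphic_intros)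
  note homs = bij_betw_lam[OF r_pos]
  have "bij_betw (lam_inv r \<circ> (\<tau> \<circ> lam r)) disc disc"
    by (intro bij_betw_trans[OF bij_betw_trans[OF homs(1) bij] homs(2)])
  then have bij\<phi>: "inj_on \<phi> disc" "\<phi> ` disc = disc"
    by (simp_all add: bij_betw_def \<phi>_def[abs_def] comp_def)
  \<comment> \<open>An injective holomorphic map has a holomorphic inverse on its image, here the
    whole disc.\<close>
  obtain \<psi> where \<psi>: "\<psi> holomorphic_on disc" "\<And>z. z \<in> disc \<Longrightarrow> \<psi> (\<phi> z) = z"
    using holomorphic_has_inverse[OF hol\<phi> open_ball bij\<phi>(1)] bij\<phi>(2) by metis
  have "\<psi> w \<in> disc \<and> \<phi> (\<psi> w) = w" if "w \<in> disc" for w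
  proof -
    have "w \<in> \<phi> ` disc"
      using that bij\<phi>(2) by simp
    then obtain z where "z \<in> disc" "w = \<phi> z"
      by blast
    then show ?thesis
      using \<psi>(2) by simp
  qed
  moreover have "\<phi> \<in> disc \<rightarrow> disc"
    using bij\<phi>(2) by (simp flip: image_subset_iff_funcset)
  ultimately have "disc_automorphism \<phi> \<psi>"
    using hol\<phi> \<psi> by (simp add: disc_automorphism_def)
  moreover have \<tau>\<phi>: "\<tau> (lam r z) = lam r (\<phi> z)" if "z \<in> disc" for z
    using lam_lam_inv[OF r_pos \<tau>L[OF that]] by (simp add: \<phi>_def)
  moreover have "q (\<phi> z) = q z" if z: "z \<in> disc" for z
    using g\<tau>[OF lam_in_Lambda[OF r_pos z]] \<tau>\<phi>[OF z] by (simp add: q_def f_eq)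
  ultimately show thesis
    using that by blast
qed

lemma automorphism_in_deck_group:
  assumes aut: "disc_automorphism \<phi> \<psi>" and q\<phi>: "\<And>z. z \<in> disc \<Longrightarrow> q (\<phi> z) = q z"
  shows "(\<lambda>x. lam r (\<phi> (lam_inv r x))) \<in> deck_group (Lambda r) g"
  unfolding deck_group_def mem_Collect_eq
proof (intro conjI ballI)
  have \<phi>: "\<phi> holomorphic_on disc" "\<phi> \<in> disc \<rightarrow> disc"
    using aut by (simp_all add: disc_automorphism_def)
  have \<psi>: "\<psi> \<in> disc \<rightarrow> disc"
    using aut by (simp add: disc_automorphism_def)
  have inv: "\<And>z. z \<in> disc \<Longrightarrow> \<psi> (\<phi> z) = z" "\<And>z. z \<in> disc \<Longrightarrow> \<phi> (\<psi> z) = z"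
    using aut by (simp_all add: disc_automorphism_def)
  note homs = bij_betw_lam[OF r_pos]
  have "bij_betw \<phi> disc disc"
    by (rule bij_betw_byWitness[of _ \<psi>]) (use inv \<phi>(2) \<psi> in auto)
  then have "bij_betw (lam r \<circ> (\<phi> \<circ> lam_inv r)) (Lambda r) (Lambda r)"
    by (intro bij_betw_trans[OF bij_betw_trans[OF homs(2)] homs(1)])
  then show "bij_betw (\<lambda>x. lam r (\<phi> (lam_inv r x))) (Lambda r) (Lambda r)"
    by (simp add: comp_def)
  show "sphere_holomorphic_on (\<lambda>x. lam r (\<phi> (lam_inv r x))) (Lambda r)"
    using r_pos \<phi> by (rule sphere_holomorphic_conjugate)
  fix w assume w: "w \<in> Lambda r"
  have z: "lam_inv r w \<in> disc"
    using r_pos w by (rule lam_inv_in_disc)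
  then have "\<phi> (lam_inv r w) \<in> disc"
    using \<phi>(2) by blast
  then have "f (\<phi> (lam_inv r w)) = f (lam_inv r w)"
    using q\<phi>[OF z] z q_eq_iff by blast
  then show "g (lam r (\<phi> (lam_inv r w))) = g w"
    using lam_lam_inv[OF r_pos w] by (simp add: f_eq)
qed

text \<open>Composing \<tau> with \<open>lam r\<close> gives an injective covering of
  \<open>Lambda r\<close> whose centre is \<open>\<tau> Infty\<close>. So the distance formula for
  the centre applies, and \<tau> need not first be shown to preserve distances.\<close>

lemma hyp_dist_Lambda:
  assumes hol: "sphere_holomorphic_on \<tau> (Lambda r)" and hom: "homeomorphism (Lambda r) (Lambda r) \<tau> \<tau>'"
    and b: "b \<in> disc"
  shows "hyp_dist (Lambda r) (\<tau> Infty) (\<tau> (lam r b)) = ennreal (2 * artanh (norm b))"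
proof -
  interpret T: sphere_covering "\<lambda>x. \<tau> (lam r (chart (Fin 0) x))" "Lambda r" 0
  proof
    show "holomorphic_universal_covering (Fin ` disc) (\<lambda>x. \<tau> (lam r (chart (Fin 0) x))) (Lambda r)"
      using r_pos homeomorphism_imp_covering_space[OF hom] hol by (rule covering_lam)
    show "Fin 0 \<notin> Lambda r"
      using r_pos by (rule zero_notin_Lambda)
    show "open (Lambda r)"
      by (rule open_Lambda)
  qed
  have Tf: "T.f z = \<tau> (lam r z)" for z
    by (simp add: T.f_def)
  have "inj_on T.f disc"
  proof (rule inj_onI)
    fix x y assume xy: "x \<in> disc" "y \<in> disc" "T.f x = T.f y"
    then have "\<tau>' (\<tau> (lam r x)) = \<tau>' (\<tau> (lam r y))"
      by (simp add: Tf)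
    then have "lam r x = lam r y"
      using homeomorphism_apply1[OF hom] lam_in_Lambda[OF r_pos] xy by simp
    then show "x = y"
      using lam_inv_lam[OF r_pos] by metis
  qed
  then show ?thesis
    using T.hyp_dist_injective[OF _ b] by (simp add: Tf)
qed

text \<open>The point \<open>lam r b\<close> is the image under \<tau> of
  \<open>lam r (\<psi> b)\<close>, so its distance from \<open>\<tau> Infty\<close> is that of
  \<open>\<psi> b\<close> from 0 in the disc.\<close>

lemma hyp_dist_Lambda_deck:
  assumes \<tau>: "\<tau> \<in> deck_group (Lambda r) g" and aut: "disc_automorphism \<phi> \<psi>"
    and eq: "\<And>z. z \<in> disc \<Longrightarrow> \<tau> (lam r z) = lam r (\<phi> z)" and b: "b \<in> disc"
  shows "hyp_dist (Lambda r) (\<tau> Infty) (lam r b) = ennreal (2 * artanh (norm (\<psi> b)))"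
proof -
  have hol\<tau>: "sphere_holomorphic_on \<tau> (Lambda r)"
    using \<tau> by (simp add: deck_group_def)
  have aut': "\<psi> holomorphic_on disc" "\<psi> \<in> disc \<rightarrow> disc" "\<phi> \<in> disc \<rightarrow> disc"
    "\<And>z. z \<in> disc \<Longrightarrow> \<psi> (\<phi> z) = z" "\<And>z. z \<in> disc \<Longrightarrow> \<phi> (\<psi> z) = z"
    using aut by (simp_all add: disc_automorphism_def)
  define \<tau>' where "\<tau>' x = lam r (\<psi> (lam_inv r x))" for x
  have \<tau>eq: "\<tau> x = lam r (\<phi> (lam_inv r x))" if "x \<in> Lambda r" for x
    using eq[OF lam_inv_in_disc[OF r_pos that]] lam_lam_inv[OF r_pos that] by simp
  have "homeomorphism (Lambda r) (Lambda r) \<tau> \<tau>'"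
  proof (rule homeomorphismI)
    show "continuous_on (Lambda r) \<tau>"
      using hol\<tau> by (simp add: sphere_holomorphic_on_def)
    show "continuous_on (Lambda r) \<tau>'"
      using sphere_holomorphic_conjugate[OF r_pos aut'(1,2)]
      by (simp add: sphere_holomorphic_on_def \<tau>'_def[abs_def])
    show "\<tau> ` Lambda r \<subseteq> Lambda r"
      using \<tau> by (auto simp: deck_group_def bij_betw_def)
    have L: "lam_inv r x \<in> disc" if "x \<in> Lambda r" for x
      using lam_inv_in_disc[OF r_pos that] .
    show "\<tau>' ` Lambda r \<subseteq> Lambda r"
      using L aut'(2) lam_in_Lambda[OF r_pos] by (auto simp: \<tau>'_def Pi_iff)
    show "\<tau>' (\<tau> x) = x" if x: "x \<in> Lambda r" for x
      using aut'(4)[OF L[OF x]] lam_lam_inv[OF r_pos x] lam_inv_lam[OF r_pos]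
      by (simp add: \<tau>eq[OF x] \<tau>'_def)
    show "\<tau> (\<tau>' x) = x" if x: "x \<in> Lambda r" for x
    proof -
      have \<psi>x: "\<psi> (lam_inv r x) \<in> disc"
        using aut'(2) L[OF x] by blast
      have "\<tau> (\<tau>' x) = lam r (\<phi> (\<psi> (lam_inv r x)))"
        using eq[OF \<psi>x] by (simp add: \<tau>'_def)
      then show ?thesis
        using aut'(5)[OF L[OF x]] lam_lam_inv[OF r_pos x] by simp
    qed
  qed
  moreover have \<psi>b: "\<psi> b \<in> disc"
    using aut'(2) b by blast
  ultimately have "hyp_dist (Lambda r) (\<tau> Infty) (\<tau> (lam r (\<psi> b))) = ennreal (2 * artanh (norm (\<psi> b)))"
    using hyp_dist_Lambda[OF hol\<tau>] by blast
  then show ?thesis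
    using eq[OF \<psi>b] aut'(5)[OF b] by simp
qed

lemma dist_less_iff:
  assumes "a \<in> disc" "b \<in> disc"
  shows "ennreal (2 * artanh (norm a)) < ennreal (2 * artanh (norm b)) \<longleftrightarrow> norm a < norm b"
proof -
  have "ennreal (2 * artanh (norm b)) \<le> ennreal (2 * artanh (norm a)) \<longleftrightarrow> norm b \<le> norm a"
    using assms artanh_nonneg[of "norm a"] artanh_le_iff[of "norm b" "norm a"] by (simp add: ennreal_le_iff)
  then show ?thesis
    by (metis not_less)
qed

text \<open>A competitor in the fibre of \<open>b\<close> is \<open>\<psi> b\<close> for a deck
  transformation, and its distance from 0 is the distance of \<open>lam r b\<close> from
  \<open>\<tau> Infty\<close>. The two exclusions match: an automorphism over \<open>q\<close> that
  fixes 0, or fixes \<open>b\<close>, is the identity.\<close>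

lemma lam_in_dirichlet_domain_iff:
  assumes b: "b \<in> disc"
  shows "lam r b \<in> dirichlet_domain r g \<longleftrightarrow> b \<in> unique_min"
proof -
  have d0: "hyp_dist (Lambda r) Infty (lam r b) = ennreal (2 * artanh (norm b))"
    using hyp_dist_Lambda[OF sphere_holomorphic_ident _ b, of "\<lambda>x. x"] by (simp add: homeomorphism_def)
  have D: "lam r b \<in> dirichlet_domain r g \<longleftrightarrow> (\<forall>\<tau>\<in>deck_group (Lambda r) g. \<tau> Infty \<noteq> Infty \<longrightarrow>
      ennreal (2 * artanh (norm b)) < hyp_dist (Lambda r) (\<tau> Infty) (lam r b))"
    using lam_in_Lambda[OF r_pos b] by (simp add: dirichlet_domain_def d0)
  show ?thesis
  proof
    assume dir: "lam r b \<in> dirichlet_domain r g"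
    have "norm b < norm b'" if b': "b' \<in> disc" "q b' = q b" "b' \<noteq> b" for b'
    proof -
      obtain \<phi> \<psi> where \<phi>: "disc_automorphism \<phi> \<psi>" "\<phi> b' = b" "\<And>z. z \<in> disc \<Longrightarrow> q (\<phi> z) = q z"
        using disc_coverings_automorphism[OF disc_covering_q disc_covering_q b'(1) b b'(2)] by metis
      define \<tau> where "\<tau> x = lam r (\<phi> (lam_inv r x))" for x
      have \<tau>: "\<tau> \<in> deck_group (Lambda r) g"
        unfolding \<tau>_def[abs_def] using \<phi>(1,3) by (rule automorphism_in_deck_group)
      have \<tau>lam: "\<tau> (lam r z) = lam r (\<phi> z)" for z
        by (simp add: \<tau>_def lam_inv_lam[OF r_pos])
      have "\<tau> Infty \<noteq> Infty"
      proof
        assume "\<tau> Infty = Infty"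
        then have "lam r (\<phi> 0) = lam r 0"
          using \<tau>lam[of 0] by simp
        then have "\<phi> 0 = 0"
          using lam_inv_lam[OF r_pos] by metis
        then have "\<phi> b' = b'"
          using automorphism_fixing_point[OF \<phi>(1,3), of 0 b'] b'(1) by simp
        then show False
          using \<phi>(2) b'(3) by simp
      qed
      then have "ennreal (2 * artanh (norm b)) < hyp_dist (Lambda r) (\<tau> Infty) (lam r b)"
        using dir D \<tau> by blast
      also have "\<dots> = ennreal (2 * artanh (norm (\<psi> b)))"
        using \<tau> \<phi>(1) \<tau>lam b by (rule hyp_dist_Lambda_deck)
      also have "\<psi> b = b'"
        using \<phi>(1,2) b'(1) by (auto simp: disc_automorphism_def)
      finally show ?thesis
        using dist_less_iff[OF b b'(1)] by blast
    qed
    then show "b \<in> unique_min"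
      using b by (simp add: unique_min_def)
  next
    assume min: "b \<in> unique_min"
    show "lam r b \<in> dirichlet_domain r g"
      unfolding D
    proof (intro ballI impI)
      fix \<tau> assume \<tau>: "\<tau> \<in> deck_group (Lambda r) g" and ne: "\<tau> Infty \<noteq> Infty"
      obtain \<phi> \<psi> where \<phi>: "disc_automorphism \<phi> \<psi>" "\<And>z. z \<in> disc \<Longrightarrow> \<tau> (lam r z) = lam r (\<phi> z)"
        "\<And>z. z \<in> disc \<Longrightarrow> q (\<phi> z) = q z"
        using deck_group_automorphism[OF \<tau>] by metis
      have \<psi>b: "\<psi> b \<in> disc" "\<phi> (\<psi> b) = b"
        using \<phi>(1) b by (auto simp: disc_automorphism_def)
      have "\<psi> b \<noteq> b"
      proof
        assume "\<psi> b = b"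
        then have "\<phi> 0 = 0"
          using automorphism_fixing_point[OF \<phi>(1,3) b, of 0] \<psi>b(2) by simp
        then show False
          using ne \<phi>(2)[of 0] by simp
      qed
      then have "norm b < norm (\<psi> b)"
        using min \<psi>b \<phi>(3)[OF \<psi>b(1)] by (simp add: unique_min_def)
      then show "ennreal (2 * artanh (norm b)) < hyp_dist (Lambda r) (\<tau> Infty) (lam r b)"
        using dist_less_iff[OF b \<psi>b(1)] hyp_dist_Lambda_deck[OF \<tau> \<phi>(1,2) b] by simp
    qed
  qed
qed

lemma image_dirichlet_domain: "g ` dirichlet_domain r g = f ` unique_min"
proof -
  have "dirichlet_domain r g = lam r ` unique_min"
  proof (intro equalityI subsetI)
    fix w assume w: "w \<in> dirichlet_domain r g"
    then have wL: "w \<in> Lambda r"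
      by (simp add: dirichlet_domain_def)
    then have "lam_inv r w \<in> unique_min"
      using lam_in_dirichlet_domain_iff[OF lam_inv_in_disc[OF r_pos wL]] w lam_lam_inv[OF r_pos wL] by simp
    then show "w \<in> lam r ` unique_min"
      using lam_lam_inv[OF r_pos wL] by (metis imageI)
  next
    fix w assume "w \<in> lam r ` unique_min"
    then obtain b where "b \<in> unique_min" "w = lam r b"
      by blast
    then show "w \<in> dirichlet_domain r g"
      using lam_in_dirichlet_domain_iff[of b] by (simp add: unique_min_def)
  qed
  then show ?thesis
    by (simp add: image_image f_eq)
qed

text \<open>The image \<open>A\<close> is open, so its boundary is closure minus \<open>A\<close>.
  By density the closure is that of the complement of \<open>E\<close>, which adds exactly the
  boundary of \<open>E\<close>; what remains inside the complement are the points with several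
  shortest curves.\<close>

lemma E_tilde_eq: "E_tilde E = frontier (g ` dirichlet_domain r g)"
proof -
  define A where "A = f ` unique_min"
  have A: "A \<subseteq> - (Fin ` E)"
    using f_maps by (auto simp: A_def unique_min_def)
  have E: "E_tilde E = Fin ` frontier E \<union> {p \<in> - (Fin ` E). p \<notin> A}"
    unfolding E_tilde_def Let_def A_def
    using several_shortest_curves_iff[unfolded f_0] by auto
  have "frontier (g ` dirichlet_domain r g) = closure A - A"
    using open_f_image_unique_min by (simp add: frontier_def image_dirichlet_domain A_def interior_open)
  moreover have "closure A = - (Fin ` E) \<union> Fin ` frontier E"
  proof
    show "closure A \<subseteq> - (Fin ` E) \<union> Fin ` frontier E"
      using closure_mono[OF A] closure_Compl_Fin_image[OF compact_E] by simp
    have "closure (- (Fin ` E)) \<subseteq> closure A"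
      using closure_f_image_unique_min by (simp add: A_def closure_minimal)
    then show "- (Fin ` E) \<union> Fin ` frontier E \<subseteq> closure A"
      using closure_Compl_Fin_image[OF compact_E] by simp
  qed
  moreover have "Fin ` frontier E \<inter> A = {}"
    using A frontier_subset_compact[OF compact_E] by auto
  ultimately have "frontier (g ` dirichlet_domain r g) = (- (Fin ` E) - A) \<union> Fin ` frontier E"
    by (simp add: Un_Diff Diff_triv)
  with E show ?thesis
    by auto
qed

end

theorem corollary16:
  fixes E :: "complex set" and r :: real and g :: "csphere \<Rightarrow> csphere"
  assumes "compact E"
    and "finite E \<longrightarrow> card E > 2"
    and "connected (- (Fin ` E))"
    and "normalized_universal_covering r g (- (Fin ` E))"
  shows "E_tilde E = frontier (g ` dirichlet_domain r g)"
proof -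
  \<comment> \<open>The empty set is finite with cardinality 0. Any point of \<open>E\<close> can
    serve as the pole of the coordinate.\<close>
  have "E \<noteq> {}"
    using assms(2) by auto
  then obtain e where "e \<in> E"
    by blast
  then interpret normalized_covering E r g e
    using assms(1,4) unfolding normalized_universal_covering_def holomorphic_universal_covering_def
      normalized_at_Infty_def 
    by (intro normalized_covering.intro) auto
  show ?thesis
    by (rule E_tilde_eq)
qed

end
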